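(* Let $T$ be a triangle without any pair of sides with lengths $a$ and $b$ such that $b/a$ is a rational number other than $1$. If $T$ is (i) acute, or (ii) isosceles and oblique, then every reptiling of $T$ is trivial.
   Context: An $r$-reptiling of a triangle $T$ ($r \ge 2$) is a subdivision of $T$ into $r$ triangles (tiles) with pairwise disjoint interiors, each similar to $T$ and all mutually congruent; necessarily $r=n^2$ for some integer $n$. The trivial $n^2$-reptiling of $T$ is obtained by dividing every side of $T$ into $n$ segments of equal length and drawing all lines parallel to the sides of $T$ through the endpoints of these segments; a reptiling is trivial if it equals this subdivision. A triangle is acute if all angles are less than $\pi/2$, and oblique if it is not a right triangle. *)

theory Defs
  imports "HOL-Analysis.Analysis"
begin

type_synonym plane = "real ^ 2"

text \<open>A triangle is the full (closed, two-dimensional) region. Notions that depend on sides or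
  angles take the three vertices as arguments; none of them depends on the order of the vertices.\<close>

definition is_triangle :: "plane set \<Rightarrow> bool" where
  "is_triangle K \<longleftrightarrow> (\<exists>A B C. \<not> collinear {A, B, C} \<and> K = convex hull {A, B, C})"

definition side_lengths :: "plane \<Rightarrow> plane \<Rightarrow> plane \<Rightarrow> real set" where
  "side_lengths A B C = {dist A B, dist B C, dist C A}"

definition angle_at :: "plane \<Rightarrow> plane \<Rightarrow> plane \<Rightarrow> real" where
  "angle_at V P Q = arccos (((P - V) \<bullet> (Q - V)) / (norm (P - V) * norm (Q - V)))"

definition triangle_angles :: "plane \<Rightarrow> plane \<Rightarrow> plane \<Rightarrow> real set" where
  "triangle_angles A B C = {angle_at A B C, angle_at B C A, angle_at C A B}"

definition acute_triangle :: "plane \<Rightarrow> plane \<Rightarrow> plane \<Rightarrow> bool" where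
  "acute_triangle A B C \<longleftrightarrow> (\<forall>\<theta>\<in>triangle_angles A B C. \<theta> < pi / 2)"

definition right_triangle :: "plane \<Rightarrow> plane \<Rightarrow> plane \<Rightarrow> bool" where
  "right_triangle A B C \<longleftrightarrow> (\<exists>\<theta>\<in>triangle_angles A B C. \<theta> = pi / 2)"

definition oblique_triangle :: "plane \<Rightarrow> plane \<Rightarrow> plane \<Rightarrow> bool" where
  "oblique_triangle A B C \<longleftrightarrow> \<not> right_triangle A B C"

definition isosceles_triangle :: "plane \<Rightarrow> plane \<Rightarrow> plane \<Rightarrow> bool" where
  "isosceles_triangle A B C \<longleftrightarrow> dist A B = dist B C \<or> dist B C = dist C A \<or> dist C A = dist A B"

text \<open>Similarity and congruence allow orientation-reversing maps, so mirror images of a tile count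
  as congruent to it.\<close>

definition similar_sets :: "plane set \<Rightarrow> plane set \<Rightarrow> bool" where
  "similar_sets S K \<longleftrightarrow>
     (\<exists>f c. 0 < c \<and> (\<forall>x y. dist (f x) (f y) = c * dist x y) \<and> f ` S = K)"

definition congruent_sets :: "plane set \<Rightarrow> plane set \<Rightarrow> bool" where
  "congruent_sets S K \<longleftrightarrow> (\<exists>f. (\<forall>x y. dist (f x) (f y) = dist x y) \<and> f ` S = K)"

text \<open>Tilings are not required to be edge-to-edge.\<close>

definition reptiling :: "nat \<Rightarrow> plane set \<Rightarrow> plane set set \<Rightarrow> bool" where
  "reptiling r T \<P> \<longleftrightarrow>
     2 \<le> r \<and> finite \<P> \<and> card \<P> = r \<and> \<Union>\<P> = T \<and>
     (\<forall>K\<in>\<P>. is_triangle K \<and> similar_sets T K) \<and>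
     (\<forall>K\<in>\<P>. \<forall>L\<in>\<P>. congruent_sets K L) \<and>
     (\<forall>K\<in>\<P>. \<forall>L\<in>\<P>. K \<noteq> L \<longrightarrow> interior K \<inter> interior L = {})"

definition sides :: "plane \<Rightarrow> plane \<Rightarrow> plane \<Rightarrow> (plane \<times> plane) set" where
  "sides A B C = {(A, B), (B, C), (C, A)}"

definition division_points :: "nat \<Rightarrow> plane \<Rightarrow> plane \<Rightarrow> plane \<Rightarrow> plane set" where
  "division_points n A B C =
     {P + (real k / real n) *\<^sub>R (Q - P) | P Q k. (P, Q) \<in> sides A B C \<and> k \<le> n}"

definition line_through :: "plane \<Rightarrow> plane \<Rightarrow> plane set" where
  "line_through p v = range (\<lambda>t::real. p + t *\<^sub>R v)"

definition grid_lines :: "nat \<Rightarrow> plane \<Rightarrow> plane \<Rightarrow> plane \<Rightarrow> plane set set" where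
  "grid_lines n A B C =
     {line_through p (Y - X) | p X Y. p \<in> division_points n A B C \<and> (X, Y) \<in> sides A B C}"

text \<open>The tiles cut out by the grid lines are the closures of the connected regions that remain
  after removing the lines. The vertices are division points, so the sides of the triangle lie on
  grid lines.\<close>

definition grid_subdivision :: "nat \<Rightarrow> plane \<Rightarrow> plane \<Rightarrow> plane \<Rightarrow> plane set set" where
  "grid_subdivision n A B C =
     closure ` components (convex hull {A, B, C} - \<Union>(grid_lines n A B C))"

definition trivial_reptiling :: "plane \<Rightarrow> plane \<Rightarrow> plane \<Rightarrow> plane set set \<Rightarrow> bool" where
  "trivial_reptiling A B C \<P> \<longleftrightarrow> (\<exists>n\<ge>1. \<P> = grid_subdivision n A B C)"

end

theory Submission
  imports Defs
begin

text \<open>Let \<open>a, b, c\<close> be the sides of a tile and \<open>\<alpha>, \<beta>, \<gamma>\<close> its angles. Call a side pure if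
  a multiple of it is a sum of tile sides only in the obvious way. As different sides have irrational
  ratios, two relations between the sides would make a ratio rational after elimination; hence at most
  one side is not pure, and none if the triangle is isosceles. Pure sides force the scale factor
  to be an integer \<open>n\<close>, and a segment whose ends cannot be passed and whose length is a multiple of a pure
  side is divided into edges of that length on either side. Choose the base \<open>BC\<close> and a second side \<open>CA\<close>
  to be pure. At a point of a row, the larger base angle cannot occur twice, because too little
  of the straight angle would remain; so all tiles standing on a row are translates of each other. The
  gaps between them are closed from left to right: the edges along the left wall of a gap either
  have a vertex at a grid point, so that the wall is divided into \<open>b\<close>-edges and the gap is filled by the inverted
  tile, or they bound further rows, which are filled by induction. The base can be chosen opposite to
  the smallest angle if that side is pure; otherwise the triangle is acute and one of the other two sides works.\<close>

subsection \<open>Cones of directions and angles as areas\<close>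

text \<open>The obstacle is that tiles need not meet edge to edge: an edge on one side of a line may
  run past the vertices on the other side, so completed tiles do not determine where the next tiles
  have their corners. A segment becomes usable once both ends are known to stop edges, and in most
  places this follows from counting the angle that the known tiles leave free. Purity of the length
  then fixes all vertices in between. The upper end of the wall of a gap is the one place where this
  may fail. But an edge that runs across it, parallel to \<open>CA\<close>, takes a straight angle
  there and so closes the next, shorter row on its right, as the side \<open>CA\<close> does for a
  full row. The wall thus either stops or produces a new row, and it has to stop at
  \<open>AB\<close>. Angles enter only through additivity and order, so every angle argument is
  about sums of \<open>\<alpha>\<close>, \<open>\<beta>\<close>, \<open>\<gamma>\<close> with
  natural coefficients. The orientation of the first triangle and mirror images are harmless: left
  and right are measured relative to \<open>A, B, C\<close>, and a tile is described by its side
  lengths alone.\<close>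

definition fcone :: "plane set \<Rightarrow> plane \<Rightarrow> plane set" where
  "fcone K p = {v. p \<in> K \<and> (\<exists>e>0. p + e *\<^sub>R v \<in> K)}"

text \<open>The angle of a convex set at a point is measured by an area, so that angles around a point
  add up because areas do; a straight angle has the value \<open>straight\<close> defined below.\<close>
definition dens :: "plane set \<Rightarrow> plane \<Rightarrow> real" where
  "dens K p = measure lebesgue (fcone K p \<inter> cball 0 1)"

lemma convex_segment_from:
  fixes p :: plane
  assumes "convex K" "p \<in> K" "p + e *\<^sub>R v \<in> K" "0 \<le> t" "t \<le> e"
  shows "p + t *\<^sub>R v \<in> K"
proof (cases "e = 0")
  case True
  then show ?thesis using assms by auto
next
  case False
  with assms have e: "e > 0" by linarith
  have "(1 - t/e) *\<^sub>R p + (t/e) *\<^sub>R (p + e *\<^sub>R v) \<in> K"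
    using assms e by (intro convexD) auto
  moreover have "(1 - t/e) *\<^sub>R p + (t/e) *\<^sub>R (p + e *\<^sub>R v) = p + t *\<^sub>R v"
    using e by (simp add: algebra_simps)
  ultimately show ?thesis by simp
qed

lemma fcone_notin: "p \<notin> K \<Longrightarrow> fcone K p = {}"
  by (auto simp: fcone_def)

text \<open>The conjunct \<open>p \<in> K\<close> in \<open>fcone\<close> is there for this: angle
  sums at a point may run over the whole tiling.\<close>

lemma dens_notin: "p \<notin> K \<Longrightarrow> dens K p = 0"
  by (simp add: dens_def fcone_notin)

lemma convex_fcone:
  assumes "convex K"
  shows "convex (fcone K p)"
proof (rule convexI)
  fix v w :: plane and s t :: real
  assume v: "v \<in> fcone K p" and w: "w \<in> fcone K p" and st: "0 \<le> s" "0 \<le> t" "s + t = 1"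
  from v obtain e1 where e1: "p \<in> K" "e1 > 0" "p + e1 *\<^sub>R v \<in> K" by (auto simp: fcone_def)
  from w obtain e2 where e2: "e2 > 0" "p + e2 *\<^sub>R w \<in> K" by (auto simp: fcone_def)
  define e where "e = min e1 e2"
  have "p + e *\<^sub>R v \<in> K" "p + e *\<^sub>R w \<in> K"
    using convex_segment_from[OF assms e1(1), of e1 v e] convex_segment_from[OF assms e1(1), of e2 w e] e1 e2
    by (auto simp: e_def)
  then have "s *\<^sub>R (p + e *\<^sub>R v) + t *\<^sub>R (p + e *\<^sub>R w) \<in> K"
    using st assms by (intro convexD) auto
  moreover have "s *\<^sub>R (p + e *\<^sub>R v) + t *\<^sub>R (p + e *\<^sub>R w) = (s + t) *\<^sub>R p + e *\<^sub>R (s *\<^sub>R v + t *\<^sub>R w)"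
    by (simp add: algebra_simps)
  ultimately have "p + e *\<^sub>R (s *\<^sub>R v + t *\<^sub>R w) \<in> K" using st by simp
  moreover have "e > 0" using e1 e2 by (simp add: e_def)
  ultimately show "s *\<^sub>R v + t *\<^sub>R w \<in> fcone K p" using e1 unfolding fcone_def by blast
qed

lemma lmeasurable_fcone:
  assumes "convex K"
  shows "fcone K p \<inter> cball 0 1 \<in> lmeasurable"
  by (intro measurable_convex convex_Int convex_fcone assms convex_cball bounded_Int) auto

lemma fcone_mono: "K \<subseteq> L \<Longrightarrow> fcone K p \<subseteq> fcone L p"
  by (auto simp: fcone_def)

text \<open>Points approaching \<open>p\<close> along \<open>v\<close> fall into finitely many
  closed tiles, so one tile receives infinitely many of them and hence also their limit
  \<open>p\<close>.\<close>

lemma fcone_Union: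
  assumes "finite \<P>" "\<And>K. K \<in> \<P> \<Longrightarrow> convex K" "\<And>K. K \<in> \<P> \<Longrightarrow> closed K"
    and "convex T" "\<Union>\<P> = T"
  shows "fcone T p = (\<Union>K\<in>\<P>. fcone K p)"
proof
  show "(\<Union>K\<in>\<P>. fcone K p) \<subseteq> fcone T p" using fcone_mono assms(5) by blast
  show "fcone T p \<subseteq> (\<Union>K\<in>\<P>. fcone K p)"
  proof
    fix v assume "v \<in> fcone T p"
    then obtain e where e: "p \<in> T" "e > 0" "p + e *\<^sub>R v \<in> T" by (auto simp: fcone_def)
    define g where "g n = p + (e / real (Suc n)) *\<^sub>R v" for n
    have "g n \<in> T" for n unfolding g_def
      by (rule convex_segment_from[OF assms(4) e(1,3)]) (use e in \<open>auto simp: field_simps\<close>)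
    then have "\<forall>n\<in>UNIV. \<exists>K\<in>\<P>. g n \<in> K" using assms(5) by blast
    from pigeonhole_infinite_rel[OF infinite_UNIV_nat assms(1) this]
    obtain K where K: "K \<in> \<P>" "infinite {n. g n \<in> K}" by auto
    have lim: "g \<longlonglongrightarrow> p"
    proof -
      have "(\<lambda>n. p + (e / real (Suc n)) *\<^sub>R v) \<longlonglongrightarrow> p + 0 *\<^sub>R v"
        by (intro tendsto_intros LIMSEQ_Suc[OF lim_const_over_n])
      then show ?thesis by (simp add: g_def[abs_def])
    qed
    have "p \<in> K"
    proof (rule ccontr)
      assume "p \<notin> K"
      then have "open (- K)" "p \<in> - K" using assms(3) K by auto
      with lim have "eventually (\<lambda>n. g n \<in> - K) sequentially"
        by (rule topological_tendstoD)
      then obtain N where "\<And>n. n \<ge> N \<Longrightarrow> g n \<notin> K" by (auto simp: eventually_sequentially)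
      then have "{n. g n \<in> K} \<subseteq> {..<N}" by (auto simp: not_le[symmetric])
      then show False using K finite_subset by blast
    qed
    moreover obtain n where "g n \<in> K" using K(2) by (metis (mono_tags) not_finite_existsD)
    ultimately have "v \<in> fcone K p" using e unfolding fcone_def g_def
      by (auto intro!: exI[of _ "e / real (Suc n)"])
    then show "v \<in> (\<Union>K\<in>\<P>. fcone K p)" using K by blast
  qed
qed

text \<open>An intersection without interior points lies on a line, and a direction leading into
  both sets must be parallel to it.\<close>

lemma negligible_fcone_Int:
  assumes "convex K" "convex L" "interior K \<inter> interior L = {}"
  shows "negligible (fcone K p \<inter> fcone L p)"
proof -
  have "interior (K \<inter> L) = {}" using assms by simp
  with assms obtain a b where ab: "a \<noteq> 0" "K \<inter> L \<subseteq> {x. a \<bullet> x = b}"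
    using empty_interior_subset_hyperplane[of "K \<inter> L"] by (metis convex_Int)
  have "fcone K p \<inter> fcone L p \<subseteq> {x. a \<bullet> x = 0}"
  proof
    fix v assume "v \<in> fcone K p \<inter> fcone L p"
    then obtain e1 e2 where e: "p \<in> K" "p \<in> L" "e1 > 0" "e2 > 0" "p + e1 *\<^sub>R v \<in> K" "p + e2 *\<^sub>R v \<in> L"
      by (auto simp: fcone_def)
    define e where "e = min e1 e2"
    have "p + e *\<^sub>R v \<in> K \<inter> L"
      using convex_segment_from[OF assms(1) e(1,5), of e] convex_segment_from[OF assms(2) e(2,6), of e] e
      by (auto simp: e_def)
    then have "a \<bullet> (p + e *\<^sub>R v) = b" "a \<bullet> p = b" using ab e by auto
    then have "e * (a \<bullet> v) = 0" by (simp add: inner_right_distrib)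
    then show "v \<in> {x. a \<bullet> x = 0}" using e by (auto simp: e_def min_def split: if_splits)
  qed
  then show ?thesis using negligible_hyperplane[of a 0] ab negligible_subset by blast
qed

text \<open>One equation covers corners, edge points and interior points alike, so no case
  distinction on how tiles meet at a point is required.\<close>

lemma sum_dens:
  assumes "finite \<P>" "\<And>K. K \<in> \<P> \<Longrightarrow> convex K" "\<And>K. K \<in> \<P> \<Longrightarrow> closed K"
    and "convex T" "\<Union>\<P> = T"
    and "\<And>K L. K \<in> \<P> \<Longrightarrow> L \<in> \<P> \<Longrightarrow> K \<noteq> L \<Longrightarrow> interior K \<inter> interior L = {}"
  shows "(\<Sum>K\<in>\<P>. dens K p) = dens T p"
proof -
  have "measure lebesgue (\<Union>((\<lambda>K. fcone K p \<inter> cball 0 1) ` \<P>)) = (\<Sum>K\<in>\<P>. measure lebesgue (fcone K p \<inter> cball 0 1))"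
  proof (rule measure_negligible_finite_Union_image[OF assms(1)])
    show "pairwise (\<lambda>K L. negligible ((fcone K p \<inter> cball 0 1) \<inter> (fcone L p \<inter> cball 0 1))) \<P>"
    proof (rule pairwiseI)
      fix K L assume "K \<in> \<P>" "L \<in> \<P>" "K \<noteq> L"
      then have "negligible (fcone K p \<inter> fcone L p)" using assms by (intro negligible_fcone_Int) auto
      then show "negligible ((fcone K p \<inter> cball 0 1) \<inter> (fcone L p \<inter> cball 0 1))"
        by (rule negligible_subset) auto
    qed
  qed (use assms lmeasurable_fcone in auto)
  moreover have "\<Union>((\<lambda>K. fcone K p \<inter> cball 0 1) ` \<P>) = fcone T p \<inter> cball 0 1"
    using fcone_Union[OF assms(1-5), of p] by auto
  ultimately show ?thesis by (simp add: dens_def)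
qed

section \<open>Planar determinants and barycentric coordinates of triangles\<close>

definition cross :: "plane \<Rightarrow> plane \<Rightarrow> real" where
  "cross u v = u $ 1 * v $ 2 - u $ 2 * v $ 1"

lemma cross_simps [simp]:
  "cross u u = 0" "cross 0 v = 0" "cross u 0 = 0"
  "cross (s *\<^sub>R u) v = s * cross u v" "cross u (s *\<^sub>R v) = s * cross u v"
  "cross (- u) v = - cross u v" "cross u (- v) = - cross u v"
  by (auto simp: cross_def algebra_simps)

lemma cross_add: "cross (u + w) v = cross u v + cross w v" "cross u (v + w) = cross u v + cross u w"
  "cross (u - w) v = cross u v - cross w v" "cross u (v - w) = cross u v - cross u w"
  by (auto simp: cross_def algebra_simps)

lemma cross_commute: "cross v u = - cross u v"
  by (simp add: cross_def)

text \<open>Cramer's rule for the coordinates of \<open>w\<close> in the basis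
  \<open>u, v\<close>.\<close>

lemma cross_expand:
  assumes "cross u v \<noteq> 0"
  shows "w = (cross w v / cross u v) *\<^sub>R u + (cross u w / cross u v) *\<^sub>R v"
proof -
  have "cross u v *\<^sub>R w = (cross w v) *\<^sub>R u + (cross u w) *\<^sub>R v"
    by (simp add: vec_eq_iff forall_2 cross_def algebra_simps)
  then have "inverse (cross u v) *\<^sub>R (cross u v *\<^sub>R w) = inverse (cross u v) *\<^sub>R ((cross w v) *\<^sub>R u + (cross u w) *\<^sub>R v)"
    by simp
  then show ?thesis using assms by (simp add: scaleR_add_right divide_inverse mult.commute)
qed

text \<open>Lagrange's identity: norms and inner product determine \<open>cross\<close> up to its
  sign.\<close>

lemma cross_identity: "(cross u v)\<^sup>2 + (u \<bullet> v)\<^sup>2 = (u \<bullet> u) * (v \<bullet> v)"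
  by (simp add: cross_def inner_vec_def sum_2 power2_eq_square algebra_simps)

lemma cross_nonzero_imp: "cross u v \<noteq> 0 \<Longrightarrow> u \<noteq> 0" "cross u v \<noteq> 0 \<Longrightarrow> v \<noteq> 0"
  by auto

lemma negligible_cross: "u \<noteq> 0 \<Longrightarrow> negligible {v. cross u v = 0}"
proof -
  assume u: "u \<noteq> 0"
  define a :: plane where "a = vector [- u $ 2, u $ 1]"
  have "a \<noteq> 0" using u by (auto simp: a_def vec_eq_iff forall_2)
  moreover have "{v. cross u v = 0} = {v. a \<bullet> v = 0}"
    by (auto simp: a_def cross_def inner_vec_def sum_2)
  ultimately show ?thesis using negligible_hyperplane[of a 0] by simp
qed

lemma collinear_cross: "collinear {A, B, C} \<longleftrightarrow> cross (B - A) (C - A) = 0"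
proof
  assume "collinear {A, B, C}"
  then obtain w where w: "\<And>x y. x \<in> {A,B,C} \<Longrightarrow> y \<in> {A,B,C} \<Longrightarrow> \<exists>c. x - y = c *\<^sub>R w"
    unfolding collinear_def by blast
  obtain s where s: "B - A = s *\<^sub>R w" using w[of B A] by auto
  obtain t where t: "C - A = t *\<^sub>R w" using w[of C A] by auto
  show "cross (B - A) (C - A) = 0" unfolding s t by simp
next
  assume *: "cross (B - A) (C - A) = 0"
  show "collinear {A, B, C}"
  proof (cases "B = A")
    case True
    then show ?thesis by (simp add: collinear_2 insert_commute)
  next
    case False
    define u where "u = B - A"
    have u: "u \<noteq> 0" "u \<bullet> u \<noteq> 0" using False by (auto simp: u_def)
    have "(u \<bullet> u) *\<^sub>R (C - A) = (u \<bullet> (C - A)) *\<^sub>R u + cross u (C - A) *\<^sub>R vector [- u $ 2, u $ 1]"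
      by (simp add: vec_eq_iff forall_2 cross_def inner_vec_def sum_2 algebra_simps)
    with * have "(u \<bullet> u) *\<^sub>R (C - A) = (u \<bullet> (C - A)) *\<^sub>R u" by (simp add: u_def)
    then have "C - A = ((u \<bullet> (C - A)) / (u \<bullet> u)) *\<^sub>R u"
      using u by (metis (no_types, lifting) divide_inverse_commute right_inverse scaleR_one scaleR_scaleR mult.commute)
    then have "\<exists>c. C - A = c *\<^sub>R u" by blast
    then have "collinear {0, u, C - A}"
      unfolding collinear_lemma by auto
    then have "collinear {B, A, C}" by (subst collinear_3) (simp_all add: u_def insert_commute)
    then show ?thesis by (simp add: insert_commute)
  qed
qed

lemma tri_mem:
  assumes "cross (q - p) (r - p) \<noteq> 0"
  shows "p + s *\<^sub>R (q - p) + t *\<^sub>R (r - p) \<in> convex hull {p, q, r} \<longleftrightarrow> 0 \<le> s \<and> 0 \<le> t \<and> s + t \<le> 1"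
proof
  define u v where "u = q - p" and "v = r - p"
  assume "p + s *\<^sub>R (q - p) + t *\<^sub>R (r - p) \<in> convex hull {p, q, r}"
  then obtain s' t' where st: "0 \<le> s'" "0 \<le> t'" "s' + t' \<le> 1"
    and eq: "s *\<^sub>R u + t *\<^sub>R v = s' *\<^sub>R u + t' *\<^sub>R v"
    unfolding convex_hull_3_alt by (auto simp: u_def v_def)
  have "cross (s *\<^sub>R u + t *\<^sub>R v) v = cross (s' *\<^sub>R u + t' *\<^sub>R v) v" "cross u (s *\<^sub>R u + t *\<^sub>R v) = cross u (s' *\<^sub>R u + t' *\<^sub>R v)"
    using eq by auto
  then have "s = s'" "t = t'" using assms by (auto simp: cross_add u_def[symmetric] v_def[symmetric])
  with st show "0 \<le> s \<and> 0 \<le> t \<and> s + t \<le> 1" by simp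
qed (auto simp: convex_hull_3_alt)

lemma tri_coords:
  assumes "cross (q - p) (r - p) \<noteq> 0"
  obtains s t where "z = p + s *\<^sub>R (q - p) + t *\<^sub>R (r - p)"
    "s = cross (z - p) (r - p) / cross (q - p) (r - p)" "t = cross (q - p) (z - p) / cross (q - p) (r - p)"
proof (rule that[OF _ refl refl])
  have "z = p + (z - p)" by simp
  also note cross_expand[OF assms, of "z - p"]
  finally show "z = p + (cross (z - p) (r - p) / cross (q - p) (r - p)) *\<^sub>R (q - p) + (cross (q - p) (z - p) / cross (q - p) (r - p)) *\<^sub>R (r - p)"
    by (simp only: add.assoc)
qed

lemma interior_triI:
  assumes d: "cross (q - p) (r - p) \<noteq> 0" and "0 < s" "0 < t" "s + t < 1"
  shows "p + s *\<^sub>R (q - p) + t *\<^sub>R (r - p) \<in> interior (convex hull {p, q, r})"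
proof -
  define d where "d = cross (q - p) (r - p)"
  \<comment> \<open>Strict barycentric inequalities written with determinants, so that openness is a
    matter of continuity.\<close>
  define S where "S = {z. 0 < cross (z - p) (r - p) / d \<and> 0 < cross (q - p) (z - p) / d \<and>
     cross (z - p) (r - p) / d + cross (q - p) (z - p) / d < 1}"
  have "open S"
    unfolding S_def cross_def using assms
    by (intro open_Collect_conj open_Collect_less continuous_intros) (auto simp: d_def)
  moreover have "S \<subseteq> convex hull {p, q, r}"
  proof
    fix z assume z: "z \<in> S"
    obtain s t where st: "z = p + s *\<^sub>R (q - p) + t *\<^sub>R (r - p)"
    "s = cross (z - p) (r - p) / d" "t = cross (q - p) (z - p) / d" using tri_coords[OF assms(1), of z] d_def by metis
    show "z \<in> convex hull {p, q, r}"
      unfolding st(1) tri_mem[OF assms(1)] using z unfolding S_def st(2,3) by auto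
  qed
  moreover have "p + s *\<^sub>R (q - p) + t *\<^sub>R (r - p) \<in> S"
  proof -
    have "cross (s *\<^sub>R (q - p) + t *\<^sub>R (r - p)) (r - p) = s * d" "cross (q - p) (s *\<^sub>R (q - p) + t *\<^sub>R (r - p)) = t * d"
      unfolding d_def cross_add(1,2) cross_simps by simp_all
    then show ?thesis using assms unfolding S_def d_def[symmetric] by (simp add: add.assoc)
  qed
  ultimately show ?thesis using interiorI by blast
qed

section \<open>Sectors and their angles\<close>

definition cone2 :: "plane \<Rightarrow> plane \<Rightarrow> plane set" where
  "cone2 u v = {s *\<^sub>R u + t *\<^sub>R v | s t. 0 \<le> s \<and> 0 \<le> t}"

definition sector :: "plane \<Rightarrow> plane \<Rightarrow> real" where
  "sector u v = measure lebesgue (cone2 u v \<inter> cball 0 1)"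

definition straight :: real where "straight = measure lebesgue (cball (0::plane) 1) / 2"

lemma cone2_mem:
  assumes "cross u v \<noteq> 0"
  shows "w \<in> cone2 u v \<longleftrightarrow> 0 \<le> cross w v / cross u v \<and> 0 \<le> cross u w / cross u v"
proof
  assume "w \<in> cone2 u v"
  then show "0 \<le> cross w v / cross u v \<and> 0 \<le> cross u w / cross u v"
    using assms by (auto simp: cone2_def cross_add)
next
  assume "0 \<le> cross w v / cross u v \<and> 0 \<le> cross u w / cross u v"
  then show "w \<in> cone2 u v" using cross_expand[OF assms, of w] unfolding cone2_def by blast
qed

lemma fcone_vertex:
  assumes "cross (q - p) (r - p) \<noteq> 0"
  shows "fcone (convex hull {p, q, r}) p = cone2 (q - p) (r - p)"
proof (intro equalityI subsetI)
  fix w assume "w \<in> fcone (convex hull {p, q, r}) p"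
  then obtain e where e: "e > 0" "p + e *\<^sub>R w \<in> convex hull {p, q, r}" by (auto simp: fcone_def)
  obtain s t where st: "w = s *\<^sub>R (q - p) + t *\<^sub>R (r - p)" using cross_expand[OF assms, of w] by blast
  have "p + (e * s) *\<^sub>R (q - p) + (e * t) *\<^sub>R (r - p) \<in> convex hull {p, q, r}"
    using e by (simp add: st scaleR_add_right add.assoc)
  then have "0 \<le> e * s" "0 \<le> e * t" unfolding tri_mem[OF assms] by auto
  then have "0 \<le> s" "0 \<le> t" using e by (auto simp: zero_le_mult_iff)
  then show "w \<in> cone2 (q - p) (r - p)" unfolding cone2_def st by blast
next
  fix w assume "w \<in> cone2 (q - p) (r - p)"
  then obtain s t where st: "0 \<le> s" "0 \<le> t" "w = s *\<^sub>R (q - p) + t *\<^sub>R (r - p)"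
    by (auto simp: cone2_def)
  define e where "e = 1 / (s + t + 1)"
  have e: "e > 0" using st by (simp add: e_def)
  have "e * s + e * t \<le> 1" using st by (simp add: e_def divide_simps)
  then have "p + (e * s) *\<^sub>R (q - p) + (e * t) *\<^sub>R (r - p) \<in> convex hull {p, q, r}"
    unfolding tri_mem[OF assms] using e st by auto
  then have "p + e *\<^sub>R w \<in> convex hull {p, q, r}" by (simp add: st scaleR_add_right add.assoc)
  then show "w \<in> fcone (convex hull {p, q, r}) p"
    using e by (auto simp: fcone_def hull_inc)
qed

lemma dens_vertex:
  assumes "cross (q - p) (r - p) \<noteq> 0"
  shows "dens (convex hull {p, q, r}) p = sector (q - p) (r - p)"
  by (simp add: dens_def sector_def fcone_vertex[OF assms])

lemma fcone_edge:
  assumes d: "cross (q - p) (r - p) \<noteq> 0" and z: "z \<in> open_segment p q"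
  shows "fcone (convex hull {p, q, r}) z = {w. 0 \<le> cross (q - p) (r - p) * cross (q - p) w}"
proof -
  obtain l where l: "0 < l" "l < 1" "z = p + l *\<^sub>R (q - p)"
    using z by (auto simp: in_segment algebra_simps)
  define d where "d = cross (q - p) (r - p)"
  have zin: "z \<in> convex hull {p, q, r}" using tri_mem[OF d, of l 0] l by simp
  show ?thesis
  proof (intro equalityI subsetI)
    fix w assume "w \<in> fcone (convex hull {p, q, r}) z"
    then obtain e where e: "e > 0" "z + e *\<^sub>R w \<in> convex hull {p, q, r}" by (auto simp: fcone_def)
    define t where "t = cross (q - p) w / d"
    obtain s where st: "w = s *\<^sub>R (q - p) + t *\<^sub>R (r - p)" using cross_expand[OF d, of w] t_def d_def by blast
    have "p + (l + e * s) *\<^sub>R (q - p) + (e * t) *\<^sub>R (r - p) \<in> convex hull {p, q, r}"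
      using e by (simp add: st l scaleR_add_right scaleR_add_left add.assoc)
    then have "0 \<le> e * t" unfolding tri_mem[OF d] by auto
    then have "0 \<le> t" using e by (auto simp: zero_le_mult_iff)
    then show "w \<in> {w. 0 \<le> cross (q - p) (r - p) * cross (q - p) w}"
      using d unfolding t_def d_def[symmetric] by (auto simp: zero_le_divide_iff zero_le_mult_iff)
  next
    fix w assume w: "w \<in> {w. 0 \<le> cross (q - p) (r - p) * cross (q - p) w}"
    define t where "t = cross (q - p) w / d"
    obtain s where st: "w = s *\<^sub>R (q - p) + t *\<^sub>R (r - p)" using cross_expand[OF d, of w] t_def d_def by blast
    have t: "t \<ge> 0" using w unfolding t_def d_def by (auto simp: zero_le_divide_iff zero_le_mult_iff)
    \<comment> \<open>Small enough that \<open>\<bar>e * s\<bar> + e * t\<close> does not exceed the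
      distance of \<open>l\<close> from 0 and from 1; the summand 1 keeps the denominator
      positive.\<close>
    define e where "e = (min l (1 - l)) / (\<bar>s\<bar> + t + 1)"
    have e: "e > 0" using l t by (auto simp: e_def)
    have "e * (\<bar>s\<bar> + t) \<le> e * (\<bar>s\<bar> + t + 1)" using e by simp
    also have "\<dots> = min l (1 - l)" unfolding e_def using t by simp
    finally have m: "e * \<bar>s\<bar> + e * t \<le> min l (1 - l)" by (simp add: algebra_simps)
    have es: "\<bar>e * s\<bar> = e * \<bar>s\<bar>" using e by (simp add: abs_mult)
    have et: "0 \<le> e * t" using e t by simp
    have "0 \<le> l + e * s" "l + e * s + e * t \<le> 1" using m es et by (auto simp: abs_if min_def split: if_splits)
    then have "p + (l + e * s) *\<^sub>R (q - p) + (e * t) *\<^sub>R (r - p) \<in> convex hull {p, q, r}"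
      unfolding tri_mem[OF d] using et by auto
    then have "z + e *\<^sub>R w \<in> convex hull {p, q, r}"
      by (simp add: st l scaleR_add_right scaleR_add_left add.assoc)
    then show "w \<in> fcone (convex hull {p, q, r}) z" using e zin by (auto simp: fcone_def)
  qed
qed

lemma fcone_interior:
  assumes "z \<in> interior K"
  shows "fcone K z = UNIV"
proof -
  obtain e where e: "e > 0" "ball z e \<subseteq> K" using assms by (auto simp: mem_interior)
  have "w \<in> fcone K z" for w
  proof -
    define c where "c = e / (2 * (norm w + 1))"
    have pos: "norm w + 1 > 0" by (meson norm_ge_zero add_nonneg_pos zero_less_one)
    then have c: "c > 0" using e by (simp add: c_def)
    have "c * norm w \<le> c * (norm w + 1)" using c by simp
    also have "\<dots> = e / 2" using pos unfolding c_def by (simp only: times_divide_eq_left) (simp add: field_simps)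
    finally have "c * norm w < e" using e by linarith
    then have "z + c *\<^sub>R w \<in> ball z e" using c by (simp add: dist_norm)
    then show ?thesis using c e assms interior_subset unfolding fcone_def by blast
  qed
  then show ?thesis by auto
qed

lemma lmeasurable_halfplane: "{w. 0 \<le> k * cross u w} \<inter> cball 0 1 \<in> lmeasurable"
proof -
  have "convex {w. 0 \<le> k * cross u w}"
    by (rule convexI) (auto simp: cross_add distrib_left mult.left_commute[of k])
  then show ?thesis by (intro measurable_convex convex_Int) (auto simp: bounded_Int)
qed

lemma measure_Un_negligible:
  fixes A B :: "plane set"
  assumes "A \<in> lmeasurable" "B \<in> lmeasurable" "negligible (A \<inter> B)"
  shows "measure lebesgue (A \<union> B) = measure lebesgue A + measure lebesgue B"
  using measure_negligible_finite_Union_image[of UNIV "\<lambda>b. if b then A else B"] assms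
  by (auto simp: UNIV_bool pairwise_def Int_commute Un_commute)

lemma measure_minus_image: "measure lebesgue (uminus ` (S :: plane set)) = measure lebesgue S"
  if "S \<in> lmeasurable"
  by (rule measure_orthogonal_image) (auto simp: orthogonal_transformation_def linear_uminus that intro: linearI)

text \<open>Reflection in the origin exchanges the two half-discs, so each has half the
  area.\<close>

lemma measure_halfplane:
  assumes "u \<noteq> 0" "k \<noteq> 0"
  shows "measure lebesgue ({w. 0 \<le> k * cross u w} \<inter> cball 0 1) = straight"
proof -
  let ?A = "{w. 0 \<le> k * cross u w} \<inter> cball 0 1" and ?B = "{w. 0 \<le> - k * cross u w} \<inter> cball 0 1"
  have "?B = uminus ` ?A"
  proof (intro equalityI subsetI)
    fix x assume "x \<in> ?B"
    then have "- x \<in> ?A" by auto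
    then show "x \<in> uminus ` ?A" by (metis imageI minus_minus)
  qed auto
  then have 1: "measure lebesgue ?B = measure lebesgue ?A"
    using measure_minus_image[OF lmeasurable_halfplane] by simp
  have "?A \<inter> ?B \<subseteq> {v. cross u v = 0}" using assms by (auto simp: zero_le_mult_iff mult_le_0_iff)
  then have "negligible (?A \<inter> ?B)" using negligible_cross[OF assms(1)] negligible_subset by blast
  then have 2: "measure lebesgue (?A \<union> ?B) = measure lebesgue ?A + measure lebesgue ?B"
    by (intro measure_Un_negligible lmeasurable_halfplane)
  have "?A \<union> ?B = cball 0 1" by auto
  then show ?thesis using 1 2 by (simp add: straight_def)
qed

lemma straight_pos: "straight > 0"
  by (simp add: straight_def content_cball_pos)

lemma dens_edge:
  assumes d: "cross (q - p) (r - p) \<noteq> 0" and z: "z \<in> open_segment p q"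
  shows "dens (convex hull {p, q, r}) z = straight"
  unfolding dens_def fcone_edge[OF assms] by (rule measure_halfplane) (use d in auto)

lemma dens_interior: "z \<in> interior K \<Longrightarrow> dens K z = 2 * straight"
  by (simp add: dens_def fcone_interior straight_def)

lemma tri_cases:
  assumes d: "cross (q - p) (r - p) \<noteq> 0" and z: "z \<in> convex hull {p, q, r}"
  obtains "z = p" | "z = q" | "z = r" | "z \<in> open_segment p q" | "z \<in> open_segment q r"
    | "z \<in> open_segment r p" | "z \<in> interior (convex hull {p, q, r})"
proof -
  obtain s t where st: "0 \<le> s" "0 \<le> t" "s + t \<le> 1" "z = p + s *\<^sub>R (q - p) + t *\<^sub>R (r - p)"
    using z unfolding convex_hull_3_alt by blast
  have ne: "p \<noteq> q" "q \<noteq> r" "r \<noteq> p" using d by auto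
  have oseg: "a + c *\<^sub>R (b - a) \<in> open_segment a b" if "0 < c" "c < 1" "a \<noteq> b" for a b :: plane and c
    using that by (auto simp: in_segment algebra_simps intro!: exI[of _ c])
  consider "t = 0" "s = 0" | "t = 0" "s = 1" | "t = 0" "0 < s" "s < 1"
    | "s = 0" "t = 1" | "s = 0" "0 < t" "t < 1" | "0 < s" "0 < t" "s + t = 1" | "0 < s" "0 < t" "s + t < 1"
    using st by linarith
  then show ?thesis
  proof cases
    case 3
    then show ?thesis using that(4) st oseg[of s p q] ne by simp
  next
    case 5
    then have "z \<in> open_segment p r" using st oseg[of t p r] ne by simp
    then show ?thesis using that(6) by (simp add: open_segment_commute)
  next
    case 6
    then have s: "s = 1 - t" by simp
    have "z = q + t *\<^sub>R (r - q)" unfolding st(4) s by (simp add: algebra_simps)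
    then show ?thesis using that(5) 6 s oseg[of t q r] ne by simp
  next
    case 7
    then show ?thesis using that(7) st interior_triI[OF d] by simp
  qed (use that st in auto)
qed

lemma cone2_commute: "cone2 u v = cone2 v u"
proof -
  have "cone2 u v \<subseteq> cone2 v u" for u v
  proof
    fix w assume "w \<in> cone2 u v"
    then obtain s t where "0 \<le> s" "0 \<le> t" "w = s *\<^sub>R u + t *\<^sub>R v" by (auto simp: cone2_def)
    then show "w \<in> cone2 v u" unfolding cone2_def
      by (intro CollectI exI[of _ t] exI[of _ s]) (auto simp: add.commute)
  qed
  then show ?thesis by blast
qed

lemma sector_commute: "sector u v = sector v u"
  by (simp add: sector_def cone2_commute)

lemma sector_scale:
  assumes "0 < a"
  shows "sector (a *\<^sub>R u) v = sector u v"
proof -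
  have "cone2 (a *\<^sub>R u) v = cone2 u v"
  proof (intro equalityI subsetI)
    fix w assume "w \<in> cone2 (a *\<^sub>R u) v"
    then obtain s t where "0 \<le> s" "0 \<le> t" "w = (s * a) *\<^sub>R u + t *\<^sub>R v" by (auto simp: cone2_def)
    then show "w \<in> cone2 u v" using assms unfolding cone2_def
      by (intro CollectI exI[of _ "s * a"] exI[of _ t]) auto
  next
    fix w assume "w \<in> cone2 u v"
    then obtain s t where "0 \<le> s" "0 \<le> t" "w = s *\<^sub>R u + t *\<^sub>R v" by (auto simp: cone2_def)
    then show "w \<in> cone2 (a *\<^sub>R u) v" using assms unfolding cone2_def
      by (intro CollectI exI[of _ "s / a"] exI[of _ t]) auto
  qed
  then show ?thesis by (simp add: sector_def)
qed

lemma convex_cone2: "convex (cone2 u v)"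
proof (rule convexI)
  fix x y :: plane and a b :: real
  assume "x \<in> cone2 u v" "y \<in> cone2 u v" and ab: "0 \<le> a" "0 \<le> b"
  then obtain s t s' t' where "0 \<le> s" "0 \<le> t" "0 \<le> s'" "0 \<le> t'" "x = s *\<^sub>R u + t *\<^sub>R v" "y = s' *\<^sub>R u + t' *\<^sub>R v"
    unfolding cone2_def by blast
  then show "a *\<^sub>R x + b *\<^sub>R y \<in> cone2 u v" using ab unfolding cone2_def
    by (intro CollectI exI[of _ "a * s + b * s'"] exI[of _ "a * t + b * t'"]) (auto simp: algebra_simps)
qed

lemma lmeasurable_cone2: "cone2 u v \<inter> cball 0 1 \<in> lmeasurable"
  by (intro measurable_convex convex_Int convex_cone2) (auto simp: bounded_Int)

lemma sector_pos:
  assumes "cross u v \<noteq> 0"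
  shows "0 < sector u v"
proof -
  let ?S = "{w. 0 < cross w v / cross u v \<and> 0 < cross u w / cross u v} \<inter> ball 0 1"
  have "open ?S"
    unfolding cross_def using assms
    by (intro open_Int open_Collect_conj open_Collect_less continuous_intros) (auto simp: cross_def)
  moreover have "?S \<noteq> {}"
  proof -
    define e where "e = 1 / (2 * (norm (u + v) + 1))"
    have e: "e > 0" by (simp add: e_def add_nonneg_pos)
    have "e * norm (u + v) < 1"
    proof -
      have "norm (u + v) < 2 * (norm (u + v) + 1)" by (smt (verit) norm_ge_zero)
      then show ?thesis by (simp add: e_def divide_less_eq add_nonneg_pos)
    qed
    then have "e *\<^sub>R (u + v) \<in> ?S" using assms e by (simp add: cross_add)
    then show ?thesis by blast
  qed
  ultimately have "\<not> negligible ?S" using open_not_negligible by blast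
  moreover have "?S \<subseteq> cone2 u v \<inter> cball 0 1"
  proof
    fix x assume x: "x \<in> ?S"
    then have "x \<in> cone2 u v" unfolding cone2_mem[OF assms] by simp
    moreover have "x \<in> cball 0 1" using x by simp
    ultimately show "x \<in> cone2 u v \<inter> cball 0 1" by blast
  qed
  ultimately have "\<not> negligible (cone2 u v \<inter> cball 0 1)" using negligible_subset by blast
  then have "measure lebesgue (cone2 u v \<inter> cball 0 1) \<noteq> 0"
    using lmeasurable_cone2 negligible_iff_measure by blast
  then show ?thesis unfolding sector_def by (simp add: zero_less_measure_iff)
qed

lemma sector_add:
  assumes "cross u v \<noteq> 0" and w: "w = s *\<^sub>R u + t *\<^sub>R v" "0 < s" "0 < t"
  shows "sector u v = sector u w + sector w v"
proof -
  have uw: "cross u w = t * cross u v" "cross w v = s * cross u v" by (auto simp: w cross_add)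
  then have ne: "cross u w \<noteq> 0" "cross w v \<noteq> 0" using assms by auto
  have "cone2 u v = cone2 u w \<union> cone2 w v"
  proof (intro equalityI subsetI)
    fix x assume "x \<in> cone2 u v"
    then obtain a b where ab: "0 \<le> a" "0 \<le> b" "x = a *\<^sub>R u + b *\<^sub>R v" by (auto simp: cone2_def)
    show "x \<in> cone2 u w \<union> cone2 w v"
    proof (cases "a * t \<ge> b * s")
      \<comment> \<open>Comparing \<open>a * t\<close> with \<open>b * s\<close> tells on which side
        of \<open>w\<close> the vector \<open>x\<close> lies; here it is the side of
        \<open>u\<close>.\<close>
      case True
      then have "0 \<le> a - b * s / t" using w by (simp add: field_simps)
      moreover have "x = (a - b * s / t) *\<^sub>R u + (b / t) *\<^sub>R w" using w by (simp add: ab algebra_simps)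
      moreover have "0 \<le> b / t" using ab w by simp
      ultimately have "x \<in> cone2 u w" unfolding cone2_def by blast
      then show ?thesis by blast
    next
      case False
      then have "0 \<le> b - a * t / s" using w by (simp add: field_simps)
      moreover have "x = (a / s) *\<^sub>R w + (b - a * t / s) *\<^sub>R v" using w by (simp add: ab algebra_simps)
      moreover have "0 \<le> a / s" using ab w by simp
      ultimately have "x \<in> cone2 w v" unfolding cone2_def by blast
      then show ?thesis by blast
    qed
  next
    fix x assume "x \<in> cone2 u w \<union> cone2 w v"
    then consider a b where "0 \<le> a" "0 \<le> b" "x = a *\<^sub>R u + b *\<^sub>R w"
      | a b where "0 \<le> a" "0 \<le> b" "x = a *\<^sub>R w + b *\<^sub>R v" unfolding cone2_def by blast
    then show "x \<in> cone2 u v"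
    proof cases
      case (1 a b)
      then show ?thesis using w unfolding cone2_def
        by (intro CollectI exI[of _ "a + b * s"] exI[of _ "b * t"]) (auto simp: algebra_simps)
    next
      case (2 a b)
      then show ?thesis using w unfolding cone2_def
        by (intro CollectI exI[of _ "a * s"] exI[of _ "b + a * t"]) (auto simp: algebra_simps)
    qed
  qed
  then have eq: "cone2 u v \<inter> cball 0 1 = (cone2 u w \<inter> cball 0 1) \<union> (cone2 w v \<inter> cball 0 1)" by blast
  have "cone2 u w \<inter> cone2 w v \<subseteq> {x. cross w x = 0}"
  proof
    fix x assume x: "x \<in> cone2 u w \<inter> cone2 w v"
    then have "0 \<le> cross x w / cross u w" "0 \<le> cross w x / cross w v" using cone2_mem ne by blast+
    moreover have "cross x w = - cross w x" by (rule cross_commute)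
    ultimately have "0 \<le> - (cross w x / cross u v)" "0 \<le> cross w x / cross u v"
      using w uw by (auto simp: zero_le_divide_iff zero_le_mult_iff mult_le_0_iff divide_le_0_iff)
    then show "x \<in> {x. cross w x = 0}" using assms by auto
  qed
  moreover have "w \<noteq> 0" using ne by auto
  ultimately have "negligible (cone2 u w \<inter> cone2 w v)" using negligible_cross negligible_subset by blast
  then have "negligible ((cone2 u w \<inter> cball 0 1) \<inter> (cone2 w v \<inter> cball 0 1))"
    by (rule negligible_subset) auto
  then show ?thesis
    unfolding sector_def eq by (intro measure_Un_negligible lmeasurable_cone2)
qed

lemma sector_half:
  assumes "cross u v \<noteq> 0"
  shows "sector u v + sector v (- u) = straight"
proof -
  have ne: "cross v (- u) \<noteq> 0" using assms by (simp add: cross_commute[of v u])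
  have u: "u \<noteq> 0" "v \<noteq> 0" using assms by auto
  define k where "k = 1 / cross u v"
  have "{w. 0 \<le> k * cross u w} \<inter> cball 0 1 = (cone2 u v \<inter> cball 0 1) \<union> (cone2 v (- u) \<inter> cball 0 1)"
    unfolding set_eq_iff Int_iff Un_iff cone2_mem[OF assms] cone2_mem[OF ne] mem_Collect_eq
    using assms by (auto simp: k_def cross_commute[of v] cross_commute[of _ u])
  moreover have "cone2 u v \<inter> cone2 v (- u) \<subseteq> {x. cross v x = 0}"
  proof
    fix x assume x: "x \<in> cone2 u v \<inter> cone2 v (- u)"
    then have "0 \<le> cross x v / cross u v" "0 \<le> cross v x / cross v (- u)" using cone2_mem[OF assms] cone2_mem[OF ne] by blast+
    moreover have "cross v u = - cross u v" "cross x v = - cross v x" by (simp_all add: cross_def)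
    ultimately have "cross v x / cross u v = 0" by simp
    then show "x \<in> {x. cross v x = 0}" using assms by simp
  qed
  then have "negligible ((cone2 u v \<inter> cball 0 1) \<inter> (cone2 v (- u) \<inter> cball 0 1))"
    by (intro negligible_subset[OF negligible_cross[OF u(2)]]) auto
  ultimately show ?thesis
    unfolding sector_def using measure_Un_negligible[OF lmeasurable_cone2 lmeasurable_cone2]
      measure_halfplane[OF u(1), of k] assms by (simp add: k_def)
qed

text \<open>The linear map sending \<open>u, v\<close> to \<open>u', v'\<close> preserves inner
  products, hence areas. It may reverse the orientation, so mirror images receive the same
  angle.\<close>

lemma sector_cong:
  assumes ne: "cross u v \<noteq> 0" and n: "norm u = norm u'" "norm v = norm v'" "u \<bullet> v = u' \<bullet> v'"
  shows "sector u v = sector u' v'"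
proof -
  define d where "d = cross u v"
  define f where "f w = (cross w v / d) *\<^sub>R u' + (cross u w / d) *\<^sub>R v'" for w
  have uu: "u \<bullet> u = u' \<bullet> u'" "v \<bullet> v = v' \<bullet> v'" using n by (simp_all add: dot_square_norm)
  have "(cross u' v')\<^sup>2 = (cross u v)\<^sup>2" using cross_identity[of u v] cross_identity[of u' v'] uu n by simp
  then have ne': "cross u' v' \<noteq> 0" using ne by auto
  have fuv: "f (s *\<^sub>R u + t *\<^sub>R v) = s *\<^sub>R u' + t *\<^sub>R v'" for s t
    using ne by (simp add: f_def cross_add d_def)
  have ex: "\<exists>s t. w = s *\<^sub>R u + t *\<^sub>R v" for w using cross_expand[OF ne, of w] by blast
  have "linear f" unfolding f_def
    by (rule linearI) (simp_all add: cross_add add_divide_distrib algebra_simps)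
  moreover have "f x \<bullet> f y = x \<bullet> y" for x y
  proof -
    obtain s t s' t' where "x = s *\<^sub>R u + t *\<^sub>R v" "y = s' *\<^sub>R u + t' *\<^sub>R v" using ex by metis
    then show ?thesis using fuv uu n(3)
      by (simp add: inner_add_left inner_add_right inner_commute[of v u] inner_commute[of v' u'])
  qed
  ultimately have o: "orthogonal_transformation f" by (simp add: orthogonal_transformation_def)
  then have nf: "norm (f x) = norm x" for x by (simp add: orthogonal_transformation_norm)
  have "f ` (cone2 u v \<inter> cball 0 1) = cone2 u' v' \<inter> cball 0 1"
  proof (intro equalityI subsetI)
    fix x assume "x \<in> f ` (cone2 u v \<inter> cball 0 1)"
    then obtain s t where st: "0 \<le> s" "0 \<le> t" "x = f (s *\<^sub>R u + t *\<^sub>R v)" "norm (s *\<^sub>R u + t *\<^sub>R v) \<le> 1"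
      by (auto simp: cone2_def)
    then have "norm x \<le> 1" using nf by simp
    then show "x \<in> cone2 u' v' \<inter> cball 0 1" using st fuv by (auto simp: cone2_def)
  next
    fix x assume "x \<in> cone2 u' v' \<inter> cball 0 1"
    then obtain s t where st: "0 \<le> s" "0 \<le> t" "x = f (s *\<^sub>R u + t *\<^sub>R v)" "norm x \<le> 1"
      using fuv by (auto simp: cone2_def)
    then have "s *\<^sub>R u + t *\<^sub>R v \<in> cone2 u v \<inter> cball 0 1" using nf by (auto simp: cone2_def)
    then show "x \<in> f ` (cone2 u v \<inter> cball 0 1)" using st by blast
  qed
  then show ?thesis unfolding sector_def using measure_orthogonal_image[OF o lmeasurable_cone2] by metis
qed

lemma sector_minus: "cross u v \<noteq> 0 \<Longrightarrow> sector (- u) (- v) = sector u v"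
  by (rule sector_cong[symmetric]) auto

text \<open>The exterior angle at \<open>q\<close>, moved to the origin between \<open>u\<close> and
  \<open>w\<close>, is split by \<open>v = u + w\<close> into the angles at \<open>p\<close> and
  \<open>r\<close>.\<close>

lemma sector_triangle:
  assumes "cross (q - p) (r - p) \<noteq> 0"
  shows "sector (q - p) (r - p) + sector (r - q) (p - q) + sector (p - r) (q - r) = straight"
proof -
  define u v where "u = q - p" and "v = r - p"
  define w where "w = v - u"
  have d: "cross u v \<noteq> 0" using assms by (simp add: u_def v_def)
  have uw: "cross u w \<noteq> 0" "cross v w \<noteq> 0" using d by (auto simp: w_def cross_add cross_commute[of v u])
  have "sector u w = sector u v + sector v w" by (rule sector_add[OF uw(1), of v 1 1]) (auto simp: w_def)
  moreover have "sector u w + sector w (- u) = straight" by (rule sector_half[OF uw(1)])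
  moreover have "sector (- v) (- w) = sector v w" by (rule sector_minus[OF uw(2)])
  moreover have "r - q = w" "p - q = - u" "p - r = - v" "q - r = - w" by (auto simp: u_def v_def w_def)
  ultimately show ?thesis unfolding u_def[symmetric] v_def[symmetric] by simp
qed

lemma sector_side_eq:
  assumes "cross (q - p) (r - p) \<noteq> 0" "dist r q = dist r p"
  shows "sector (q - p) (r - p) = sector (r - q) (p - q)"
proof -
  have "norm (r - p) = norm (r - q)" using assms by (simp add: dist_norm)
  moreover have "(q - p) \<bullet> (r - p) = (p - q) \<bullet> (r - q)"
  proof -
    have "(norm (r - p))\<^sup>2 = (norm (r - q))\<^sup>2" using calculation by simp
    then show ?thesis unfolding power2_norm_eq_inner
      by (simp add: inner_diff_left inner_diff_right inner_commute algebra_simps)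
  qed
  ultimately have "sector (q - p) (r - p) = sector (p - q) (r - q)"
    by (intro sector_cong assms) (auto simp: norm_minus_commute)
  then show ?thesis by (simp add: sector_commute)
qed

text \<open>Euclid's argument: mark \<open>d\<close> on the longer side with \<open>d\<close> and
  \<open>q\<close> equally far from \<open>r\<close>. The base angle of the triangle
  \<open>d q r\<close> is a proper part of the angle at \<open>q\<close>, and as an exterior angle
  of \<open>p q d\<close> it exceeds the angle at \<open>p\<close>.\<close>

lemma sector_side_less:
  assumes "cross (q - p) (r - p) \<noteq> 0" "dist r q < dist r p"
  shows "sector (q - p) (r - p) < sector (r - q) (p - q)"
proof -
  define u v where "u = p - r" and "v = q - r"
  define l where "l = norm v / norm u"
  have d: "cross u v \<noteq> 0" using assms(1) by (auto simp: u_def v_def cross_def algebra_simps)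
  then have uv: "u \<noteq> 0" "v \<noteq> 0" by auto
  have l: "0 < l" "l < 1" using assms uv by (auto simp: l_def u_def v_def dist_norm norm_minus_commute)
  define d where "d = r + l *\<^sub>R u"
  have dr: "d - r = l *\<^sub>R u" "r - d = - l *\<^sub>R u" by (simp_all add: d_def)
  have qd: "q - d = v - l *\<^sub>R u" "d - q = l *\<^sub>R u - v" by (auto simp: d_def v_def)
  have "dist r q = dist r d" using uv by (simp add: dist_norm dr v_def norm_minus_commute l_def)
  moreover have cd: "cross (q - d) (r - d) \<noteq> 0" using d l unfolding qd dr by (simp add: cross_add cross_commute[of v u])
  ultimately have iso: "sector (q - d) (r - d) = sector (r - q) (d - q)" by (intro sector_side_eq)
  have rq: "r - q = - v" "p - q = u - v" "q - p = v - u" "r - p = - u" by (auto simp: u_def v_def)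
  have 1: "sector (- v) (u - v) = sector (- v) (l *\<^sub>R u - v) + sector (l *\<^sub>R u - v) (u - v)"
    by (rule sector_add[where s = "1 - l" and t = l]) (use d l in \<open>auto simp: cross_add cross_commute[of v u] algebra_simps\<close>)
  have p1: "0 < sector (l *\<^sub>R u - v) (u - v)"
    by (rule sector_pos) (use d l in \<open>auto simp: cross_add cross_commute[of v u]\<close>)
  have 2: "sector (- u) (v - l *\<^sub>R u) = sector (- u) (v - u) + sector (v - u) (v - l *\<^sub>R u)"
    by (rule sector_add[where s = "1 - l" and t = 1]) (use d l in \<open>auto simp: cross_add cross_commute[of v u] algebra_simps\<close>)
  have p2: "0 < sector (v - u) (v - l *\<^sub>R u)"
    by (rule sector_pos) (use d l in \<open>auto simp: cross_add cross_commute[of v u]\<close>)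
  have 3: "sector (v - l *\<^sub>R u) (- l *\<^sub>R u) = sector (- u) (v - l *\<^sub>R u)"
    using sector_scale[OF l(1), of "- u" "v - l *\<^sub>R u"] by (simp add: sector_commute)
  show ?thesis using 1 2 3 p1 p2 iso unfolding rq qd dr by (simp add: sector_commute)
qed

text \<open>If \<open>u\<close> and \<open>v\<close> are perpendicular, replacing \<open>u\<close>
  by its negative keeps the angle, so both parts in \<open>sector_half\<close> agree. The acute case
  compares \<open>v\<close> with its component \<open>w\<close> perpendicular to
  \<open>u\<close>.\<close>

lemma sector_acute:
  assumes d: "cross u v \<noteq> 0"
  shows "u \<bullet> v = 0 \<Longrightarrow> 2 * sector u v = straight" "0 < u \<bullet> v \<Longrightarrow> 2 * sector u v < straight" "u \<bullet> v < 0 \<Longrightarrow> straight < 2 * sector u v"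
proof -
  have right: "2 * sector u w = straight" if "u \<bullet> w = 0" "cross u w \<noteq> 0" for u w
  proof -
    have "sector u w = sector (- u) w" by (rule sector_cong[OF that(2)]) (simp_all add: that)
    then show ?thesis using sector_half[OF that(2)] by (simp add: sector_commute)
  qed
  have ac: "2 * sector u v < straight" if "0 < u \<bullet> v" "cross u v \<noteq> 0" for u v
  proof -
    define l where "l = (u \<bullet> v) / (u \<bullet> u)"
    have u: "u \<bullet> u > 0" using that by auto
    have l: "l > 0" using u that by (simp add: l_def)
    define w where "w = v - l *\<^sub>R u"
    have w: "u \<bullet> w = 0" "cross u w \<noteq> 0" using u that by (auto simp: w_def l_def cross_add inner_diff_right)
    have "sector u w = sector u v + sector v w"
      by (rule sector_add[OF w(2), of v l 1]) (use l in \<open>auto simp: w_def\<close>)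
    moreover have "0 < sector v w" by (rule sector_pos) (use that l in \<open>auto simp: w_def cross_add cross_commute[of v u]\<close>)
    ultimately show ?thesis using right[OF w] by linarith
  qed
  show "u \<bullet> v = 0 \<Longrightarrow> 2 * sector u v = straight" using right d by blast
  show "0 < u \<bullet> v \<Longrightarrow> 2 * sector u v < straight" using ac d by blast
  assume "u \<bullet> v < 0"
  then have "2 * sector (- u) v < straight" by (intro ac) (use d in auto)
  then show "straight < 2 * sector u v" using sector_half[OF d] by (simp add: sector_commute)
qed

subsection \<open>Tilings by congruent triangles\<close>

text \<open>Extreme points depend on the set alone, so two descriptions of one tile as a convex hull
  can be compared.\<close>

definition verts :: "plane set \<Rightarrow> plane set" where
  "verts K = {x. x extreme_point_of K}"

lemma verts_tri:
  assumes "cross (q - p) (r - p) \<noteq> 0"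
  shows "verts (convex hull {p, q, r}) = {p, q, r}"
proof -
  have "\<not> affine_dependent {p, q, r}"
    using assms collinear_cross[of p q r] collinear_3_eq_affine_dependent[of p q r] by blast
  then show ?thesis unfolding verts_def using extreme_point_of_convex_hull_affine_independent by blast
qed

lemma cross_rotate: "cross (r - q) (p - q) = cross (q - p) (r - p)" "cross (p - r) (q - r) = cross (q - p) (r - p)"
  by (simp_all add: cross_def algebra_simps)

lemma cross_rotate_ne:
  assumes "cross (q - p) (r - p) \<noteq> 0"
  shows "cross (r - q) (p - q) \<noteq> 0" "cross (p - r) (q - r) \<noteq> 0"
    "cross (r - p) (q - p) \<noteq> 0" "cross (p - q) (r - q) \<noteq> 0" "cross (q - r) (p - r) \<noteq> 0"
  using assms by (auto simp: cross_def algebra_simps)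

lemma dens_vertices:
  assumes "cross (q - p) (r - p) \<noteq> 0"
  shows "dens (convex hull {p, q, r}) p = sector (q - p) (r - p)"
    "dens (convex hull {p, q, r}) q = sector (r - q) (p - q)"
    "dens (convex hull {p, q, r}) r = sector (p - r) (q - r)"
proof -
  have e: "{p, q, r} = {q, r, p}" "{p, q, r} = {r, p, q}" by auto
  show "dens (convex hull {p, q, r}) p = sector (q - p) (r - p)" by (rule dens_vertex[OF assms])
  show "dens (convex hull {p, q, r}) q = sector (r - q) (p - q)"
    unfolding e(1) by (rule dens_vertex) (rule cross_rotate_ne[OF assms])
  show "dens (convex hull {p, q, r}) r = sector (p - r) (q - r)"
    unfolding e(2) by (rule dens_vertex) (rule cross_rotate_ne[OF assms])
qed

lemma dist_inner:
  fixes p q r :: plane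
  shows "(dist q r)\<^sup>2 = (dist p q)\<^sup>2 + (dist r p)\<^sup>2 - 2 * ((q - p) \<bullet> (r - p))"
  unfolding dist_norm power2_norm_eq_inner
  by (simp add: inner_diff_left inner_diff_right inner_commute algebra_simps)

text \<open>By the law of cosines (\<open>dist_inner\<close>) the three lengths fix the inner
  product, and norms with inner product fix the angle.\<close>

lemma sss:
  assumes d: "cross (B - A) (C - A) \<noteq> 0" and k: "0 < k"
    and l: "dist q r = k * dist B C" "dist r p = k * dist C A" "dist p q = k * dist A B"
  shows "cross (q - p) (r - p) \<noteq> 0 \<and> sector (q - p) (r - p) = sector (B - A) (C - A)"
proof -
  define u v where "u = k *\<^sub>R (B - A)" and "v = k *\<^sub>R (C - A)"
  have n: "norm (q - p) = norm u" "norm (r - p) = norm v"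
    using l k by (simp_all add: u_def v_def dist_norm norm_minus_commute)
  have "2 * ((q - p) \<bullet> (r - p)) = k\<^sup>2 * (2 * ((B - A) \<bullet> (C - A)))"
    using dist_inner[of q r p] dist_inner[of B C A] unfolding l by (simp add: power_mult_distrib algebra_simps)
  then have i: "(q - p) \<bullet> (r - p) = u \<bullet> v" by (simp add: u_def v_def power2_eq_square)
  have d': "cross u v \<noteq> 0" using d k by (simp add: u_def v_def)
  have "(cross (q - p) (r - p))\<^sup>2 = (cross u v)\<^sup>2"
    using cross_identity[of "q - p" "r - p"] cross_identity[of u v] n i by (simp add: dot_square_norm)
  then have ne: "cross (q - p) (r - p) \<noteq> 0" using d' by auto
  have "sector (q - p) (r - p) = sector u v" by (rule sector_cong[OF ne n i])
  also have "\<dots> = sector (B - A) (C - A)"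
    unfolding u_def v_def using sector_scale[OF k] by (metis sector_commute)
  finally show ?thesis using ne by simp
qed

text \<open>Half-planes with nonparallel boundaries meet in an open set; this excludes edges
  transversal to a line under study.\<close>

lemma two_halfplanes:
  assumes "cross e u \<noteq> 0" "k1 \<noteq> 0" "k2 \<noteq> 0"
  obtains w where "0 < k1 * cross e w" "k2 * cross u w < 0"
proof
  let ?w = "(1 / (k2 * cross e u)) *\<^sub>R e + (1 / (k1 * cross e u)) *\<^sub>R u"
  have "k1 * cross e ?w = 1" using assms by (simp add: cross_add)
  then show "0 < k1 * cross e ?w" by simp
  have "k2 * cross u ?w = - 1" using assms cross_commute[of e u] by (simp add: cross_add)
  then show "k2 * cross u ?w < 0" by simp
qed

lemma parallel_scale:
  assumes "cross u e = 0" "u \<noteq> 0"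
  obtains l where "e = l *\<^sub>R u"
proof -
  have "collinear {0, u, e}" using collinear_cross[of 0 u e] assms by simp
  then show ?thesis using assms that unfolding collinear_lemma by auto
qed

text \<open>The scale factor \<open>t\<close> is real at this stage; that it is an integer is a
  result. Only lengths are prescribed, so tiles may be mirror images.\<close>

locale tiling =
  fixes A B C :: plane and \<P> :: "plane set set" and t :: real
  assumes tri: "cross (B - A) (C - A) \<noteq> 0"
    and t_pos: "0 < t"
    and fin: "finite \<P>"
    and cover: "\<Union>\<P> = convex hull {A, B, C}"
    and tile: "K \<in> \<P> \<Longrightarrow> \<exists>p q r. K = convex hull {p, q, r} \<and>
        dist q r = dist B C / t \<and> dist r p = dist C A / t \<and> dist p q = dist A B / t"
    and disj: "K \<in> \<P> \<Longrightarrow> L \<in> \<P> \<Longrightarrow> K \<noteq> L \<Longrightarrow> interior K \<inter> interior L = {}"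
begin

definition "a = dist B C / t"
definition "b = dist C A / t"
definition "c = dist A B / t"
definition "\<alpha> = sector (B - A) (C - A)"
definition "\<beta> = sector (C - B) (A - B)"
definition "\<gamma> = sector (A - C) (B - C)"
abbreviation "T \<equiv> convex hull {A, B, C}"

text \<open>The factor carries the orientation of \<open>A, B, C\<close>: the big triangle always
  counts as positively oriented, and its interior lies to the left of its sides.\<close>

definition D :: "plane \<Rightarrow> plane \<Rightarrow> real" where "D u v = cross (B - A) (C - A) * cross u v"

lemma D_simps [simp]:
  "D u u = 0" "D 0 v = 0" "D u 0 = 0"
  "D (s *\<^sub>R u) v = s * D u v" "D u (s *\<^sub>R v) = s * D u v"
  "D (- u) v = - D u v" "D u (- v) = - D u v"
  by (auto simp: D_def algebra_simps)

lemma D_add: "D (u + w) v = D u v + D w v" "D u (v + w) = D u v + D u w"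
  "D (u - w) v = D u v - D w v" "D u (v - w) = D u v - D u w"
  by (auto simp: D_def cross_add algebra_simps)

lemma D_commute: "D v u = - D u v"
  by (simp add: D_def cross_commute[of v u])

lemma D_zero_iff: "D u v = 0 \<longleftrightarrow> cross u v = 0"
  using tri by (simp add: D_def)

lemma D_pos_ne: "0 < D u v \<Longrightarrow> cross u v \<noteq> 0"
  by (auto simp: D_def)

lemma D_tri: "0 < D (B - A) (C - A)" "0 < D (C - B) (A - B)" "0 < D (A - C) (B - C)"
proof -
  have "0 < cross (B - A) (C - A) * cross (B - A) (C - A)" using tri by (metis not_real_square_gt_zero)
  then show "0 < D (B - A) (C - A)" "0 < D (C - B) (A - B)" "0 < D (A - C) (B - C)"
    unfolding D_def cross_rotate(1)[of C B A] cross_rotate(2)[of A C B] by simp_all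
qed

lemma sides_pos: "0 < a" "0 < b" "0 < c"
proof -
  have "B \<noteq> C" "C \<noteq> A" "A \<noteq> B" using tri by auto
  then show "0 < a" "0 < b" "0 < c" using t_pos by (simp_all add: a_def b_def c_def)
qed

lemma angles_pos: "0 < \<alpha>" "0 < \<beta>" "0 < \<gamma>"
  unfolding \<alpha>_def \<beta>_def \<gamma>_def by (intro sector_pos tri cross_rotate_ne[OF tri])+

lemma angle_sum: "\<alpha> + \<beta> + \<gamma> = straight"
  unfolding \<alpha>_def \<beta>_def \<gamma>_def by (rule sector_triangle[OF tri])

lemma angle_eq:
  "a = b \<Longrightarrow> \<alpha> = \<beta>" "b = c \<Longrightarrow> \<beta> = \<gamma>" "c = a \<Longrightarrow> \<gamma> = \<alpha>"
  using t_pos sector_side_eq[OF tri] sector_side_eq[OF cross_rotate_ne(1)[OF tri]] sector_side_eq[OF cross_rotate_ne(2)[OF tri]]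
  unfolding a_def b_def c_def \<alpha>_def \<beta>_def \<gamma>_def by (auto simp: dist_commute)

lemma angle_less:
  "a < b \<Longrightarrow> \<alpha> < \<beta>" "b < c \<Longrightarrow> \<beta> < \<gamma>" "c < a \<Longrightarrow> \<gamma> < \<alpha>"
  "b < a \<Longrightarrow> \<beta> < \<alpha>" "c < b \<Longrightarrow> \<gamma> < \<beta>" "a < c \<Longrightarrow> \<alpha> < \<gamma>"
proof -
  note n = cross_rotate_ne[OF tri]
  have *: "x / t < y / t \<longleftrightarrow> x < y" for x y :: real using t_pos by (simp add: divide_less_cancel)
  show "a < b \<Longrightarrow> \<alpha> < \<beta>" "b < c \<Longrightarrow> \<beta> < \<gamma>" "c < a \<Longrightarrow> \<gamma> < \<alpha>"
    using sector_side_less[OF tri] sector_side_less[OF n(1)] sector_side_less[OF n(2)]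
    unfolding a_def b_def c_def \<alpha>_def \<beta>_def \<gamma>_def * by (auto simp: dist_commute)
  show "b < a \<Longrightarrow> \<beta> < \<alpha>" "c < b \<Longrightarrow> \<gamma> < \<beta>" "a < c \<Longrightarrow> \<alpha> < \<gamma>"
    using sector_side_less[OF n(4)] sector_side_less[OF n(5)] sector_side_less[OF n(3)]
    unfolding a_def b_def c_def \<alpha>_def \<beta>_def \<gamma>_def *
    by (simp_all add: dist_commute sector_commute[of "A - B"] sector_commute[of "B - C"] sector_commute[of "C - A"])
qed

lemma angle_eq_iff: "\<alpha> = \<beta> \<longleftrightarrow> a = b" "\<beta> = \<gamma> \<longleftrightarrow> b = c" "\<gamma> = \<alpha> \<longleftrightarrow> c = a"
  using angle_eq angle_less by (metis less_irrefl linorder_neqE_linordered_idom)+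

definition perms :: "'z \<Rightarrow> 'z \<Rightarrow> 'z \<Rightarrow> ('z \<times> 'z \<times> 'z) set" where
  "perms x y z = {(x,y,z), (y,z,x), (z,x,y), (x,z,y), (y,x,z), (z,y,x)}"

definition shape :: "plane \<Rightarrow> plane \<Rightarrow> plane \<Rightarrow> bool" where
  "shape p q r \<longleftrightarrow> ((dist q r, sector (q - p) (r - p)), (dist r p, sector (r - q) (p - q)), (dist p q, sector (p - r) (q - r)))
     \<in> perms (a, \<alpha>) (b, \<beta>) (c, \<gamma>)"

lemma shape_rotate: "shape p q r \<Longrightarrow> shape q r p"
  unfolding shape_def perms_def by auto

lemma shape_swap: "shape p q r \<Longrightarrow> shape q p r"
  unfolding shape_def perms_def by (auto simp: dist_commute sector_commute)

lemma shapeI: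
  assumes "dist q r = a" "dist r p = b" "dist p q = c"
  shows "shape p q r" "cross (q - p) (r - p) \<noteq> 0"
proof -
  have l: "dist q r = 1 / t * dist B C" "dist r p = 1 / t * dist C A" "dist p q = 1 / t * dist A B"
    using assms by (auto simp: a_def b_def c_def)
  have k: "0 < 1 / t" using t_pos by simp
  have d: "cross (C - B) (A - B) \<noteq> 0" "cross (A - C) (B - C) \<noteq> 0" using cross_rotate_ne[OF tri] by blast+
  show "shape p q r"
    using sss[OF tri k l] sss[OF d(1) k l(2,3,1)] sss[OF d(2) k l(3,1,2)] assms
    unfolding shape_def perms_def \<alpha>_def \<beta>_def \<gamma>_def by simp
  show "cross (q - p) (r - p) \<noteq> 0" using sss[OF tri k l] by blast
qed

text \<open>Comparing extreme points identifies the given vertices with those of the tile up to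
  order, and \<open>shape\<close> is insensitive to the order.\<close>

lemma tile_shape:
  assumes "convex hull {p, q, r} \<in> \<P>" "cross (q - p) (r - p) \<noteq> 0"
  shows "shape p q r"
proof -
  from tile[OF assms(1)] obtain p' q' r' where t': "convex hull {p, q, r} = convex hull {p', q', r'}"
    "dist q' r' = dist B C / t" "dist r' p' = dist C A / t" "dist p' q' = dist A B / t" by auto
  then have t: "convex hull {p, q, r} = convex hull {p', q', r'}"
    "dist q' r' = a" "dist r' p' = b" "dist p' q' = c" by (auto simp: a_def b_def c_def)
  note s = shapeI[OF t(2-4)]
  have "verts (convex hull {p, q, r}) = {p', q', r'}" unfolding t(1) by (rule verts_tri[OF s(2)])
  then have eq: "{p, q, r} = {p', q', r'}" by (rule trans[OF verts_tri[OF assms(2), symmetric]])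
  have ne: "p' \<noteq> q'" "q' \<noteq> r'" "p' \<noteq> r'" "p \<noteq> q" "q \<noteq> r" "p \<noteq> r" using s(2) assms(2) by auto
  have "p \<in> {p', q', r'}" "q \<in> {p', q', r'}" "r \<in> {p', q', r'}" using eq by blast+
  then have "(p, q, r) \<in> perms p' q' r'" using ne unfolding perms_def by auto
  moreover note s1 = s(1)
  moreover note s2 = shape_rotate[OF s1]
  moreover note s3 = shape_rotate[OF s2]
  moreover note shape_swap[OF s1] shape_swap[OF s2] shape_swap[OF s3]
  ultimately show ?thesis unfolding perms_def by auto
qed

lemma tile_obtain:
  assumes "K \<in> \<P>"
  obtains p q r where "K = convex hull {p, q, r}" "cross (q - p) (r - p) \<noteq> 0" "shape p q r"
proof -
  from tile[OF assms] obtain p q r where t: "K = convex hull {p, q, r}"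
    "dist q r = dist B C / t" "dist r p = dist C A / t" "dist p q = dist A B / t" by auto
  then have "dist q r = a" "dist r p = b" "dist p q = c" by (auto simp: a_def b_def c_def)
  from shapeI[OF this] t(1) show ?thesis using that by blast
qed

lemma tile_convex: "K \<in> \<P> \<Longrightarrow> convex K"
  by (erule tile_obtain) simp

lemma tile_closed: "K \<in> \<P> \<Longrightarrow> closed K"
  by (erule tile_obtain) (simp add: compact_imp_closed finite_imp_compact_convex_hull)

lemma tile_verts: "K \<in> \<P> \<Longrightarrow> finite (verts K)"
  by (erule tile_obtain) (simp add: verts_tri)

lemma dens_nonneg: "0 \<le> dens K z"
  by (simp add: dens_def)

lemma dens_sum: "(\<Sum>K\<in>\<P>. dens K z) = dens T z"
  by (rule sum_dens) (auto simp: fin tile_convex tile_closed cover disj)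

lemma dens_sum_le: "F \<subseteq> \<P> \<Longrightarrow> (\<Sum>K\<in>F. dens K z) \<le> dens T z"
  unfolding dens_sum[symmetric] by (rule sum_mono2) (auto simp: fin dens_nonneg)

lemma shape_angles:
  assumes "shape p q r"
  shows "sector (q - p) (r - p) \<in> {\<alpha>, \<beta>, \<gamma>}" "sector (r - q) (p - q) \<in> {\<alpha>, \<beta>, \<gamma>}" "sector (p - r) (q - r) \<in> {\<alpha>, \<beta>, \<gamma>}"
  using assms unfolding shape_def perms_def by auto

lemma shape_dists:
  assumes "shape p q r"
  shows "dist p q \<in> {a, b, c}"
  using assms unfolding shape_def perms_def by auto

lemma dens_values:
  assumes "K \<in> \<P>"
  shows "dens K z \<in> {0, \<alpha>, \<beta>, \<gamma>, straight, 2 * straight}"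
proof (cases "z \<in> K")
  case False
  then show ?thesis by (simp add: dens_notin)
next
  case True
  obtain p q r where K: "K = convex hull {p, q, r}" "cross (q - p) (r - p) \<noteq> 0" "shape p q r"
    using tile_obtain[OF assms] .
  have e: "{p, q, r} = {q, r, p}" "{p, q, r} = {r, p, q}" by auto
  have n: "cross (r - q) (p - q) \<noteq> 0" "cross (p - r) (q - r) \<noteq> 0" using cross_rotate_ne[OF K(2)] by blast+
  from K(2) True[unfolded K(1)] show ?thesis
  proof (cases rule: tri_cases)
    case 4 then show ?thesis using dens_edge[OF K(2)] K(1) by simp
  next
    case 5 then show ?thesis using dens_edge[OF n(1)] K(1) e by simp
  next
    case 6 then show ?thesis using dens_edge[OF n(2)] K(1) e by simp
  next
    case 7 then show ?thesis using dens_interior K(1) by simp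
  qed (use dens_vertices[OF K(2)] shape_angles[OF K(3)] K(1) in auto)
qed

text \<open>The source of all angle equations: whatever unknown tiles remain at a point, their total
  is a combination with natural coefficients.\<close>

lemma dens_fill:
  assumes "finite F" "F \<subseteq> \<P>"
  shows "\<exists>i j k m. (\<Sum>K\<in>F. dens K z) = real i * \<alpha> + real j * \<beta> + real k * \<gamma> + real m * straight"
  using assms
proof (induction F rule: finite_induct)
  case empty
  show ?case by (intro exI[of _ 0]) simp
next
  case (insert K F)
  have "F \<subseteq> \<P>" using insert by simp
  from insert.IH[OF this] obtain i j k m
    where ih: "(\<Sum>K\<in>F. dens K z) = real i * \<alpha> + real j * \<beta> + real k * \<gamma> + real m * straight" by (elim exE)
  have "\<exists>i j k m. dens K z = real i * \<alpha> + real j * \<beta> + real k * \<gamma> + real m * straight"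
  proof -
    consider "dens K z = 0" | "dens K z = \<alpha>" | "dens K z = \<beta>" | "dens K z = \<gamma>" | "dens K z = straight" | "dens K z = 2 * straight"
      using dens_values[of K z] insert by auto
    then show ?thesis
    proof cases
      case 1 then show ?thesis by (intro exI[of _ 0]) simp
    next
      case 2 then show ?thesis by - (rule exI[of _ 1], rule exI[of _ 0], rule exI[of _ 0], rule exI[of _ 0], simp)
    next
      case 3 then show ?thesis by - (rule exI[of _ 0], rule exI[of _ 1], rule exI[of _ 0], rule exI[of _ 0], simp)
    next
      case 4 then show ?thesis by - (rule exI[of _ 0], rule exI[of _ 0], rule exI[of _ 1], rule exI[of _ 0], simp)
    next
      case 5 then show ?thesis by - (rule exI[of _ 0], rule exI[of _ 0], rule exI[of _ 0], rule exI[of _ 1], simp)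
    next
      case 6 then show ?thesis by - (rule exI[of _ 0], rule exI[of _ 0], rule exI[of _ 0], rule exI[of _ 2], simp)
    qed
  qed
  then obtain i' j' k' m' where "dens K z = real i' * \<alpha> + real j' * \<beta> + real k' * \<gamma> + real m' * straight" by (elim exE)
  then have "(\<Sum>K\<in>insert K F. dens K z) = real (i + i') * \<alpha> + real (j + j') * \<beta> + real (k + k') * \<gamma> + real (m + m') * straight"
    using insert ih by (simp add: algebra_simps)
  then show ?case by - (rule exI, rule exI, rule exI, rule exI, assumption)
qed

text \<open>Edges carry a direction so that the two sides of a line can be studied separately:
  reversing the direction changes the side.\<close>

definition left_edge :: "plane set \<Rightarrow> plane \<Rightarrow> plane \<Rightarrow> bool" where
  "left_edge K p q \<longleftrightarrow> (\<exists>r. K = convex hull {p, q, r} \<and> 0 < D (q - p) (r - p))"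

lemma left_edge_fcone:
  assumes "left_edge K p q" "z \<in> open_segment p q"
  shows "fcone K z = {w. 0 \<le> D (q - p) w}"
proof -
  obtain r where r: "K = convex hull {p, q, r}" "0 < D (q - p) (r - p)" using assms left_edge_def by blast
  then have ne: "cross (q - p) (r - p) \<noteq> 0" using D_pos_ne by blast
  have "0 < (cross (B - A) (C - A) * cross (q - p) (r - p))" using r by (simp add: D_def)
  then show ?thesis unfolding r(1) fcone_edge[OF ne assms(2)] D_def
    by (auto simp: zero_le_mult_iff zero_less_mult_iff)
qed

lemma left_edge_dens:
  assumes "left_edge K p q" "z \<in> open_segment p q"
  shows "dens K z = straight"
proof -
  obtain r where r: "K = convex hull {p, q, r}" "0 < D (q - p) (r - p)" using assms left_edge_def by blast
  then have ne: "cross (q - p) (r - p) \<noteq> 0" using D_pos_ne by blast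
  show ?thesis using dens_edge[OF ne assms(2)] r(1) by simp
qed

lemma open_D_less: "open {w. D u w < 0}" "open {w. 0 < D u w}"
  unfolding D_def cross_def by (intro open_Collect_less continuous_intros)+

lemma line_open_segment:
  assumes "s1 < s" "s < s2" "u \<noteq> 0"
  shows "x + s *\<^sub>R u \<in> open_segment (x + s1 *\<^sub>R u) (x + s2 *\<^sub>R (u :: plane))"
proof -
  define k where "k = (s - s1) / (s2 - s1)"
  have "0 < k" "k < 1" using assms by (auto simp: k_def)
  moreover have "s = (1 - k) * s1 + k * s2" using assms unfolding k_def by (simp add: divide_simps) (simp add: algebra_simps)
  then have "s *\<^sub>R u = (1 - k) *\<^sub>R s1 *\<^sub>R u + k *\<^sub>R s2 *\<^sub>R u"
    by (simp add: scaleR_add_left)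
  then have "x + s *\<^sub>R u = (1 - k) *\<^sub>R (x + s1 *\<^sub>R u) + k *\<^sub>R (x + s2 *\<^sub>R u)"
    by (simp add: algebra_simps)
  moreover have "x + s1 *\<^sub>R u \<noteq> x + s2 *\<^sub>R u" using assms by auto
  ultimately show ?thesis unfolding in_segment by blast
qed

text \<open>At a common inner point both tiles have the same half-plane of directions, which
  different tiles cannot share.\<close>

lemma left_edge_overlap:
  assumes "K \<in> \<P>" "K' \<in> \<P>" "u \<noteq> 0"
    and "left_edge K (x + s1 *\<^sub>R u) (x + s2 *\<^sub>R u)" "left_edge K' (x + s1' *\<^sub>R u) (x + s2' *\<^sub>R u)"
    and "s1 < s" "s < s2" "s1' < s" "s < s2'"
  shows "K = K'"
proof (rule ccontr)
  assume "K \<noteq> K'"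
  let ?z = "x + s *\<^sub>R u"
  have "fcone K ?z = {w. 0 \<le> D ((s2 - s1) *\<^sub>R u) w}" "fcone K' ?z = {w. 0 \<le> D ((s2' - s1') *\<^sub>R u) w}"
    using left_edge_fcone[OF assms(4) line_open_segment] left_edge_fcone[OF assms(5) line_open_segment] assms
    by (simp_all add: algebra_simps)
  moreover have "negligible (fcone K ?z \<inter> fcone K' ?z)"
    using \<open>K \<noteq> K'\<close> assms by (intro negligible_fcone_Int tile_convex disj) auto
  ultimately have "negligible {w. 0 < D u w}"
    by (elim negligible_subset) (use assms in auto)
  moreover have "{w. 0 < D u w} \<noteq> {}"
  proof -
    define w :: plane where "w = vector [- u $ 2, u $ 1]"
    have "cross u w = u \<bullet> u" by (simp add: w_def cross_def inner_vec_def sum_2)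
    then have "cross u w \<noteq> 0" using assms by simp
    then have "D u w \<noteq> 0" using D_zero_iff by simp
    then have "0 < D u w \<or> 0 < D u (- w)" by auto
    then show ?thesis by blast
  qed
  ultimately show False using open_not_negligible open_D_less by blast
qed

text \<open>The third vertex is off the line, so the ends of both edges are the same two vertices,
  in the same order.\<close>

lemma left_edge_unique:
  assumes "u \<noteq> 0" "s1 < s2" "s1' < s2'"
    and "left_edge K (x + s1 *\<^sub>R u) (x + s2 *\<^sub>R u)" "left_edge K (x + s1' *\<^sub>R u) (x + s2' *\<^sub>R u)"
  shows "s1' = s1 \<and> s2' = s2"
proof -
  obtain r where r: "K = convex hull {x + s1 *\<^sub>R u, x + s2 *\<^sub>R u, r}" "0 < D ((s2 - s1) *\<^sub>R u) (r - (x + s1 *\<^sub>R u))"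
    using assms(4) unfolding left_edge_def by (auto simp: algebra_simps)
  obtain r' where r': "K = convex hull {x + s1' *\<^sub>R u, x + s2' *\<^sub>R u, r'}" "0 < D ((s2' - s1') *\<^sub>R u) (r' - (x + s1' *\<^sub>R u))"
    using assms(5) unfolding left_edge_def by (auto simp: algebra_simps)
  have "verts K = {x + s1 *\<^sub>R u, x + s2 *\<^sub>R u, r}"
    using r D_zero_iff unfolding r(1) by (intro verts_tri) (metis add_diff_cancel_left less_irrefl scaleR_left_diff_distrib)
  moreover have "verts K = {x + s1' *\<^sub>R u, x + s2' *\<^sub>R u, r'}"
    using r' D_zero_iff unfolding r'(1) by (intro verts_tri) (metis add_diff_cancel_left less_irrefl scaleR_left_diff_distrib)
  ultimately have eq: "{x + s1 *\<^sub>R u, x + s2 *\<^sub>R u, r} = {x + s1' *\<^sub>R u, x + s2' *\<^sub>R u, r'}" by simp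
  have "r \<noteq> x + s *\<^sub>R u" for s
  proof
    assume "r = x + s *\<^sub>R u"
    then have "r - (x + s1 *\<^sub>R u) = (s - s1) *\<^sub>R u" by (simp add: algebra_simps)
    then show False using r(2) by simp
  qed
  then have "x + s1' *\<^sub>R u \<in> {x + s1 *\<^sub>R u, x + s2 *\<^sub>R u}" "x + s2' *\<^sub>R u \<in> {x + s1 *\<^sub>R u, x + s2 *\<^sub>R u}"
    using eq by blast+
  then show ?thesis using assms by auto
qed

text \<open>A tile reached by \<open>v\<close> is confined to the left of the line and has no vertex
  at \<open>z\<close>. Hence \<open>z\<close> is neither in its interior nor on a transversal edge,
  and one of its edges runs along \<open>u\<close>. Confinement is asked only up to null sets,
  because disjoint interiors give no more.\<close>

lemma edge_coverage:
  assumes u: "u \<noteq> 0" and v: "v \<in> fcone T z"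
    and neg: "\<And>K. K \<in> \<P> \<Longrightarrow> v \<in> fcone K z \<Longrightarrow> negligible (fcone K z \<inter> {w. D u w < 0})"
    and gen: "\<And>K. K \<in> \<P> \<Longrightarrow> z \<notin> verts K"
  shows "\<exists>K\<in>\<P>. \<exists>p q l. left_edge K p q \<and> z \<in> open_segment p q \<and> 0 < l \<and> q - p = l *\<^sub>R u"
proof -
  have "fcone T z = (\<Union>K\<in>\<P>. fcone K z)"
    by (rule fcone_Union) (auto simp: fin tile_convex tile_closed cover)
  then obtain K where K: "K \<in> \<P>" "v \<in> fcone K z" using v by blast
  then have zK: "z \<in> K" by (auto simp: fcone_def)
  note neg = neg[OF K]
  \<comment> \<open>One edge through \<open>z\<close> is treated here; the other two follow by
    rotating the names of the vertices.\<close>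
  have claim: ?thesis if pqr: "K = convex hull {p, q, r}" "cross (q - p) (r - p) \<noteq> 0" and z: "z \<in> open_segment p q" for p q r
  proof -
    have fc: "fcone K z = {w. 0 \<le> cross (q - p) (r - p) * cross (q - p) w}" unfolding pqr(1) by (rule fcone_edge[OF pqr(2) z])
    have "cross (q - p) u = 0"
    proof (rule ccontr)
      assume "cross (q - p) u \<noteq> 0"
      then obtain w where w: "0 < cross (q - p) (r - p) * cross (q - p) w" "cross (B - A) (C - A) * cross u w < 0"
        using two_halfplanes pqr(2) tri by metis
      let ?S = "{w. 0 < cross (q - p) (r - p) * cross (q - p) w} \<inter> {w. D u w < 0}"
      have "open ?S" unfolding D_def cross_def
        by (intro open_Int open_Collect_less continuous_intros)
      moreover have "w \<in> ?S" using w by (simp add: D_def)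
      moreover have "negligible ?S" using neg unfolding fc by (rule negligible_subset) auto
      ultimately show False using open_not_negligible by blast
    qed
    then obtain l where l: "q - p = l *\<^sub>R u" using parallel_scale u cross_commute by (metis neg_equal_0_iff_equal)
    have Dr: "D (q - p) (r - p) \<noteq> 0" using pqr(2) D_zero_iff by simp
    have Dw: "0 \<le> D u w" if "w \<in> fcone K z" "w = r - p" for w
    proof (rule ccontr)
      assume "\<not> 0 \<le> D u w"
      then have Duw: "D u w < 0" by simp
      let ?S = "{w. 0 < cross (q - p) (r - p) * cross (q - p) w} \<inter> {w. D u w < 0}"
      have "open ?S" unfolding D_def cross_def
        by (intro open_Int open_Collect_less continuous_intros)
      moreover have "w \<in> ?S" using Duw pqr(2) that by (simp add: zero_less_mult_iff) linarith
      moreover have "negligible ?S" using neg unfolding fc by (rule negligible_subset) auto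
      ultimately show False using open_not_negligible by blast
    qed
    have "r - p \<in> fcone K z" unfolding fc by simp
    then have Du: "0 \<le> D u (r - p)" using Dw by blast
    have Dl: "D (q - p) (r - p) = l * D u (r - p)" unfolding l by simp
    show ?thesis
    proof (cases "0 < l")
      case True
      then have "0 < D (q - p) (r - p)" using Dr Dl Du by (simp add: less_le)
      then have "left_edge K p q" using pqr(1) left_edge_def by blast
      then show ?thesis using K(1) z True l by blast
    next
      \<comment> \<open>The edge runs against \<open>u\<close>; exchanging its ends puts the tile on
        the left.\<close>
      case False
      then have "l < 0" using l Dr by (cases "l = 0") auto
      then have "D (q - p) (r - p) < 0" using Dr Dl Du by (simp add: mult_neg_pos less_le mult_le_0_iff)
      then have "0 < D (p - q) (r - q)" unfolding D_def by (simp add: cross_def algebra_simps)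
      moreover have "K = convex hull {q, p, r}" using pqr(1) by (simp add: insert_commute)
      ultimately have "left_edge K q p" using left_edge_def by blast
      moreover have "p - q = (- l) *\<^sub>R u" using l by (metis minus_diff_eq scaleR_minus_left)
      moreover have "0 < - l" using \<open>l < 0\<close> by simp
      ultimately show ?thesis using K(1) z by (metis open_segment_commute)
    qed
  qed
  obtain p q r where pqr: "K = convex hull {p, q, r}" "cross (q - p) (r - p) \<noteq> 0"
    using tile_obtain[OF K(1)] by metis
  have e: "{p, q, r} = {q, r, p}" "{p, q, r} = {r, p, q}" by auto
  have n: "cross (r - q) (p - q) \<noteq> 0" "cross (p - r) (q - r) \<noteq> 0" using cross_rotate_ne[OF pqr(2)] by blast+
  have nv: "z \<noteq> p" "z \<noteq> q" "z \<noteq> r" using gen[OF K(1)] verts_tri[OF pqr(2)] pqr(1) by auto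
  from pqr(2) zK[unfolded pqr(1)] show ?thesis
  proof (cases rule: tri_cases)
    case 4
    then show ?thesis using claim[OF pqr] by blast
  next
    case 5
    then show ?thesis using claim[OF _ n(1)] pqr(1) e by simp
  next
    case 6
    then show ?thesis using claim[OF _ n(2)] pqr(1) e by simp
  next
    case 7
    then have "fcone K z = UNIV" using fcone_interior pqr(1) by blast
    then have "negligible {w. D u w < 0}" using neg by simp
    moreover have "{w. D u w < 0} \<noteq> {}"
    proof -
      define w :: plane where "w = vector [- u $ 2, u $ 1]"
      have "cross u w = u \<bullet> u" by (simp add: w_def cross_def inner_vec_def sum_2)
      then have "D u w \<noteq> 0" using u D_zero_iff by simp
      then have "D u w < 0 \<or> D u (- w) < 0" by auto
      then show ?thesis by blast
    qed
    ultimately show ?thesis using open_not_negligible open_D_less by blast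
  qed (use nv in auto)
qed

end

subsection \<open>Edges along a line\<close>

text \<open>The three values may coincide, so they do not determine the counts. The second part
  keeps what matters later: if only values equal to \<open>e\<close> are counted, every term is
  \<open>e\<close>.\<close>

lemma sum_of_three_values:
  fixes g :: "nat \<Rightarrow> real"
  assumes "\<And>i. i < N \<Longrightarrow> g i \<in> {x, y, z}"
  shows "\<exists>p q s. (\<Sum>i<N. g i) = real p * x + real q * y + real s * z \<and>
    (\<forall>e. (x \<noteq> e \<longrightarrow> p = 0) \<and> (y \<noteq> e \<longrightarrow> q = 0) \<and> (z \<noteq> e \<longrightarrow> s = 0) \<longrightarrow> (\<forall>i<N. g i = e))"
  using assms
proof (induction N)
  case 0
  show ?case by (rule exI[of _ 0], rule exI[of _ 0], rule exI[of _ 0]) simp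
next
  case (Suc N)
  from Suc.IH obtain p q s where ih: "(\<Sum>i<N. g i) = real p * x + real q * y + real s * z"
    "\<And>e. (x \<noteq> e \<longrightarrow> p = 0) \<and> (y \<noteq> e \<longrightarrow> q = 0) \<and> (z \<noteq> e \<longrightarrow> s = 0) \<Longrightarrow> (\<forall>i<N. g i = e)"
    using Suc.prems by (metis less_Suc_eq)
  consider "g N = x" | "g N = y" | "g N = z" using Suc.prems[of N] by auto
  then show ?case
  proof cases
    case 1
    show ?thesis by (rule exI[of _ "Suc p"], rule exI[of _ q], rule exI[of _ s])
      (use 1 ih in \<open>auto simp: less_Suc_eq algebra_simps\<close>)
  next
    case 2
    show ?thesis by (rule exI[of _ p], rule exI[of _ "Suc q"], rule exI[of _ s])
      (use 2 ih in \<open>auto simp: less_Suc_eq algebra_simps\<close>)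
  next
    case 3
    show ?thesis by (rule exI[of _ p], rule exI[of _ q], rule exI[of _ "Suc s"])
      (use 3 ih in \<open>auto simp: less_Suc_eq algebra_simps\<close>)
  qed
qed

lemma open_segment_param:
  fixes x u p q :: plane
  assumes "x + s *\<^sub>R u \<in> open_segment p q" "q - p = l *\<^sub>R u" "0 < l"
  shows "\<exists>s1 s2. s1 < s \<and> s < s2 \<and> p = x + s1 *\<^sub>R u \<and> q = x + s2 *\<^sub>R u"
proof -
  obtain k where k: "0 < k" "k < 1" "x + s *\<^sub>R u = (1 - k) *\<^sub>R p + k *\<^sub>R q"
    using assms by (auto simp: in_segment)
  have q: "q = p + l *\<^sub>R u" using assms(2) by (simp add: algebra_simps)
  have "x + s *\<^sub>R u = p + (k * l) *\<^sub>R u" using k(3) unfolding q by (simp add: algebra_simps)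
  then have p: "p = x + (s - k * l) *\<^sub>R u" by (simp add: algebra_simps)
  have "q = x + (s + (1 - k) * l) *\<^sub>R u" unfolding q p by (simp add: algebra_simps)
  then show ?thesis using p k assms by (intro exI[of _ "s - k * l"] exI[of _ "s + (1 - k) * l"]) simp
qed

context tiling begin

lemma left_edge_shape:
  assumes "K \<in> \<P>" "left_edge K p q"
  obtains r where "K = convex hull {p, q, r}" "0 < D (q - p) (r - p)" "cross (q - p) (r - p) \<noteq> 0" "shape p q r"
proof -
  obtain r where r: "K = convex hull {p, q, r}" "0 < D (q - p) (r - p)" using assms left_edge_def by blast
  then show ?thesis using that tile_shape assms D_pos_ne by blast
qed

lemma left_edge_verts:
  assumes "left_edge K p q"
  shows "p \<in> verts K" "q \<in> verts K"
proof -
  obtain r where r: "K = convex hull {p, q, r}" "0 < D (q - p) (r - p)" using assms left_edge_def by blast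
  then show "p \<in> verts K" "q \<in> verts K" using verts_tri[OF D_pos_ne[OF r(2)]] by auto
qed

lemma left_edge_length:
  assumes "K \<in> \<P>" "left_edge K p q"
  shows "dist p q \<in> {a, b, c}"
  using left_edge_shape[OF assms] shape_dists by metis

lemma left_edge_a:
  assumes "K \<in> \<P>" "left_edge K p q" "dist p q = a"
  obtains r where "K = convex hull {p, q, r}" "0 < D (q - p) (r - p)"
    "dist q r = b \<and> dist r p = c \<and> dens K p = \<beta> \<and> dens K q = \<gamma> \<or>
     dist q r = c \<and> dist r p = b \<and> dens K p = \<gamma> \<and> dens K q = \<beta>"
proof -
  obtain r where r: "K = convex hull {p, q, r}" "0 < D (q - p) (r - p)" "cross (q - p) (r - p) \<noteq> 0" "shape p q r"
    using left_edge_shape[OF assms(1,2)] .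
  have "dens K p = sector (q - p) (r - p)" "dens K q = sector (r - q) (p - q)"
    using dens_vertices[OF r(3)] r(1) by auto
  then show ?thesis using that[OF r(1,2)] r(4) assms(3) angle_eq
    unfolding shape_def perms_def by auto
qed

lemma left_edge_b:
  assumes "K \<in> \<P>" "left_edge K p q" "dist p q = b"
  obtains r where "K = convex hull {p, q, r}" "0 < D (q - p) (r - p)"
    "dist q r = c \<and> dist r p = a \<and> dens K p = \<gamma> \<and> dens K q = \<alpha> \<or>
     dist q r = a \<and> dist r p = c \<and> dens K p = \<alpha> \<and> dens K q = \<gamma>"
proof -
  obtain r where r: "K = convex hull {p, q, r}" "0 < D (q - p) (r - p)" "cross (q - p) (r - p) \<noteq> 0" "shape p q r"
    using left_edge_shape[OF assms(1,2)] .
  have "dens K p = sector (q - p) (r - p)" "dens K q = sector (r - q) (p - q)"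
    using dens_vertices[OF r(3)] r(1) by auto
  then show ?thesis using that[OF r(1,2)] r(4) assms(3) angle_eq
    unfolding shape_def perms_def by auto
qed

text \<open>Such a parameter is a forced end: edges on the left may stop there but not run across,
  so a segment between two of them can be measured on its own.\<close>

definition blocked :: "plane \<Rightarrow> plane \<Rightarrow> real \<Rightarrow> bool" where
  "blocked x u s \<longleftrightarrow> (\<forall>K\<in>\<P>. \<forall>s1 s2. left_edge K (x + s1 *\<^sub>R u) (x + s2 *\<^sub>R u) \<longrightarrow> \<not> (s1 < s \<and> s < s2))"

text \<open>Vertices are exempt because \<open>edge_coverage\<close> cannot be applied there; as
  they are finite in number, the edges still leave no gap.\<close>

definition covered :: "plane \<Rightarrow> plane \<Rightarrow> real \<Rightarrow> bool" where
  "covered x u l \<longleftrightarrow> (\<forall>s. 0 < s \<and> s < l \<and> (\<forall>K\<in>\<P>. x + s *\<^sub>R u \<notin> verts K) \<longrightarrow>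
     (\<exists>K\<in>\<P>. \<exists>s1 s2. s1 < s \<and> s < s2 \<and> left_edge K (x + s1 *\<^sub>R u) (x + s2 *\<^sub>R u)))"

definition chain :: "plane \<Rightarrow> plane \<Rightarrow> real \<Rightarrow> nat \<Rightarrow> (nat \<Rightarrow> real) \<Rightarrow> bool" where
  "chain x u l N f \<longleftrightarrow> f 0 = 0 \<and> f N = l \<and>
     (\<forall>i<N. f i < f (Suc i) \<and> (\<exists>K\<in>\<P>. left_edge K (x + f i *\<^sub>R u) (x + f (Suc i) *\<^sub>R u)))"

text \<open>Just to the right of \<open>s\<close>, before the next vertex, the edge found there must
  start at \<open>s\<close>, and it cannot run beyond \<open>l\<close>. Its end is blocked in turn,
  since an edge across it would overlap with it.\<close>

lemma chain_step:
  assumes u: "u \<noteq> 0" and cov: "covered x u l" and bs: "blocked x u s" and bl: "blocked x u l"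
    and s: "0 \<le> s" "s < l"
  shows "\<exists>s'. s < s' \<and> s' \<le> l \<and> blocked x u s' \<and> (\<exists>K\<in>\<P>. left_edge K (x + s *\<^sub>R u) (x + s' *\<^sub>R u))"
proof -
  define V where "V = (\<lambda>s. x + s *\<^sub>R u) -` (\<Union>K\<in>\<P>. verts K)"
  have "inj (\<lambda>s. x + s *\<^sub>R u)" using u by (auto intro!: injI)
  then have "finite V" unfolding V_def using fin tile_verts by (intro finite_vimageI finite_UN_I) auto
  then obtain e where e: "e > 0" "\<And>t. t \<in> V \<Longrightarrow> t \<noteq> s \<Longrightarrow> e \<le> dist s t"
    using finite_set_avoid[of V s] by metis
  define t0 where "t0 = s + min e (l - s) / 2"
  have t0: "s < t0" "t0 < s + e" "t0 < l" using e s by (auto simp: t0_def min_def field_simps)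
  have free: "t \<notin> V" if "s < t" "t < s + e" for t
    using e(2)[of t] that by (auto simp: dist_real_def)
  have "\<forall>K\<in>\<P>. x + t0 *\<^sub>R u \<notin> verts K" using free[of t0] t0 by (auto simp: V_def)
  then obtain K s1 s2 where K: "K \<in> \<P>" "s1 < t0" "t0 < s2" "left_edge K (x + s1 *\<^sub>R u) (x + s2 *\<^sub>R u)"
    using cov t0 s unfolding covered_def by (meson le_less_trans)
  have "s1 \<in> V" using left_edge_verts[OF K(4)] K(1) by (auto simp: V_def)
  then have "s1 \<le> s" using free[of s1] t0 K by force
  moreover have "\<not> s1 < s" using bs K t0 unfolding blocked_def by (meson less_trans)
  ultimately have s1: "s1 = s" by simp
  have "s2 \<le> l" using bl K s s1 unfolding blocked_def by (meson not_le)
  moreover have "blocked x u s2" unfolding blocked_def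
  proof (intro ballI allI impI notI)
    fix K' s1' s2' assume K': "K' \<in> \<P>" "left_edge K' (x + s1' *\<^sub>R u) (x + s2' *\<^sub>R u)" "s1' < s2 \<and> s2 < s2'"
    define m where "m = (max s1 s1' + s2) / 2"
    have m: "s1 < m" "m < s2" "s1' < m" "m < s2'" using K' K by (auto simp: m_def max_def field_simps)
    have "K = K'" by (rule left_edge_overlap[OF K(1) K'(1) u K(4) K'(2)]) (use m in auto)
    then show False using left_edge_unique[OF u _ _ K(4), of s1' s2'] K K' by auto
  qed
  ultimately show ?thesis using K s1 t0 by (intro exI[of _ s2]) auto
qed

lemma chain_exists:
  assumes u: "u \<noteq> 0" and cov: "covered x u l" and b0: "blocked x u 0" and bl: "blocked x u l" and l: "0 \<le> l"
  shows "\<exists>N f. chain x u l N f"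
proof -
  \<comment> \<open>The shortest tile side in units of \<open>u\<close>: every step advances at
    least this far, which bounds the number of steps.\<close>
  define \<delta> where "\<delta> = min a (min b c) / norm u"
  have \<delta>: "\<delta> > 0" using sides_pos u by (simp add: \<delta>_def)
  have main: "\<exists>N f. f 0 = s \<and> f N = l \<and> (\<forall>i<N. f i < f (Suc i) \<and> (\<exists>K\<in>\<P>. left_edge K (x + f i *\<^sub>R u) (x + f (Suc i) *\<^sub>R u)))"
    if "blocked x u s" "0 \<le> s" "s \<le> l" "l - s \<le> real n * \<delta>" for n s
    using that
  proof (induction n arbitrary: s)
    case 0
    then have "s = l" by simp
    then show ?case by (intro exI[of _ 0] exI[of _ "\<lambda>_. l"]) simp
  next
    case (Suc n)
    show ?case
    proof (cases "s = l")
      case True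
      then show ?thesis by (intro exI[of _ 0] exI[of _ "\<lambda>_. l"]) simp
    next
      case False
      then obtain s' K where s': "s < s'" "s' \<le> l" "blocked x u s'" "K \<in> \<P>" "left_edge K (x + s *\<^sub>R u) (x + s' *\<^sub>R u)"
        using chain_step[OF u cov Suc.prems(1) bl] Suc.prems by fastforce
      have "dist (x + s *\<^sub>R u) (x + s' *\<^sub>R u) = norm ((s - s') *\<^sub>R u)" unfolding dist_norm by (simp add: algebra_simps)
      also have "\<dots> = (s' - s) * norm u" using s' by simp
      finally have "(s' - s) * norm u \<ge> min a (min b c)" using left_edge_length[OF s'(4,5)] by auto
      then have "\<delta> \<le> s' - s" using u by (simp add: \<delta>_def divide_simps)
      then have "l - s' \<le> real n * \<delta>" using Suc.prems(4) by (simp add: algebra_simps)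
      then obtain N f where f: "f 0 = s'" "f N = l"
        "\<forall>i<N. f i < f (Suc i) \<and> (\<exists>K\<in>\<P>. left_edge K (x + f i *\<^sub>R u) (x + f (Suc i) *\<^sub>R u))"
        using Suc.IH[of s'] s' Suc.prems by auto
      define g where "g i = (case i of 0 \<Rightarrow> s | Suc j \<Rightarrow> f j)" for i
      have "g 0 = s" "g (Suc N) = l" using f by (auto simp: g_def)
      moreover have "g i < g (Suc i) \<and> (\<exists>K\<in>\<P>. left_edge K (x + g i *\<^sub>R u) (x + g (Suc i) *\<^sub>R u))" if "i < Suc N" for i
        using that f s' by (cases i) (auto simp: g_def)
      ultimately show ?thesis by blast
    qed
  qed
  obtain n where "l / \<delta> \<le> real n" using real_arch_simple by blast
  then have "l - 0 \<le> real n * \<delta>" using \<delta> by (simp add: field_simps)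
  from main[OF b0 _ _ this] l show ?thesis unfolding chain_def by auto
qed

lemma chain_length:
  assumes "chain x u l N f" "i < N"
  shows "(f (Suc i) - f i) * norm u \<in> {a, b, c}"
    "dist (x + f i *\<^sub>R u) (x + f (Suc i) *\<^sub>R u) = (f (Suc i) - f i) * norm u"
proof -
  have "dist (x + f i *\<^sub>R u) (x + f (Suc i) *\<^sub>R u) = norm ((f i - f (Suc i)) *\<^sub>R u)" unfolding dist_norm by (simp add: algebra_simps)
  also have "\<dots> = (f (Suc i) - f i) * norm u" using assms by (auto simp: chain_def)
  finally show d: "dist (x + f i *\<^sub>R u) (x + f (Suc i) *\<^sub>R u) = (f (Suc i) - f i) * norm u" .
  obtain K where "K \<in> \<P>" "left_edge K (x + f i *\<^sub>R u) (x + f (Suc i) *\<^sub>R u)" using assms unfolding chain_def by blast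
  from left_edge_length[OF this] show "(f (Suc i) - f i) * norm u \<in> {a, b, c}" unfolding d .
qed

lemma chain_counts:
  assumes "chain x u l N f"
  shows "\<exists>p q s. l * norm u = real p * a + real q * b + real s * c \<and>
    (\<forall>e. (a \<noteq> e \<longrightarrow> p = 0) \<and> (b \<noteq> e \<longrightarrow> q = 0) \<and> (c \<noteq> e \<longrightarrow> s = 0) \<longrightarrow> (\<forall>i<N. (f (Suc i) - f i) * norm u = e))"
proof -
  have "(\<Sum>i<N. (f (Suc i) - f i) * norm u) = (f N - f 0) * norm u"
    by (simp add: sum_distrib_right[symmetric] sum_lessThan_telescope)
  also have "\<dots> = l * norm u" using assms by (simp add: chain_def)
  finally show ?thesis
    using sum_of_three_values[of N "\<lambda>i. (f (Suc i) - f i) * norm u" a b c] chain_length(1)[OF assms] by simp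
qed

text \<open>A segment whose length is a multiple of a pure side can only be covered by edges of this length.\<close>
definition pure :: "real \<Rightarrow> bool" where
  "pure e \<longleftrightarrow> (\<forall>k p q s. real k * e = real p * a + real q * b + real s * c \<longrightarrow>
     (a \<noteq> e \<longrightarrow> p = 0) \<and> (b \<noteq> e \<longrightarrow> q = 0) \<and> (c \<noteq> e \<longrightarrow> s = 0))"

lemma chain_pure:
  assumes "chain x u l N f" "pure e" "l * norm u = real k * e" "i < N"
  shows "(f (Suc i) - f i) * norm u = e"
proof -
  obtain p q s where pqs: "l * norm u = real p * a + real q * b + real s * c"
    "\<forall>e. (a \<noteq> e \<longrightarrow> p = 0) \<and> (b \<noteq> e \<longrightarrow> q = 0) \<and> (c \<noteq> e \<longrightarrow> s = 0) \<longrightarrow> (\<forall>i<N. (f (Suc i) - f i) * norm u = e)"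
    using chain_counts[OF assms(1)] by (elim exE conjE)
  have "(a \<noteq> e \<longrightarrow> p = 0) \<and> (b \<noteq> e \<longrightarrow> q = 0) \<and> (c \<noteq> e \<longrightarrow> s = 0)"
    using assms(2,3) pqs(1) unfolding pure_def by metis
  then show ?thesis using pqs(2) assms(4) by blast
qed

text \<open>All edges have length \<open>norm u\<close>, so the vertices sit exactly at the integer
  parameters.\<close>

lemma pure_chain:
  assumes "pure (norm u)" "u \<noteq> 0" "covered x u (real k)" "blocked x u 0" "blocked x u (real k)" "i < k"
  shows "\<exists>K\<in>\<P>. left_edge K (x + real i *\<^sub>R u) (x + real (Suc i) *\<^sub>R u)"
proof -
  obtain N f where ch: "chain x u (real k) N f" using chain_exists[OF assms(2-5)] by auto
  have st: "f (Suc i) = f i + 1" if "i < N" for i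
  proof -
    have "f (Suc i) - f i = 1" using chain_pure[OF ch assms(1) refl that] assms(2) by simp
    then show ?thesis by linarith
  qed
  have fi: "f i = real i" if "i \<le> N" for i
    using that ch by (induction i) (auto simp: st chain_def)
  have "N = k" using fi[of N] ch by (simp add: chain_def)
  moreover have "f i = real i" "f (Suc i) = real (Suc i)" using fi[of i] fi[of "Suc i"] assms(6) \<open>N = k\<close> by simp_all
  moreover have "\<exists>K\<in>\<P>. left_edge K (x + f i *\<^sub>R u) (x + f (Suc i) *\<^sub>R u)"
    using ch assms(6) \<open>N = k\<close> unfolding chain_def by blast
  ultimately show ?thesis by simp
qed

section \<open>Edges along the sides of the big triangle\<close>

definition side :: "plane \<Rightarrow> plane \<Rightarrow> plane \<Rightarrow> bool" where
  "side P Q R \<longleftrightarrow> T = convex hull {P, Q, R} \<and> 0 < D (Q - P) (R - P)"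

lemma sides: "side A B C" "side B C A" "side C A B"
  using D_tri unfolding side_def by (auto simp: insert_commute)

lemma side_left_edge: "side P Q R \<Longrightarrow> left_edge T P Q"
  unfolding side_def left_edge_def by blast

lemma side_corners:
  assumes "side P Q R"
  shows "dens T P < straight" "dens T Q < straight" "P \<noteq> Q"
proof -
  have ne: "cross (Q - P) (R - P) \<noteq> 0" using assms D_pos_ne side_def by blast
  note n = cross_rotate_ne[OF ne]
  show "dens T P < straight" "dens T Q < straight"
    using dens_vertices[OF ne] assms sector_triangle[OF ne] sector_pos[OF ne] sector_pos[OF n(1)] sector_pos[OF n(2)]
    unfolding side_def by auto
  show "P \<noteq> Q" using ne by auto
qed

lemma dens_le: "K \<in> \<P> \<Longrightarrow> dens K z \<le> dens T z"
  using dens_sum_le[of "{K}" z] by simp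

lemma blocked_dens:
  assumes "dens T (x + s *\<^sub>R u) < straight" "u \<noteq> 0"
  shows "blocked x u s"
  unfolding blocked_def
proof (intro ballI allI impI notI)
  fix K s1 s2 assume K: "K \<in> \<P>" "left_edge K (x + s1 *\<^sub>R u) (x + s2 *\<^sub>R u)" "s1 < s \<and> s < s2"
  then have "dens K (x + s *\<^sub>R u) = straight" using left_edge_dens[OF K(2) line_open_segment] assms by blast
  then show False using dens_le[OF K(1), of "x + s *\<^sub>R u"] assms by simp
qed

lemma side_mem:
  assumes "side P Q R" "0 < s" "s < 1"
  shows "P + s *\<^sub>R (Q - P) \<in> open_segment P Q"
  using line_open_segment[of 0 s 1 "Q - P" P] assms side_corners(3)[OF assms(1)] by auto

text \<open>At an inner point of a side all tiles stay in the half-plane of \<open>T\<close>, so the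
  confinement in \<open>edge_coverage\<close> holds without any knowledge of the tiles.\<close>

lemma side_covered:
  assumes sd: "side P Q R" and k: "Q - P = k *\<^sub>R u" "0 < k"
  shows "covered P u k"
  unfolding covered_def
proof (intro allI impI)
  fix s assume s: "0 < s \<and> s < k \<and> (\<forall>K\<in>\<P>. P + s *\<^sub>R u \<notin> verts K)"
  let ?z = "P + s *\<^sub>R u"
  have u: "u \<noteq> 0" using side_corners(3)[OF sd] k by auto
  have "?z \<in> open_segment P Q"
    using side_mem[OF sd, of "s / k"] s k by (simp add: divide_less_eq)
  then have fT: "fcone T ?z = {w. 0 \<le> D u w}"
    using left_edge_fcone[OF side_left_edge[OF sd]] k by (simp add: zero_le_mult_iff)
  have "\<exists>K\<in>\<P>. \<exists>p q l. left_edge K p q \<and> ?z \<in> open_segment p q \<and> 0 < l \<and> q - p = l *\<^sub>R u"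
  proof (rule edge_coverage[OF u])
    show "R - P \<in> fcone T ?z" using sd k unfolding fT side_def by (simp add: zero_less_mult_iff)
    fix K assume K: "K \<in> \<P>"
    then show "?z \<notin> verts K" using s by blast
    have "fcone K ?z \<subseteq> {w. 0 \<le> D u w}" using fcone_mono[of K T ?z] K cover fT by blast
    then have "fcone K ?z \<inter> {w. D u w < 0} = {}" by (auto simp: not_less)
    then show "negligible (fcone K ?z \<inter> {w. D u w < 0})" by simp
  qed
  then show "\<exists>K\<in>\<P>. \<exists>s1 s2. s1 < s \<and> s < s2 \<and> left_edge K (P + s1 *\<^sub>R u) (P + s2 *\<^sub>R u)"
    using open_segment_param by (metis (no_types, lifting))
qed

lemma side_chain:
  assumes "side P Q R"
  shows "\<exists>N f. chain P (Q - P) 1 N f"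
proof (rule chain_exists)
  show u: "Q - P \<noteq> 0" using side_corners[OF assms] by simp
  show "blocked P (Q - P) 0" "blocked P (Q - P) 1"
    using side_corners[OF assms] u by (auto intro!: blocked_dens)
  show "covered P (Q - P) 1" by (rule side_covered[OF assms]) simp_all
qed simp

lemma chain_mono: "chain x u l N f \<Longrightarrow> i < j \<Longrightarrow> j \<le> N \<Longrightarrow> f i < f j"
proof (induction j)
  case (Suc j)
  then have "f j < f (Suc j)" by (auto simp: chain_def)
  then show ?case using Suc by (cases "i = j") auto
qed simp

text \<open>On a side tiled by \<open>a\<close>-edges only, two neighbouring tiles cannot both show the larger
  end angle \<open>Y\<close> at their common vertex, so one of the extreme tiles shows \<open>Y\<close> at a corner.\<close>
lemma side_a_corner:
  assumes sd: "side P Q R" and ch: "chain P (Q - P) 1 N f"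
    and len: "\<And>i. i < N \<Longrightarrow> (f (Suc i) - f i) * norm (Q - P) = a"
  shows "min \<beta> \<gamma> \<le> dens T P" and "min \<beta> \<gamma> \<le> dens T Q"
    and "(Y, Z) \<in> {(\<beta>, \<gamma>), (\<gamma>, \<beta>)} \<Longrightarrow>
      (\<And>i j k m. 2 * Y + real i * \<alpha> + real j * \<beta> + real k * \<gamma> + real m * straight \<noteq> straight) \<Longrightarrow>
      Y \<le> dens T P \<or> Y \<le> dens T Q"
proof -
  let ?u = "Q - P"
  let ?p = "\<lambda>i. P + f i *\<^sub>R ?u"
  have u: "?u \<noteq> 0" using side_corners[OF sd] by simp
  have f01: "f 0 = 0" "f N = 1" using ch by (auto simp: chain_def)
  then have N: "0 < N" by (cases N) auto
  have ends: "?p 0 = P" "?p N = Q" using f01 by auto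
  have "\<exists>K. \<forall>i<N. K i \<in> \<P> \<and> left_edge (K i) (?p i) (?p (Suc i))"
    using ch unfolding chain_def by metis
  then obtain K where K: "\<And>i. i < N \<Longrightarrow> K i \<in> \<P>" "\<And>i. i < N \<Longrightarrow> left_edge (K i) (?p i) (?p (Suc i))" by blast
  have ang: "dens (K i) (?p i) = \<beta> \<and> dens (K i) (?p (Suc i)) = \<gamma> \<or> dens (K i) (?p i) = \<gamma> \<and> dens (K i) (?p (Suc i)) = \<beta>"
    if "i < N" for i
    using left_edge_a[OF K(1,2)[OF that]] chain_length(2)[OF ch that] len[OF that] by metis
  show "min \<beta> \<gamma> \<le> dens T P"
    using ang[OF N] dens_le[OF K(1)[OF N], of P] ends by auto
  show "min \<beta> \<gamma> \<le> dens T Q"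
    using ang[of "N - 1"] dens_le[OF K(1)[of "N - 1"], of Q] ends N by auto
  assume YZ: "(Y, Z) \<in> {(\<beta>, \<gamma>), (\<gamma>, \<beta>)}"
    and no: "\<And>i j k m. 2 * Y + real i * \<alpha> + real j * \<beta> + real k * \<gamma> + real m * straight \<noteq> straight"
  \<comment> \<open>\<open>S\<close> passes from each tile to the next one, so either the first tile
    shows \<open>Y\<close> at \<open>P\<close> or the last one shows it at \<open>Q\<close>.\<close>
  define S where "S i \<longleftrightarrow> dens (K i) (?p (Suc i)) = Y" for i
  have nS: "dens (K i) (?p i) = Y" if "i < N" "\<not> S i" for i using ang[OF that(1)] that(2) YZ by (auto simp: S_def)
  have step: "S (Suc i)" if i: "Suc i < N" "S i" for i
  proof (rule ccontr)
    assume "\<not> S (Suc i)"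
    then have d: "dens (K (Suc i)) (?p (Suc i)) = Y" using nS i by blast
    have inc: "f i < f (Suc i)" "f (Suc i) < f (Suc (Suc i))" using ch i by (auto simp: chain_def)
    have "K i \<noteq> K (Suc i)"
    proof
      assume "K i = K (Suc i)"
      then show False
        using left_edge_unique[OF u inc, of "K i" P] K(2)[of i] K(2)[of "Suc i"] i inc by auto
    qed
    moreover have "{K i, K (Suc i)} \<subseteq> \<P>" using K i by auto
    ultimately have sum: "dens T (?p (Suc i)) = 2 * Y + (\<Sum>L\<in>\<P> - {K i, K (Suc i)}. dens L (?p (Suc i)))"
      using sum.subset_diff[of "{K i, K (Suc i)}" \<P> "\<lambda>L. dens L (?p (Suc i))"] fin d i
      unfolding dens_sum S_def by simp
    have "0 < f (Suc i)" "f (Suc i) < 1" using chain_mono[OF ch, of 0 "Suc i"] chain_mono[OF ch, of "Suc i" N] i f01 by auto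
    then have "dens T (?p (Suc i)) = straight" using left_edge_dens[OF side_left_edge[OF sd] side_mem[OF sd]] by simp
    moreover obtain i' j k m where "(\<Sum>L\<in>\<P> - {K i, K (Suc i)}. dens L (?p (Suc i))) = real i' * \<alpha> + real j * \<beta> + real k * \<gamma> + real m * straight"
      using dens_fill[of "\<P> - {K i, K (Suc i)}" "?p (Suc i)"] fin by (metis Diff_subset finite_Diff)
    ultimately show False using sum no[of i' j k m] by simp
  qed
  show "Y \<le> dens T P \<or> Y \<le> dens T Q"
  proof (cases "S 0")
    case False
    then have "dens (K 0) P = Y" using nS[OF N] ends by simp
    then show ?thesis using dens_le[OF K(1)[OF N], of P] by simp
  next
    case True
    have "S i" if "i < N" for i using that True step by (induction i) auto
    then have "S (N - 1)" using N by simp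
    then have "dens (K (N - 1)) Q = Y" using N ends by (simp add: S_def)
    then show ?thesis using dens_le[OF K(1)[of "N - 1"], of Q] N by simp
  qed
qed

section \<open>Edge counts on the sides and integrality of the scale factor\<close>

lemma dens_corners: "dens T A = \<alpha>" "dens T B = \<beta>" "dens T C = \<gamma>"
  using dens_vertices[OF tri] by (simp_all add: \<alpha>_def \<beta>_def \<gamma>_def)

text \<open>Since \<open>\<beta>\<close> is the largest angle, two copies and any further angle
  exceed \<open>\<alpha> + \<beta> + \<gamma>\<close>; without a further angle,
  \<open>\<beta>\<close> would be a right angle.\<close>

lemma no_double:
  assumes "\<alpha> < \<beta>" "\<gamma> < \<beta>" "2 * \<beta> \<noteq> straight"
  shows "2 * \<beta> + real i * \<alpha> + real j * \<beta> + real k * \<gamma> + real m * straight \<noteq> straight"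
proof
  assume eq: "2 * \<beta> + real i * \<alpha> + real j * \<beta> + real k * \<gamma> + real m * straight = straight"
  have nn: "0 \<le> real i * \<alpha>" "0 \<le> real j * \<beta>" "0 \<le> real k * \<gamma>" "0 \<le> real m * straight"
    using angles_pos angle_sum by simp_all
  have ge: "real x * y \<ge> y" if "x \<noteq> 0" "y > 0" for x y
    using that by (simp add: mult_le_cancel_right1)
  have "i = 0"
  proof (rule ccontr)
    assume "i \<noteq> 0"
    from ge[OF this angles_pos(1)] show False using eq nn angle_sum assms angles_pos by linarith
  qed
  moreover have "j = 0"
  proof (rule ccontr)
    assume "j \<noteq> 0"
    from ge[OF this angles_pos(2)] show False using eq nn angle_sum assms angles_pos by linarith
  qed
  moreover have "k = 0"
  proof (rule ccontr)
    assume "k \<noteq> 0"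
    from ge[OF this angles_pos(3)] show False using eq nn angle_sum assms angles_pos by linarith
  qed
  moreover have "m = 0"
  proof (rule ccontr)
    assume "m \<noteq> 0"
    from ge[OF this straight_pos] show False using eq nn angle_sum assms angles_pos by linarith
  qed
  ultimately show False using eq assms by simp
qed

text \<open>If \<open>CA\<close> carried only edges of length \<open>a\<close>, the tile at
  \<open>A\<close> would force \<open>\<gamma> \<le> \<alpha>\<close>. Then \<open>\<beta>\<close>
  is the strictly largest angle and fits into neither end of \<open>CA\<close>, against
  \<open>side_a_corner\<close>. The premise \<open>c \<noteq> a\<close> is there because
  \<open>c\<close>-edges count as \<open>a\<close>-edges when the lengths agree.\<close>

lemma ca_counts:
  assumes "\<alpha> < \<beta>" "2 * \<beta> \<noteq> straight"
  obtains p q s where "t * b = real p * a + real q * b + real s * c" "\<not> (q = 0 \<and> (c \<noteq> a \<longrightarrow> s = 0))"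
proof -
  obtain N f where ch: "chain C (A - C) 1 N f" using side_chain[OF sides(3)] by blast
  have nl: "norm (A - C) = t * b" using t_pos by (simp add: b_def dist_norm norm_minus_commute)
  obtain p q s where pqs: "1 * norm (A - C) = real p * a + real q * b + real s * c"
    "\<forall>e. (a \<noteq> e \<longrightarrow> p = 0) \<and> (b \<noteq> e \<longrightarrow> q = 0) \<and> (c \<noteq> e \<longrightarrow> s = 0) \<longrightarrow> (\<forall>i<N. (f (Suc i) - f i) * norm (A - C) = e)"
    using chain_counts[OF ch] by (elim exE conjE)
  have "\<not> (q = 0 \<and> (c \<noteq> a \<longrightarrow> s = 0))"
  proof
    assume "q = 0 \<and> (c \<noteq> a \<longrightarrow> s = 0)"
    then have len: "\<And>i. i < N \<Longrightarrow> (f (Suc i) - f i) * norm (A - C) = a" using pqs(2)[rule_format, of a] by auto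
    note sc = side_a_corner[OF sides(3) ch len]
    have "min \<beta> \<gamma> \<le> \<alpha>" using sc(2) dens_corners by simp
    then have g: "\<gamma> < \<beta>" using assms by linarith
    have "\<beta> \<le> \<gamma> \<or> \<beta> \<le> \<alpha>" using sc(3)[of \<beta> \<gamma>] no_double[OF assms(1) g assms(2)] dens_corners by auto
    then show False using g assms by auto
  qed
  then show ?thesis using that pqs(1) nl by simp
qed

lemma bc_counts:
  obtains p q s where "t * a = real p * a + real q * b + real s * c"
proof -
  obtain N f where ch: "chain B (C - B) 1 N f" using side_chain[OF sides(2)] by blast
  have nl: "norm (C - B) = t * a" using t_pos by (simp add: a_def dist_norm norm_minus_commute)
  show ?thesis using chain_counts[OF ch] that nl by auto
qed

text \<open>Together with \<open>tiling_rotate\<close> this allows any side as base and any other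
  side as the second direction.\<close>

lemma tiling_swap: "tiling A C B \<P> t"
proof
  show "cross (C - A) (B - A) \<noteq> 0" by (rule cross_rotate_ne[OF tri])
  show "\<Union>\<P> = convex hull {A, C, B}" using cover by (simp add: insert_commute)
  fix K assume "K \<in> \<P>"
  from tile[OF this] obtain p q r where "K = convex hull {p, q, r}"
    "dist q r = dist B C / t" "dist r p = dist C A / t" "dist p q = dist A B / t" by auto
  then show "\<exists>p q r. K = convex hull {p, q, r} \<and> dist q r = dist C B / t \<and> dist r p = dist B A / t \<and> dist p q = dist A C / t"
    by (intro exI[of _ p] exI[of _ r] exI[of _ q]) (auto simp: dist_commute insert_commute)
qed (use t_pos fin disj in auto)

lemma tiling_rotate: "tiling B C A \<P> t"
proof
  show "cross (C - B) (A - B) \<noteq> 0" by (rule cross_rotate_ne[OF tri])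
  show "\<Union>\<P> = convex hull {B, C, A}" using cover by (simp add: insert_commute)
  fix K assume "K \<in> \<P>"
  from tile[OF this] obtain p q r where "K = convex hull {p, q, r}"
    "dist q r = dist B C / t" "dist r p = dist C A / t" "dist p q = dist A B / t" by auto
  then show "\<exists>p q r. K = convex hull {p, q, r} \<and> dist q r = dist C A / t \<and> dist r p = dist A B / t \<and> dist p q = dist B C / t"
    by (intro exI[of _ q] exI[of _ r] exI[of _ p]) (auto simp: insert_commute)
qed (use t_pos fin disj in auto)

end

context tiling begin

interpretation sw: tiling A C B \<P> t by (rule tiling_swap)

lemma swap_eqs: "sw.a = a" "sw.b = c" "sw.c = b" "sw.\<alpha> = \<alpha>" "sw.\<beta> = \<gamma>" "sw.\<gamma> = \<beta>"
  unfolding sw.a_def sw.b_def sw.c_def sw.\<alpha>_def sw.\<beta>_def sw.\<gamma>_def a_def b_def c_def \<alpha>_def \<beta>_def \<gamma>_def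
  by (simp_all add: dist_commute sector_commute)

lemma swap_pure: "sw.pure e = pure e"
proof
  assume p: "sw.pure e"
  show "pure e" unfolding pure_def
  proof (intro allI impI)
    fix k p q s assume "real k * e = real p * a + real q * b + real s * c"
    then have "real k * e = real p * a + real s * c + real q * b" by simp
    with p show "(a \<noteq> e \<longrightarrow> p = 0) \<and> (b \<noteq> e \<longrightarrow> q = 0) \<and> (c \<noteq> e \<longrightarrow> s = 0)"
      unfolding sw.pure_def swap_eqs by blast
  qed
next
  assume p: "pure e"
  show "sw.pure e" unfolding sw.pure_def swap_eqs
  proof (intro allI impI)
    fix k p q s assume "real k * e = real p * a + real q * c + real s * b"
    then have "real k * e = real p * a + real s * b + real q * c" by simp
    with p show "(a \<noteq> e \<longrightarrow> p = 0) \<and> (c \<noteq> e \<longrightarrow> q = 0) \<and> (b \<noteq> e \<longrightarrow> s = 0)"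
      unfolding pure_def by blast
  qed
qed

lemma ab_counts:
  assumes "\<alpha> < \<gamma>" "2 * \<gamma> \<noteq> straight"
  obtains p q s where "t * c = real p * a + real q * b + real s * c" "\<not> (s = 0 \<and> (b \<noteq> a \<longrightarrow> q = 0))"
proof -
  obtain p q s where "t * c = real p * a + real q * c + real s * b" "\<not> (q = 0 \<and> (b \<noteq> a \<longrightarrow> s = 0))"
    using sw.ca_counts[unfolded swap_eqs, OF assms] by blast
  then show ?thesis using that[of p s q] by simp
qed

text \<open>The three equations are a matrix with natural entries that has the sides as eigenvector
  and \<open>t\<close> as eigenvalue; the last two conclusions restrict its second and third
  row.\<close>

lemma counts:
  obtains p1 q1 s1 p2 q2 s2 p3 q3 s3 where
    "t * a = real p1 * a + real q1 * b + real s1 * c"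
    "t * b = real p2 * a + real q2 * b + real s2 * c"
    "t * c = real p3 * a + real q3 * b + real s3 * c"
    "\<alpha> < \<beta> \<Longrightarrow> 2 * \<beta> \<noteq> straight \<Longrightarrow> \<not> (q2 = 0 \<and> (c \<noteq> a \<longrightarrow> s2 = 0))"
    "\<alpha> < \<gamma> \<Longrightarrow> 2 * \<gamma> \<noteq> straight \<Longrightarrow> \<not> (s3 = 0 \<and> (b \<noteq> a \<longrightarrow> q3 = 0))"
proof -
  interpret r: tiling B C A \<P> t by (rule tiling_rotate)
  interpret rr: tiling C A B \<P> t by (rule r.tiling_rotate)
  have e: "r.a = b" "r.b = c" "r.c = a" "rr.a = c" "rr.b = a" "rr.c = b"
    by (simp_all add: a_def b_def c_def r.a_def r.b_def r.c_def rr.a_def rr.b_def rr.c_def)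
  obtain p1 q1 s1 where 1: "t * a = real p1 * a + real q1 * b + real s1 * c" using bc_counts .
  obtain q s p where b0: "t * b = real q * b + real s * c + real p * a" using r.bc_counts unfolding e .
  obtain s' p' q' where c0: "t * c = real s' * c + real p' * a + real q' * b" using rr.bc_counts unfolding e .
  obtain p2 q2 s2 where 2: "t * b = real p2 * a + real q2 * b + real s2 * c"
    "\<alpha> < \<beta> \<Longrightarrow> 2 * \<beta> \<noteq> straight \<Longrightarrow> \<not> (q2 = 0 \<and> (c \<noteq> a \<longrightarrow> s2 = 0))"
  proof (cases "\<alpha> < \<beta> \<and> 2 * \<beta> \<noteq> straight")
    case True
    then show ?thesis using ca_counts that by metis
  next
    case False
    then show ?thesis using b0 that[of p q s] by auto
  qed
  obtain p3 q3 s3 where 3: "t * c = real p3 * a + real q3 * b + real s3 * c"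
    "\<alpha> < \<gamma> \<Longrightarrow> 2 * \<gamma> \<noteq> straight \<Longrightarrow> \<not> (s3 = 0 \<and> (b \<noteq> a \<longrightarrow> q3 = 0))"
  proof (cases "\<alpha> < \<gamma> \<and> 2 * \<gamma> \<noteq> straight")
    case True
    then show ?thesis using ab_counts that by metis
  next
    case False
    then show ?thesis using c0 that[of p' q' s'] by auto
  qed
  show ?thesis by (rule that[OF 1 2(1) 3(1)]) (use 2 3 in blast)+
qed

text \<open>Multiplication by \<open>t\<close> maps each tile side to a sum of tile sides; doing it twice multiplies
  by the integer \<open>r\<close>, so a pure side can only come back from sides which consist of it.\<close>
lemma pure_square:
  assumes "pure e" "t\<^sup>2 = real r" "t * e = real p * a + real q * b + real s * c"
    and "t * a = real p1 * a + real q1 * b + real s1 * c"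
    "t * b = real p2 * a + real q2 * b + real s2 * c"
    "t * c = real p3 * a + real q3 * b + real s3 * c"
  shows "a \<noteq> e \<Longrightarrow> p * p1 = 0 \<and> q * p2 = 0 \<and> s * p3 = 0"
    "b \<noteq> e \<Longrightarrow> p * q1 = 0 \<and> q * q2 = 0 \<and> s * q3 = 0"
    "c \<noteq> e \<Longrightarrow> p * s1 = 0 \<and> q * s2 = 0 \<and> s * s3 = 0"
proof -
  have "real r * e = t * (t * e)" using assms(2) by (simp add: power2_eq_square)
  also have "\<dots> = real p * (t * a) + real q * (t * b) + real s * (t * c)" unfolding assms(3) by (simp add: algebra_simps)
  also have "\<dots> = real (p * p1 + q * p2 + s * p3) * a + real (p * q1 + q * q2 + s * q3) * b + real (p * s1 + q * s2 + s * s3) * c"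
    unfolding assms(4-6) by (simp add: algebra_simps)
  finally have *: "(a \<noteq> e \<longrightarrow> p * p1 + q * p2 + s * p3 = 0) \<and> (b \<noteq> e \<longrightarrow> p * q1 + q * q2 + s * q3 = 0) \<and>
    (c \<noteq> e \<longrightarrow> p * s1 + q * s2 + s * s3 = 0)"
    using assms(1) unfolding pure_def by blast
  show "a \<noteq> e \<Longrightarrow> p * p1 = 0 \<and> q * p2 = 0 \<and> s * p3 = 0"
    "b \<noteq> e \<Longrightarrow> p * q1 = 0 \<and> q * q2 = 0 \<and> s * q3 = 0"
    "c \<noteq> e \<Longrightarrow> p * s1 = 0 \<and> q * s2 = 0 \<and> s * s3 = 0" using * by auto
qed

text \<open>By \<open>pure_square\<close>, a \<open>b\<close>-edge on \<open>BC\<close> with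
  \<open>b \<noteq> a\<close> would force \<open>CA\<close> to consist of \<open>a\<close>-edges,
  and a \<open>c\<close>-edge would do the same to \<open>AB\<close>. Both contradict
  \<open>counts\<close>, so \<open>BC\<close> is a multiple of \<open>a\<close>.\<close>

lemma t_integer_smallest:
  assumes "pure a" "t\<^sup>2 = real r" "\<alpha> \<le> \<beta>" "\<alpha> \<le> \<gamma>" "2 * \<beta> \<noteq> straight" "2 * \<gamma> \<noteq> straight"
  shows "\<exists>n. t = real n"
proof -
  obtain p1 q1 s1 p2 q2 s2 p3 q3 s3 where ct:
    "t * a = real p1 * a + real q1 * b + real s1 * c"
    "t * b = real p2 * a + real q2 * b + real s2 * c"
    "t * c = real p3 * a + real q3 * b + real s3 * c"
    "\<alpha> < \<beta> \<Longrightarrow> 2 * \<beta> \<noteq> straight \<Longrightarrow> \<not> (q2 = 0 \<and> (c \<noteq> a \<longrightarrow> s2 = 0))"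
    "\<alpha> < \<gamma> \<Longrightarrow> 2 * \<gamma> \<noteq> straight \<Longrightarrow> \<not> (s3 = 0 \<and> (b \<noteq> a \<longrightarrow> q3 = 0))" by (rule counts) blast
  note sq = pure_square[OF assms(1,2) ct(1) ct(1-3)]
  have "q1 = 0" if "b \<noteq> a"
  proof (rule ccontr)
    assume "q1 \<noteq> 0"
    then have "q2 = 0" "c \<noteq> a \<longrightarrow> s2 = 0" using sq that by auto
    moreover have "\<alpha> < \<beta>" using assms that angle_eq_iff by (simp add: less_le)
    ultimately show False using ct(4) assms by blast
  qed
  moreover have "s1 = 0" if "c \<noteq> a"
  proof (rule ccontr)
    assume "s1 \<noteq> 0"
    then have "s3 = 0" "b \<noteq> a \<longrightarrow> q3 = 0" using sq that by auto
    moreover have "\<alpha> < \<gamma>" using assms that angle_eq_iff by (simp add: less_le)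
    ultimately show False using ct(5) assms by blast
  qed
  ultimately have "t * a = real (p1 + q1 + s1) * a"
    using ct(1) by (cases "b = a"; cases "c = a") (auto simp: algebra_simps)
  then have "t = real (p1 + q1 + s1)" using sides_pos by simp
  then show ?thesis by blast
qed

text \<open>One nonzero diagonal entry, \<open>p1\<close> or \<open>q2\<close>, suffices, as purity
  clears the rest of its row. If both vanish, then \<open>s2\<close>, \<open>q3\<close> and
  \<open>q1\<close> are nonzero in turn, and the last one clears \<open>s2\<close>.\<close>

lemma t_integer_acute:
  assumes "pure a" "pure b" "t\<^sup>2 = real r" "\<gamma> < \<alpha>" "\<alpha> < \<beta>" "2 * \<beta> \<noteq> straight"
  shows "\<exists>n. t = real n"
proof -
  obtain p1 q1 s1 p2 q2 s2 p3 q3 s3 where ct: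
    "t * a = real p1 * a + real q1 * b + real s1 * c"
    "t * b = real p2 * a + real q2 * b + real s2 * c"
    "t * c = real p3 * a + real q3 * b + real s3 * c"
    "\<alpha> < \<beta> \<Longrightarrow> 2 * \<beta> \<noteq> straight \<Longrightarrow> \<not> (q2 = 0 \<and> (c \<noteq> a \<longrightarrow> s2 = 0))" by (rule counts) blast
  have ne: "b \<noteq> a" "c \<noteq> a" "c \<noteq> b" using assms angle_eq_iff by auto
  note sqa = pure_square[OF assms(1,3) ct(1) ct(1-3)]
  note sqb = pure_square[OF assms(2,3) ct(2) ct(1-3)]
  show ?thesis
  proof (cases "p1 = 0 \<and> q2 = 0")
    case True
    then have "s2 \<noteq> 0" using ct(4) assms ne by auto
    then have "p3 = 0" "s3 = 0" using sqb ne by auto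
    then have "q3 \<noteq> 0" using ct(3) t_pos sides_pos by (cases "q3 = 0") auto
    then have "s1 = 0" using sqa ne by auto
    then have "q1 \<noteq> 0" using ct(1) True t_pos sides_pos \<open>s1 = 0\<close> by (cases "q1 = 0") auto
    then have "s2 = 0" using sqa ne by auto
    then show ?thesis using \<open>s2 \<noteq> 0\<close> by blast
  next
    case False
    then consider "p1 \<noteq> 0" | "q2 \<noteq> 0" by auto
    then show ?thesis
    proof cases
      case 1
      then have "q1 = 0" "s1 = 0" using sqa ne by auto
      then show ?thesis using ct(1) sides_pos by auto
    next
      case 2
      then have "p2 = 0" "s2 = 0" using sqb ne by auto
      then show ?thesis using ct(2) sides_pos by auto
    qed
  qed
qed

end

subsection \<open>The grid\<close>

text \<open>Here \<open>BC\<close> is the base of the rows and lines parallel to \<open>CA\<close> bound them. The last three assumptions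
  say that the larger base angle cannot occur twice at a point of a straight line, and that the
  angle of the gap between two upright cells cannot be filled starting with \<open>\<gamma>\<close>.\<close>
locale grid = tiling A B C \<P> "real n" for A B C :: plane and \<P> and n :: nat +
  assumes pure_a: "pure a" and pure_b: "pure b"
    and no_beta: "\<gamma> < \<beta> \<Longrightarrow> 2 * \<beta> + real i * \<alpha> + real j * \<beta> + real k * \<gamma> + real m * straight \<noteq> straight"
    and no_gamma: "\<beta> < \<gamma> \<Longrightarrow> 2 * \<gamma> + real i * \<alpha> + real j * \<beta> + real k * \<gamma> + real m * straight \<noteq> straight"
    and no_alpha: "a \<noteq> c \<Longrightarrow> \<alpha> \<noteq> \<gamma> + real i * \<alpha> + real j * \<beta> + real k * \<gamma> + real m * straight"
begin

lemma n_pos: "0 < n"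
  using t_pos by simp

definition "e1 = (1 / real n) *\<^sub>R (C - B)"
definition "e2 = (1 / real n) *\<^sub>R (A - B)"

text \<open>Lines parallel to \<open>BC\<close>, \<open>AB\<close> and \<open>CA\<close> are those
  of constant \<open>Y\<close>, \<open>X\<close> and \<open>X + Y\<close>.\<close>

definition G :: "real \<Rightarrow> real \<Rightarrow> plane" where "G x y = B + x *\<^sub>R e1 + y *\<^sub>R e2"
definition X :: "plane \<Rightarrow> real" where "X z = D (z - B) e2 / D e1 e2"
definition Y :: "plane \<Rightarrow> real" where "Y z = D e1 (z - B) / D e1 e2"

lemma D12: "0 < D e1 e2"
  using D_tri(2) n_pos by (simp add: e1_def e2_def)

lemma D_e [simp]: "D e2 e1 = - D e1 e2"
  by (rule D_commute)

lemma cr12: "cross e1 e2 \<noteq> 0"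
  using D_pos_ne[OF D12] .

lemma G_diff: "G x y - G x' y' = (x - x') *\<^sub>R e1 + (y - y') *\<^sub>R e2"
  by (simp add: G_def algebra_simps)

lemma X_G [simp]: "X (G x y) = x"
  using D12 by (simp add: X_def G_def D_add)

lemma Y_G [simp]: "Y (G x y) = y"
  using D12 by (simp add: Y_def G_def D_add)

lemma G_XY: "G (X z) (Y z) = z"
proof -
  have "z - B = (cross (z - B) e2 / cross e1 e2) *\<^sub>R e1 + (cross e1 (z - B) / cross e1 e2) *\<^sub>R e2"
    by (rule cross_expand[OF cr12])
  moreover have "X z = cross (z - B) e2 / cross e1 e2" "Y z = cross e1 (z - B) / cross e1 e2"
    using tri by (simp_all add: X_def Y_def D_def)
  ultimately show ?thesis unfolding G_def by (metis add.assoc add.commute diff_add_cancel)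
qed

lemma G_eq_iff: "G x y = G x' y' \<longleftrightarrow> x = x' \<and> y = y'"
  by (metis X_G Y_G)

lemma X_add: "X (z + w *\<^sub>R e1) = X z + w" "X (z + w *\<^sub>R e2) = X z"
  "Y (z + w *\<^sub>R e1) = Y z" "Y (z + w *\<^sub>R e2) = Y z + w"
  using D12 by (auto simp: X_def Y_def D_add diff_add_eq[symmetric] add_divide_distrib)

lemma D_e1: "D e1 (z - G x y) = (Y z - y) * D e1 e2"
proof -
  have "D e1 (z - G x y) = D e1 (G (X z) (Y z) - G x y)" by (simp add: G_XY)
  then show ?thesis unfolding G_diff by (simp add: D_add)
qed

lemma D_diag: "D (e1 - e2) (z - G x y) = (X z + Y z - x - y) * D e1 e2"
proof -
  have "D (e1 - e2) (z - G x y) = D (e1 - e2) (G (X z) (Y z) - G x y)" by (simp add: G_XY)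
  then show ?thesis unfolding G_diff by (simp add: D_add algebra_simps)
qed

lemma norms: "norm e1 = a" "norm e2 = c" "norm (e1 - e2) = b"
proof -
  show "norm e1 = a" "norm e2 = c" using n_pos
    by (simp_all add: e1_def e2_def a_def c_def dist_norm norm_minus_commute)
  have "e1 - e2 = (1 / real n) *\<^sub>R (C - A)" by (simp add: e1_def e2_def algebra_simps)
  then show "norm (e1 - e2) = b" using n_pos by (simp add: b_def dist_norm)
qed

lemma e_nonzero: "e1 \<noteq> 0" "e2 \<noteq> 0" "e1 - e2 \<noteq> 0"
  using norms sides_pos by auto

text \<open>A negative \<open>s\<close> gives the point-reflected triangle, so upright and inverted
  cells share all computations.\<close>

definition grid_tri :: "real \<Rightarrow> real \<Rightarrow> real \<Rightarrow> plane set" where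
  "grid_tri x y s = convex hull {G x y, G (x + s) y, G x (y + s)}"

lemma grid_tri_ne: "s \<noteq> 0 \<Longrightarrow> cross (G (x + s) y - G x y) (G x (y + s) - G x y) \<noteq> 0"
  unfolding G_diff using cr12 by simp

lemma G_bary: "G (x + u * s) (y + v * s) = G x y + u *\<^sub>R (G (x + s) y - G x y) + v *\<^sub>R (G x (y + s) - G x y)"
  by (simp add: G_def algebra_simps)

lemma grid_tri_coords:
  assumes "s \<noteq> 0"
  shows "z = G x y + ((X z - x) / s) *\<^sub>R (G (x + s) y - G x y) + ((Y z - y) / s) *\<^sub>R (G x (y + s) - G x y)"
proof -
  have "z = G (x + ((X z - x) / s) * s) (y + ((Y z - y) / s) * s)" using assms by (simp add: G_XY)
  then show ?thesis unfolding G_bary .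
qed

lemma grid_tri_mem:
  assumes "s \<noteq> 0"
  shows "z \<in> grid_tri x y s \<longleftrightarrow> 0 \<le> (X z - x) / s \<and> 0 \<le> (Y z - y) / s \<and> (X z - x) / s + (Y z - y) / s \<le> 1"
  unfolding grid_tri_def using tri_mem[OF grid_tri_ne[OF assms]] grid_tri_coords[OF assms] by metis

lemma grid_tri_interior:
  assumes "s \<noteq> 0" "0 < (X z - x) / s" "0 < (Y z - y) / s" "(X z - x) / s + (Y z - y) / s < 1"
  shows "z \<in> interior (grid_tri x y s)"
  using interior_triI[OF grid_tri_ne[OF assms(1)] assms(2-4), of x y] grid_tri_coords[OF assms(1), of z x y]
  unfolding grid_tri_def by metis

lemma T_grid_tri: "T = grid_tri 0 0 (real n)"
proof -
  have "G 0 0 = B" "G (real n) 0 = C" "G 0 (real n) = A" using n_pos by (simp_all add: G_def e1_def e2_def)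
  then show ?thesis unfolding grid_tri_def by (simp add: insert_commute)
qed

lemma T_mem: "z \<in> T \<longleftrightarrow> 0 \<le> X z \<and> 0 \<le> Y z \<and> X z + Y z \<le> real n"
  unfolding T_grid_tri using grid_tri_mem[of "real n" z 0 0] n_pos by (simp add: field_simps)

lemma T_interior: "0 < X z \<Longrightarrow> 0 < Y z \<Longrightarrow> X z + Y z < real n \<Longrightarrow> z \<in> interior T"
  unfolding T_grid_tri using n_pos by (intro grid_tri_interior) (simp_all add: field_simps)

text \<open>The labels \<open>(True, i, j)\<close> and \<open>(False, i, j)\<close> stand for the upright cell and the inverted
  cell of the parallelogram with lower left corner \<open>G i j\<close>.\<close>
fun cell :: "bool \<times> int \<times> int \<Rightarrow> plane set" where
  "cell (True, i, j) = grid_tri (real_of_int i) (real_of_int j) 1"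
| "cell (False, i, j) = grid_tri (real_of_int i + 1) (real_of_int j + 1) (- 1)"

lemma cell_mem:
  "z \<in> cell (True, i, j) \<longleftrightarrow> real_of_int i \<le> X z \<and> real_of_int j \<le> Y z \<and> X z + Y z \<le> real_of_int (i + j + 1)"
  "z \<in> cell (False, i, j) \<longleftrightarrow> X z \<le> real_of_int i + 1 \<and> Y z \<le> real_of_int j + 1 \<and> real_of_int (i + j + 1) \<le> X z + Y z"
  using grid_tri_mem[of 1 z "real_of_int i" "real_of_int j"] grid_tri_mem[of "- 1" z "real_of_int i + 1" "real_of_int j + 1"]
  by auto

lemma cell_convex: "convex (cell l)"
  by (cases l rule: cell.cases) (simp_all add: grid_tri_def)

lemma cell_closed: "closed (cell l)"
  by (cases l rule: cell.cases) (simp_all add: grid_tri_def compact_imp_closed finite_imp_compact_convex_hull)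

text \<open>The floors find the parallelogram and the comparison its half; on interiors of cells
  this inverts \<open>cell\<close>.\<close>

definition label_of :: "plane \<Rightarrow> bool \<times> int \<times> int" where
  "label_of z = (X z + Y z < real_of_int (\<lfloor>X z\<rfloor> + \<lfloor>Y z\<rfloor> + 1), \<lfloor>X z\<rfloor>, \<lfloor>Y z\<rfloor>)"

lemma interior_push:
  fixes z v :: plane
  assumes "z \<in> interior K"
  obtains e where "0 < e" "z + e *\<^sub>R v \<in> K"
proof -
  have "v \<in> fcone K z" using fcone_interior[OF assms] by simp
  then show ?thesis using that by (auto simp: fcone_def)
qed

lemma cell_interior_iff:
  "z \<in> interior (cell (True, i, j)) \<longleftrightarrow> real_of_int i < X z \<and> real_of_int j < Y z \<and> X z + Y z < real_of_int (i + j + 1)"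
  "z \<in> interior (cell (False, i, j)) \<longleftrightarrow> X z < real_of_int i + 1 \<and> Y z < real_of_int j + 1 \<and> real_of_int (i + j + 1) < X z + Y z"
proof -
  have n: "- e1 = (- 1) *\<^sub>R e1" "- e2 = (- 1) *\<^sub>R e2" by simp_all
  \<comment> \<open>An interior point can be pushed a little in every direction, which turns the
    weak inequalities of \<open>cell_mem\<close> into strict ones.\<close>
  have p: "\<exists>e>0. z + e *\<^sub>R e1 \<in> K" "\<exists>e>0. z + (- e) *\<^sub>R e1 \<in> K" "\<exists>e>0. z + e *\<^sub>R e2 \<in> K" "\<exists>e>0. z + (- e) *\<^sub>R e2 \<in> K"
    if "z \<in> interior K" for K :: "plane set"
    using interior_push[OF that, of e1] interior_push[OF that, of "- e1"] interior_push[OF that, of e2] interior_push[OF that, of "- e2"]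
    by (metis scaleR_minus_left scaleR_minus_right)+
  show "z \<in> interior (cell (True, i, j)) \<longleftrightarrow> real_of_int i < X z \<and> real_of_int j < Y z \<and> X z + Y z < real_of_int (i + j + 1)"
  proof
    assume z: "z \<in> interior (cell (True, i, j))"
    obtain s1 s2 s3 where s: "0 < s1" "z + s1 *\<^sub>R e1 \<in> cell (True, i, j)" "0 < s2" "z + (- s2) *\<^sub>R e1 \<in> cell (True, i, j)"
      "0 < s3" "z + (- s3) *\<^sub>R e2 \<in> cell (True, i, j)"
      using p[OF z] by blast
    from s(2,4,6) have "X z + s1 + Y z \<le> real_of_int (i + j + 1)" "real_of_int i \<le> X z - s2" "real_of_int j \<le> Y z - s3"
      unfolding cell_mem X_add by simp_all
    then show "real_of_int i < X z \<and> real_of_int j < Y z \<and> X z + Y z < real_of_int (i + j + 1)"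
      using s(1,3,5) by linarith
  qed (auto intro!: grid_tri_interior)
  show "z \<in> interior (cell (False, i, j)) \<longleftrightarrow> X z < real_of_int i + 1 \<and> Y z < real_of_int j + 1 \<and> real_of_int (i + j + 1) < X z + Y z"
  proof
    assume z: "z \<in> interior (cell (False, i, j))"
    obtain s1 s2 s3 where s: "0 < s1" "z + s1 *\<^sub>R e1 \<in> cell (False, i, j)" "0 < s2" "z + (- s2) *\<^sub>R e1 \<in> cell (False, i, j)"
      "0 < s3" "z + s3 *\<^sub>R e2 \<in> cell (False, i, j)"
      using p[OF z] by blast
    from s(2,4,6) have "real_of_int (i + j + 1) \<le> X z - s2 + Y z" "X z + s1 \<le> real_of_int i + 1" "Y z + s3 \<le> real_of_int j + 1"
      unfolding cell_mem X_add by simp_all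
    then show "X z < real_of_int i + 1 \<and> Y z < real_of_int j + 1 \<and> real_of_int (i + j + 1) < X z + Y z"
      using s(1,3,5) by linarith
  qed (auto intro!: grid_tri_interior)
qed

lemma cell_interior_label_of:
  assumes "z \<in> interior (cell l)"
  shows "l = label_of z"
proof (cases l rule: cell.cases)
  case (1 i j)
  have "real_of_int i < X z" "real_of_int j < Y z" "X z + Y z < real_of_int (i + j + 1)"
    using assms unfolding 1 cell_interior_iff by auto
  then have "\<lfloor>X z\<rfloor> = i" "\<lfloor>Y z\<rfloor> = j" "X z + Y z < real_of_int (i + j + 1)" by linarith+
  then show ?thesis unfolding 1 label_of_def by simp
next
  case (2 i j)
  have "X z < real_of_int i + 1" "Y z < real_of_int j + 1" "real_of_int (i + j + 1) < X z + Y z"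
    using assms unfolding 2 cell_interior_iff by auto
  then have "\<lfloor>X z\<rfloor> = i" "\<lfloor>Y z\<rfloor> = j" "\<not> X z + Y z < real_of_int (i + j + 1)" by linarith+
  then show ?thesis unfolding 2 label_of_def by simp
qed

lemma cell_interior_nonempty: "interior (cell l) \<noteq> {}"
proof (cases l rule: cell.cases)
  case (1 i j)
  have "G (real_of_int i + 1/3) (real_of_int j + 1/3) \<in> interior (cell l)"
    unfolding 1 cell_interior_iff by simp
  then show ?thesis by blast
next
  case (2 i j)
  have "G (real_of_int i + 2/3) (real_of_int j + 2/3) \<in> interior (cell l)"
    unfolding 2 cell_interior_iff by simp
  then show ?thesis by blast
qed

lemma cell_disjoint: "l \<noteq> l' \<Longrightarrow> interior (cell l) \<inter> interior (cell l') = {}"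
  using cell_interior_label_of by blast

lemma inj_cell: "inj cell"
  by (rule injI) (metis cell_disjoint cell_interior_nonempty inf.idem)

text \<open>The summand 2 comes from the corner \<open>G (i + 1) (j + 1)\<close> of an inverted
  cell, which must not lie beyond \<open>CA\<close>.\<close>

definition labels :: "(bool \<times> int \<times> int) set" where
  "labels = {(b, i, j). 0 \<le> i \<and> 0 \<le> j \<and> i + j + (if b then 1 else 2) \<le> int n}"

lemma labels_mem: "(True, i, j) \<in> labels \<longleftrightarrow> 0 \<le> i \<and> 0 \<le> j \<and> i + j + 1 \<le> int n"
  "(False, i, j) \<in> labels \<longleftrightarrow> 0 \<le> i \<and> 0 \<le> j \<and> i + j + 2 \<le> int n"
  by (simp_all add: labels_def)

lemma finite_labels: "finite labels"
proof (rule finite_subset)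
  show "labels \<subseteq> UNIV \<times> {0..int n} \<times> {0..int n}" by (auto simp: labels_def split: if_splits)
qed simp

lemma cell_subset_T: "l \<in> labels \<Longrightarrow> cell l \<subseteq> T"
proof
  fix z assume l: "l \<in> labels" and z: "z \<in> cell l"
  show "z \<in> T"
  proof (cases l rule: cell.cases)
    case (1 i j)
    have "0 \<le> real_of_int i" "0 \<le> real_of_int j" "real_of_int (i + j + 1) \<le> real n"
      using l unfolding 1 labels_mem by linarith+
    then show ?thesis using z unfolding 1 cell_mem T_mem by linarith
  next
    case (2 i j)
    have "0 \<le> real_of_int i" "0 \<le> real_of_int j" "real_of_int i + real_of_int j + 2 \<le> real n"
      using l unfolding 2 labels_mem by linarith+
    then show ?thesis using z unfolding 2 cell_mem T_mem by simp
  qed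
qed

lemma cell_cover: "\<Union>(cell ` labels) = T"
proof
  show "\<Union>(cell ` labels) \<subseteq> T" using cell_subset_T by blast
  show "T \<subseteq> \<Union>(cell ` labels)"
  proof
    fix z assume "z \<in> T"
    then have z: "0 \<le> X z" "0 \<le> Y z" "X z + Y z \<le> real n" unfolding T_mem by auto
    define i j where "i = \<lfloor>X z\<rfloor>" and "j = \<lfloor>Y z\<rfloor>"
    have ij: "real_of_int i \<le> X z" "X z < real_of_int i + 1" "real_of_int j \<le> Y z" "Y z < real_of_int j + 1" "0 \<le> i" "0 \<le> j"
      using z by (auto simp: i_def j_def)
    have "\<exists>l\<in>labels. z \<in> cell l"
    proof (cases "X z + Y z \<le> real_of_int (i + j + 1)")
      case False
      then have "(False, i, j) \<in> labels" using z ij unfolding labels_mem by linarith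
      moreover have "z \<in> cell (False, i, j)" using False ij unfolding cell_mem by linarith
      ultimately show ?thesis by blast
    next
      case True
      show ?thesis
      proof (cases "i + j + 1 \<le> int n")
        case le: True
        have "(True, i, j) \<in> labels" using ij le unfolding labels_mem by simp
        moreover have "z \<in> cell (True, i, j)" using True ij unfolding cell_mem by simp
        ultimately show ?thesis by blast
      next
        \<comment> \<open>At grid points on \<open>CA\<close> the floors name a cell outside
          \<open>T\<close>; a neighbouring cell with this point as a corner is taken
          instead.\<close>
        case False
        then have "i + j = int n" "X z = real_of_int i" "Y z = real_of_int j" using z ij by linarith+
        show ?thesis
        proof (cases "i = 0")
          case True
          then have "(True, i, j - 1) \<in> labels" using \<open>i + j = int n\<close> n_pos unfolding labels_mem by simp
          moreover have "z \<in> cell (True, i, j - 1)" using \<open>X z = real_of_int i\<close> \<open>Y z = real_of_int j\<close> unfolding cell_mem by simp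
          ultimately show ?thesis by blast
        next
          case False
          then have "(True, i - 1, j) \<in> labels" using \<open>i + j = int n\<close> ij unfolding labels_mem by simp
          moreover have "z \<in> cell (True, i - 1, j)" using \<open>X z = real_of_int i\<close> \<open>Y z = real_of_int j\<close> unfolding cell_mem by simp
          ultimately show ?thesis by blast
        qed
      qed
    qed
    then show "z \<in> \<Union>(cell ` labels)" by blast
  qed
qed

section \<open>Angles at grid points\<close>

lemma sum_dens_cell: "(\<Sum>l\<in>labels. dens (cell l) z) = dens T z"
proof -
  have "(\<Sum>K\<in>cell ` labels. dens K z) = dens T z"
  proof (rule sum_dens)
    fix K L assume "K \<in> cell ` labels" "L \<in> cell ` labels" "K \<noteq> L"
    then obtain l l' where "K = cell l" "L = cell l'" "l \<noteq> l'" by blast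
    then show "interior K \<inter> interior L = {}" using cell_disjoint by simp
  qed (use finite_labels cell_convex cell_closed cell_cover in auto)
  then show ?thesis using inj_cell by (simp add: sum.reindex inj_on_subset)
qed

lemma tri_dens:
  assumes "dist q r = a" "dist r p = b" "dist p q = c"
  shows "dens (convex hull {p, q, r}) p = \<alpha>" "dens (convex hull {p, q, r}) q = \<beta>" "dens (convex hull {p, q, r}) r = \<gamma>"
proof -
  have l: "dist q r = 1 / real n * dist B C" "dist r p = 1 / real n * dist C A" "dist p q = 1 / real n * dist A B"
    using assms by (auto simp: a_def b_def c_def)
  have k: "0 < 1 / real n" using t_pos by simp
  note d = cross_rotate_ne[OF tri]
  have ne: "cross (q - p) (r - p) \<noteq> 0" using shapeI(2)[OF assms] .
  show "dens (convex hull {p, q, r}) p = \<alpha>" "dens (convex hull {p, q, r}) q = \<beta>" "dens (convex hull {p, q, r}) r = \<gamma>"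
    unfolding dens_vertices[OF ne] \<alpha>_def \<beta>_def \<gamma>_def
    using sss[OF tri k l] sss[OF d(1) k l(2,3,1)] sss[OF d(2) k l(3,1,2)] by blast+
qed

lemma grid_tri_dens:
  assumes "s = 1 \<or> s = - 1"
  shows "dens (grid_tri x y s) (G x y) = \<beta>" "dens (grid_tri x y s) (G (x + s) y) = \<gamma>" "dens (grid_tri x y s) (G x (y + s)) = \<alpha>"
proof -
  have d1: "dist (G x y) (G (x + s) y) = a" using assms norms unfolding dist_norm G_diff by auto
  have d2: "dist (G x (y + s)) (G x y) = c" using assms norms unfolding dist_norm G_diff by auto
  have d3: "dist (G (x + s) y) (G x (y + s)) = b"
  proof -
    have "G (x + s) y - G x (y + s) = s *\<^sub>R (e1 - e2)" unfolding G_diff by (simp add: algebra_simps)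
    then show ?thesis using assms norms unfolding dist_norm by (elim disjE) (simp_all add: norm_minus_commute)
  qed
  have e: "grid_tri x y s = convex hull {G x (y + s), G x y, G (x + s) y}" unfolding grid_tri_def by (simp add: insert_commute)
  show "dens (grid_tri x y s) (G x y) = \<beta>" "dens (grid_tri x y s) (G (x + s) y) = \<gamma>" "dens (grid_tri x y s) (G x (y + s)) = \<alpha>"
    unfolding e using tri_dens[OF d1 d3 d2] by auto
qed

text \<open>The six cells around a grid point, in pairs opposite to each other. Near the boundary
  some of them are not in \<open>labels\<close>, which is why indices are integers.\<close>

definition ang :: "int \<Rightarrow> int \<Rightarrow> bool \<times> int \<times> int \<Rightarrow> real" where
  "ang i j l = (if l = (True, i, j) \<or> l = (False, i - 1, j - 1) then \<beta>
     else if l = (True, i - 1, j) \<or> l = (False, i, j - 1) then \<gamma>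
     else if l = (True, i, j - 1) \<or> l = (False, i - 1, j) then \<alpha> else 0)"

lemma dens_cell: "dens (cell l) (G (real_of_int i) (real_of_int j)) = ang i j l"
proof -
  consider "l = (True, i, j)" | "l = (False, i - 1, j - 1)" | "l = (True, i - 1, j)" | "l = (False, i, j - 1)"
    | "l = (True, i, j - 1)" | "l = (False, i - 1, j)"
    | "l \<notin> {(True, i, j), (False, i - 1, j - 1), (True, i - 1, j), (False, i, j - 1), (True, i, j - 1), (False, i - 1, j)}"
    by blast
  then show ?thesis
  proof cases
    case 1
    then show ?thesis using grid_tri_dens(1)[of 1 "real_of_int i" "real_of_int j"] by (simp add: ang_def)
  next
    case 2
    then show ?thesis using grid_tri_dens(1)[of "- 1" "real_of_int i" "real_of_int j"] by (simp add: ang_def)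
  next
    case 3
    then show ?thesis using grid_tri_dens(2)[of 1 "real_of_int i - 1" "real_of_int j"] by (simp add: ang_def)
  next
    case 4
    then show ?thesis using grid_tri_dens(2)[of "- 1" "real_of_int i + 1" "real_of_int j"] by (simp add: ang_def)
  next
    case 5
    then show ?thesis using grid_tri_dens(3)[of 1 "real_of_int i" "real_of_int j - 1"] by (simp add: ang_def)
  next
    case 6
    then show ?thesis using grid_tri_dens(3)[of "- 1" "real_of_int i" "real_of_int j + 1"] by (simp add: ang_def)
  next
    case 7
    have "G (real_of_int i) (real_of_int j) \<notin> cell l"
    proof (cases l rule: cell.cases)
      case (1 i' j')
      have "\<not> (i' \<le> i \<and> j' \<le> j \<and> i + j \<le> i' + j' + 1)"
      proof
        assume *: "i' \<le> i \<and> j' \<le> j \<and> i + j \<le> i' + j' + 1"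
        then consider "i' = i \<and> j' = j" | "i' = i - 1 \<and> j' = j" | "i' = i \<and> j' = j - 1" by linarith
        then show False by cases (use 7 1 in auto)
      qed
      then show ?thesis unfolding 1 cell_mem X_G Y_G by linarith
    next
      case (2 i' j')
      have "\<not> (i \<le> i' + 1 \<and> j \<le> j' + 1 \<and> i' + j' + 1 \<le> i + j)"
      proof
        assume *: "i \<le> i' + 1 \<and> j \<le> j' + 1 \<and> i' + j' + 1 \<le> i + j"
        then consider "i' = i - 1 \<and> j' = j - 1" | "i' = i - 1 \<and> j' = j" | "i' = i \<and> j' = j - 1" by linarith
        then show False by cases (use 7 2 in auto)
      qed
      then show ?thesis unfolding 2 cell_mem X_G Y_G by linarith
    qed
    then show ?thesis using 7 by (auto simp: dens_notin ang_def)
  qed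
qed

lemma ang_less: "ang i j l < straight"
  using angles_pos angle_sum by (auto simp: ang_def)

text \<open>At a grid point, the tiles other than the known cells fill the same total angle as the
  remaining cells of the grid.\<close>
lemma remainder:
  assumes "F \<subseteq> labels" "cell ` F \<subseteq> \<P>"
  shows "(\<Sum>K\<in>\<P> - cell ` F. dens K (G (real_of_int i) (real_of_int j))) =
    (if (True, i, j) \<in> labels - F then \<beta> else 0) + (if (False, i - 1, j - 1) \<in> labels - F then \<beta> else 0) +
    (if (True, i - 1, j) \<in> labels - F then \<gamma> else 0) + (if (False, i, j - 1) \<in> labels - F then \<gamma> else 0) +
    (if (True, i, j - 1) \<in> labels - F then \<alpha> else 0) + (if (False, i - 1, j) \<in> labels - F then \<alpha> else 0)"
proof -
  let ?z = "G (real_of_int i) (real_of_int j)"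
  let ?N = "{(True, i, j), (False, i - 1, j - 1), (True, i - 1, j), (False, i, j - 1), (True, i, j - 1), (False, i - 1, j)}"
  have fF: "finite F" using assms finite_labels finite_subset by blast
  have 1: "(\<Sum>K\<in>\<P> - cell ` F. dens K ?z) = dens T ?z - (\<Sum>K\<in>cell ` F. dens K ?z)"
    using sum_diff[OF fin assms(2), of "\<lambda>K. dens K ?z"] dens_sum by simp
  have "(\<Sum>K\<in>cell ` F. dens K ?z) = (\<Sum>l\<in>F. dens (cell l) ?z)"
    using inj_cell by (simp add: sum.reindex inj_on_subset)
  then have "(\<Sum>K\<in>\<P> - cell ` F. dens K ?z) = (\<Sum>l\<in>labels - F. dens (cell l) ?z)"
    using 1 sum_diff[OF finite_labels assms(1), of "\<lambda>l. dens (cell l) ?z"] sum_dens_cell by simp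
  also have "\<dots> = (\<Sum>l\<in>labels - F. ang i j l)" by (simp add: dens_cell)
  also have "\<dots> = (\<Sum>l\<in>?N \<inter> (labels - F). ang i j l)"
    by (rule sum.mono_neutral_right) (use finite_labels in \<open>auto simp: ang_def\<close>)
  also have "\<dots> = (\<Sum>l\<in>?N. if l \<in> labels - F then ang i j l else 0)"
    by (subst sum.inter_restrict) auto
  also have "\<dots> = (if (True, i, j) \<in> labels - F then \<beta> else 0) + (if (False, i - 1, j - 1) \<in> labels - F then \<beta> else 0) +
    (if (True, i - 1, j) \<in> labels - F then \<gamma> else 0) + (if (False, i, j - 1) \<in> labels - F then \<gamma> else 0) +
    (if (True, i, j - 1) \<in> labels - F then \<alpha> else 0) + (if (False, i - 1, j) \<in> labels - F then \<alpha> else 0)"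
    by (simp add: ang_def)
  finally show ?thesis .
qed

lemma remainder_fill:
  assumes "F2 \<subseteq> \<P> - cell ` F"
  shows "\<exists>i j k m. (\<Sum>K\<in>\<P> - cell ` F. dens K z) =
    (\<Sum>K\<in>F2. dens K z) + real i * \<alpha> + real j * \<beta> + real k * \<gamma> + real m * straight"
proof -
  have "(\<Sum>K\<in>\<P> - cell ` F. dens K z) = (\<Sum>K\<in>\<P> - cell ` F - F2. dens K z) + (\<Sum>K\<in>F2. dens K z)"
    by (rule sum.subset_diff) (use assms fin in auto)
  moreover obtain i j k m where "(\<Sum>K\<in>\<P> - cell ` F - F2. dens K z) = real i * \<alpha> + real j * \<beta> + real k * \<gamma> + real m * straight"
    using dens_fill[of "\<P> - cell ` F - F2" z] fin by (metis Diff_subset finite_Diff subset_trans)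
  ultimately show ?thesis by - (rule exI[of _ i], rule exI[of _ j], rule exI[of _ k], rule exI[of _ m], simp)
qed

lemma remainder_le:
  assumes "F2 \<subseteq> \<P> - cell ` F"
  shows "(\<Sum>K\<in>F2. dens K z) \<le> (\<Sum>K\<in>\<P> - cell ` F. dens K z)"
  by (rule sum_mono2) (use assms fin dens_nonneg in auto)

lemma dens_straight_notin_cell:
  assumes "dens K (G (real_of_int i) (real_of_int j)) = straight"
  shows "K \<notin> cell ` F"
  using assms dens_cell ang_less by (metis (no_types, lifting) imageE less_irrefl)

text \<open>The tile of an edge running across the point has a straight angle there. It is none of
  the known cells, whose angles at grid points are smaller, so it would have to fit into the
  rest.\<close>

lemma grid_blocked:
  assumes "u \<noteq> 0" "x + s *\<^sub>R u = G (real_of_int i) (real_of_int j)"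
    and "(\<Sum>K\<in>\<P> - cell ` F. dens K (G (real_of_int i) (real_of_int j))) < straight"
  shows "blocked x u s"
  unfolding blocked_def
proof (intro ballI allI impI notI)
  fix K s1 s2 assume K: "K \<in> \<P>" "left_edge K (x + s1 *\<^sub>R u) (x + s2 *\<^sub>R u)" "s1 < s \<and> s < s2"
  then have d: "dens K (G (real_of_int i) (real_of_int j)) = straight"
    using left_edge_dens[OF K(2) line_open_segment] assms by metis
  have "{K} \<subseteq> \<P> - cell ` F" using K dens_straight_notin_cell[OF d] by simp
  from remainder_le[OF this, of "G (real_of_int i) (real_of_int j)"] show False using d assms by simp
qed

text \<open>Equal distances fix the inner product with \<open>q - p\<close> and the determinant up
  to sign; the sign is fixed because both points lie on the left.\<close>

lemma third_vertex:
  assumes "dist q r = dist q r'" "dist r p = dist r' p" "0 < D (q - p) (r - p)" "0 < D (q - p) (r' - p)"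
  shows "r = r'"
proof -
  define u w w' where "u = q - p" and "w = r - p" and "w' = r' - p"
  have n: "norm w = norm w'" using assms by (simp add: w_def w'_def dist_norm)
  have i: "u \<bullet> w = u \<bullet> w'" using dist_inner[of q r p] dist_inner[of q r' p] assms by (simp add: u_def w_def w'_def)
  have ww: "w \<bullet> w = w' \<bullet> w'" using n by (simp add: dot_square_norm)
  have "(cross u w)\<^sup>2 = (cross u w')\<^sup>2" using cross_identity[of u w] cross_identity[of u w'] unfolding i ww by simp
  moreover have "0 < D u w * D u w'" using assms by (simp add: u_def w_def w'_def)
  then have "0 < (cross (B - A) (C - A))\<^sup>2 * (cross u w * cross u w')" by (simp add: D_def power2_eq_square mult_ac)
  then have "0 < cross u w * cross u w'" by (simp add: zero_less_mult_iff)
  ultimately have c: "cross u w = cross u w'" by (auto simp: power2_eq_iff zero_less_mult_iff)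
  have "(u \<bullet> u) * ((w - w') \<bullet> (w - w')) = 0"
    using cross_identity[of u "w - w'"] c i by (simp add: cross_add inner_diff_right)
  moreover have "u \<noteq> 0" using assms(3) by (auto simp: u_def)
  ultimately have "w = w'" by simp
  then show ?thesis by (simp add: w_def w'_def)
qed

text \<open>The tile \<open>W\<close> occupies the whole right half-plane at the point, so every
  other tile is confined to the left, as \<open>edge_coverage\<close> demands.\<close>

lemma covered_by_tile:
  assumes u: "u \<noteq> 0" and v: "0 < D u v"
    and W: "\<And>s. 0 < s \<Longrightarrow> s < l \<Longrightarrow> (\<And>K. K \<in> \<P> \<Longrightarrow> x + s *\<^sub>R u \<notin> verts K) \<Longrightarrow>
      x + s *\<^sub>R u \<in> interior T \<and> (\<exists>W\<in>\<P>. fcone W (x + s *\<^sub>R u) = {w. D u w \<le> 0})"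
  shows "covered x u l"
  unfolding covered_def
proof (intro allI impI)
  fix s assume s: "0 < s \<and> s < l \<and> (\<forall>K\<in>\<P>. x + s *\<^sub>R u \<notin> verts K)"
  let ?z = "x + s *\<^sub>R u"
  obtain W where W: "?z \<in> interior T" "W \<in> \<P>" "fcone W ?z = {w. D u w \<le> 0}" using W[of s] s by blast
  have "\<exists>K\<in>\<P>. \<exists>p q l. left_edge K p q \<and> ?z \<in> open_segment p q \<and> 0 < l \<and> q - p = l *\<^sub>R u"
  proof (rule edge_coverage[OF u])
    show "v \<in> fcone T ?z" using fcone_interior[OF W(1)] by simp
    fix K assume K: "K \<in> \<P>"
    then show "?z \<notin> verts K" using s by blast
    assume vK: "v \<in> fcone K ?z"
    then have "K \<noteq> W" using W v by auto
    then have "negligible (fcone K ?z \<inter> fcone W ?z)"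
      using K W by (intro negligible_fcone_Int tile_convex disj) auto
    then show "negligible (fcone K ?z \<inter> {w. D u w < 0})"
      unfolding W(3) by (rule negligible_subset) auto
  qed
  then show "\<exists>K\<in>\<P>. \<exists>s1 s2. s1 < s \<and> s < s2 \<and> left_edge K (x + s1 *\<^sub>R u) (x + s2 *\<^sub>R u)"
    using open_segment_param by (metis (no_types, lifting))
qed

end

subsection \<open>Rows and gaps\<close>

context grid begin

lemma grid_tri_left_edge:
  assumes "s \<noteq> 0"
  shows "left_edge (grid_tri x y s) (G x y) (G (x + s) y)" "left_edge (grid_tri x y s) (G (x + s) y) (G x (y + s))"
proof -
  have p: "0 < s * s" using assms not_real_square_gt_zero by blast
  have "D (G (x + s) y - G x y) (G x (y + s) - G x y) = s * s * D e1 e2"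
    unfolding G_diff by (simp add: D_add)
  then show "left_edge (grid_tri x y s) (G x y) (G (x + s) y)"
    unfolding left_edge_def grid_tri_def using D12 p by (intro exI[of _ "G x (y + s)"]) simp
  have "D (G x (y + s) - G (x + s) y) (G x y - G (x + s) y) = s * s * D e1 e2"
    unfolding G_diff by (simp add: D_add algebra_simps)
  then show "left_edge (grid_tri x y s) (G (x + s) y) (G x (y + s))"
    unfolding left_edge_def grid_tri_def using D12 p by (intro exI[of _ "G x y"]) (simp add: insert_commute)
qed

lemma verts_grid_tri: "s \<noteq> 0 \<Longrightarrow> verts (grid_tri x y s) = {G x y, G (x + s) y, G x (y + s)}"
  unfolding grid_tri_def by (rule verts_tri[OF grid_tri_ne])

lemma G_row: "G x y + s *\<^sub>R e1 = G (x + s) y"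
  by (simp add: G_def algebra_simps)

lemma G_diagonal: "G x y + s *\<^sub>R (e1 - e2) = G (x + s) (y - s)"
  by (simp add: G_def algebra_simps)

text \<open>The cells of the row below height \<open>j\<close> which touch the segment from \<open>G 0 j\<close> to \<open>G m j\<close>,
  except the inverted one on the right of \<open>G m j\<close>.\<close>
definition below :: "nat \<Rightarrow> nat \<Rightarrow> (bool \<times> int \<times> int) set" where
  "below j m = labels \<inter> {(b, i, j'). j' = int j - 1 \<and> i + (if b then 0 else 1) \<le> int m}"

lemma below_mem:
  "(True, i, j') \<in> below j m \<longleftrightarrow> (True, i, j') \<in> labels \<and> j' = int j - 1 \<and> i \<le> int m"
  "(False, i, j') \<in> below j m \<longleftrightarrow> (False, i, j') \<in> labels \<and> j' = int j - 1 \<and> i + 1 \<le> int m"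
  by (auto simp: below_def)

lemma below_labels: "below j m \<subseteq> labels"
  by (auto simp: below_def)

lemma below_height:
  assumes "l \<in> below j m" "z \<in> cell l"
  shows "Y z \<le> real j"
proof (cases l rule: cell.cases)
  case (1 i j')
  then have "j' = int j - 1" using assms below_mem by auto
  moreover have "real_of_int i \<le> X z" "X z + Y z \<le> real_of_int (i + j' + 1)" using assms(2) unfolding 1 cell_mem by auto
  ultimately show ?thesis by simp
next
  case (2 i j')
  then have "j' = int j - 1" using assms below_mem by auto
  moreover have "Y z \<le> real_of_int j' + 1" using assms(2) unfolding 2 cell_mem by auto
  ultimately show ?thesis by simp
qed

text \<open>On \<open>BC\<close> the side of \<open>T\<close> confines the tiles; higher up this is
  done by the inverted cells of the row below, whose top edges form the segment.\<close>

lemma row_covered: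
  assumes sub: "cell ` below j m \<subseteq> \<P>" and mj: "m + j \<le> n"
  shows "covered (G 0 (real j)) e1 (real m)"
proof (cases "j = 0")
  case True
  have "G 0 (real j) = B" using True by (simp add: G_def)
  moreover have "covered B e1 (real n)"
    by (rule side_covered[OF sides(2)]) (use n_pos in \<open>simp_all add: e1_def\<close>)
  ultimately show ?thesis using mj unfolding covered_def by auto
next
  case False
  show ?thesis
  proof (rule covered_by_tile[OF e_nonzero(1) D12])
    fix s assume s: "0 < s" "s < real m" and gen: "\<And>K. K \<in> \<P> \<Longrightarrow> G 0 (real j) + s *\<^sub>R e1 \<notin> verts K"
    have z: "G 0 (real j) + s *\<^sub>R e1 = G s (real j)" by (simp add: G_row)
    define i where "i = \<lfloor>s\<rfloor>"
    have i: "real_of_int i \<le> s" "s < real_of_int i + 1" "0 \<le> i" "i < int m" using s unfolding i_def by linarith+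
    have "(True, i, int j - 1) \<in> below j m" using i mj False unfolding below_mem labels_mem by simp
    then have "cell (True, i, int j - 1) \<in> \<P>" using sub by blast
    from gen[OF this] have "G s (real j) \<noteq> G (real_of_int i) (real j)" unfolding z by (simp add: verts_grid_tri)
    then have "real_of_int i < s" using i by (cases "real_of_int i = s") auto
    have W: "(False, i, int j - 1) \<in> below j m" using i mj False unfolding below_mem labels_mem by simp
    then have WP: "cell (False, i, int j - 1) \<in> \<P>" using sub by blast
    have le: "left_edge (cell (False, i, int j - 1)) (G (real_of_int i + 1) (real j)) (G (real_of_int i) (real j))"
      using grid_tri_left_edge(1)[of "- 1" "real_of_int i + 1" "real j"] by simp
    have "G s (real j) \<in> open_segment (G (real_of_int i) (real j)) (G (real_of_int i + 1) (real j))"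
      using line_open_segment[of "real_of_int i" s "real_of_int i + 1" e1 "G 0 (real j)"] i \<open>real_of_int i < s\<close> e_nonzero
      by (simp add: G_row)
    then have "fcone (cell (False, i, int j - 1)) (G s (real j)) = {w. 0 \<le> D (- e1) w}"
      using left_edge_fcone[OF le] by (simp add: G_diff open_segment_commute)
    moreover have "G s (real j) \<in> interior T" using s mj False by (intro T_interior) auto
    ultimately show "G 0 (real j) + s *\<^sub>R e1 \<in> interior T \<and>
        (\<exists>W\<in>\<P>. fcone W (G 0 (real j) + s *\<^sub>R e1) = {w. D e1 w \<le> 0})"
      unfolding z using WP by auto
  qed
qed

text \<open>An edge on the right of the line through \<open>G m j\<close> parallel to \<open>CA\<close> passes over this point.\<close>
definition passing :: "nat \<Rightarrow> nat \<Rightarrow> bool" where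
  "passing m j \<longleftrightarrow> \<not> blocked (G (real m) (real j)) (e1 - e2) 0"

text \<open>The free angle is \<open>\<beta>\<close> at the left end and straight in between. The
  right end is closed by \<open>CA\<close> or by a passing edge, whose tile takes a straight angle
  and leaves at most \<open>\<gamma>\<close>. So at the end where an upright cell shows its smaller
  base angle the larger one does not fit, and the upright position spreads from that end.\<close>

lemma row:
  assumes sub: "cell ` below j m \<subseteq> \<P>" and mj: "m + j \<le> n" and right: "m + j = n \<or> passing m j" and im: "i < m"
  shows "cell (True, int i, int j) \<in> \<P>"
proof -
  let ?F = "below j m"
  let ?g = "\<lambda>i. G (real i) (real j)"
  define rem where "rem i = (\<Sum>K\<in>\<P> - cell ` ?F. dens K (?g i))" for i
  have m: "0 < m" using im by simp
  have rem0: "rem 0 = \<beta>"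
    using remainder[OF below_labels sub, of "int 0" "int j"] m mj unfolding rem_def
    by (simp add: below_mem labels_mem)
  have remi: "rem i = straight" if "0 < i" "i < m" for i
    using remainder[OF below_labels sub, of "int i" "int j"] that mj angle_sum unfolding rem_def
    by (simp add: below_mem labels_mem)
  \<comment> \<open>The inverted cell to the right of \<open>G m j\<close> is not in
    \<open>below j m\<close>; it contributes the extra \<open>\<gamma>\<close>.\<close>
  have remm: "rem m \<le> (if m + j = n then \<gamma> else straight + \<gamma>)"
    using remainder[OF below_labels sub, of "int m" "int j"] m mj angle_sum angles_pos unfolding rem_def
    by (simp add: below_mem labels_mem)
  have obst: "\<exists>L\<in>\<P> - cell ` ?F. dens L (?g m) = straight \<and> fcone L (?g m) = {w. 0 \<le> D (e1 - e2) w}" if ne: "m + j \<noteq> n"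
  proof -
    obtain L s1 s2 where L: "L \<in> \<P>" "left_edge L (?g m + s1 *\<^sub>R (e1 - e2)) (?g m + s2 *\<^sub>R (e1 - e2))" "s1 < 0" "0 < s2"
      using right ne unfolding passing_def blocked_def by auto
    have mem: "?g m \<in> open_segment (?g m + s1 *\<^sub>R (e1 - e2)) (?g m + s2 *\<^sub>R (e1 - e2))"
      using line_open_segment[of s1 0 s2 "e1 - e2" "?g m"] L e_nonzero by simp
    have d: "dens L (?g m) = straight" using left_edge_dens[OF L(2) mem] .
    have "fcone L (?g m) = {w. 0 \<le> D ((s2 - s1) *\<^sub>R (e1 - e2)) w}"
      using left_edge_fcone[OF L(2) mem] by (simp add: algebra_simps)
    also have "\<dots> = {w. 0 \<le> D (e1 - e2) w}" using L by (simp only: D_simps) (simp add: zero_le_mult_iff)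
    finally show ?thesis using d L(1) dens_straight_notin_cell[of L "int m" "int j"] by auto
  qed
  have bl0: "blocked (?g 0) e1 0"
    by (rule grid_blocked[where F = ?F and i = "int 0" and j = "int j"])
      (use rem0 e_nonzero angle_sum angles_pos in \<open>simp_all add: rem_def\<close>)
  have blm: "blocked (?g 0) e1 (real m)"
  proof (cases "m + j = n")
    case True
    show ?thesis
      by (rule grid_blocked[where F = ?F and i = "int m" and j = "int j"])
        (use True remm e_nonzero angle_sum angles_pos in \<open>simp_all add: rem_def G_row\<close>)
  next
    case False
    obtain L where L: "L \<in> \<P> - cell ` ?F" "dens L (?g m) = straight" "fcone L (?g m) = {w. 0 \<le> D (e1 - e2) w}"
      using obst[OF False] by blast
    show ?thesis unfolding blocked_def
    proof (intro ballI allI impI notI)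
      fix K s1 s2 assume K: "K \<in> \<P>" "left_edge K (?g 0 + s1 *\<^sub>R e1) (?g 0 + s2 *\<^sub>R e1)" "s1 < real m \<and> real m < s2"
      have mem: "?g m \<in> open_segment (?g 0 + s1 *\<^sub>R e1) (?g 0 + s2 *\<^sub>R e1)"
        using line_open_segment[of s1 "real m" s2 e1 "?g 0"] K e_nonzero by (simp add: G_row)
      have dK: "dens K (?g m) = straight" using left_edge_dens[OF K(2) mem] .
      have "fcone K (?g m) = {w. 0 \<le> D ((s2 - s1) *\<^sub>R e1) w}"
        using left_edge_fcone[OF K(2) mem] by (simp add: algebra_simps)
      \<comment> \<open>The direction \<open>- e1\<close> tells the two tiles apart: it lies on the
        boundary of the half-plane of \<open>K\<close> and outside that of \<open>L\<close>.\<close>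
      then have "- e1 \<in> fcone K (?g m)" by simp
      moreover have "- e1 \<notin> fcone L (?g m)" unfolding L(3) using D12 by (simp add: D_add)
      ultimately have "K \<noteq> L" by auto
      have "{K, L} \<subseteq> \<P> - cell ` ?F" using K L dens_straight_notin_cell[of K "int m" "int j"] dK by auto
      from remainder_le[OF this, of "?g m"] have "2 * straight \<le> rem m"
        using \<open>K \<noteq> L\<close> dK L unfolding rem_def by simp
      then show False using remm False angle_sum angles_pos by simp
    qed
  qed
  have "\<exists>K\<in>\<P>. left_edge K (?g i) (?g (Suc i))" if "i < m" for i
    using pure_chain[of e1 "?g 0" m i] row_covered[OF sub mj] bl0 blm pure_a norms e_nonzero that
    by (simp add: G_row)
  then obtain K where K: "\<And>i. i < m \<Longrightarrow> K i \<in> \<P>" "\<And>i. i < m \<Longrightarrow> left_edge (K i) (?g i) (?g (Suc i))" by metis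
  define U where "U i \<longleftrightarrow> K i = cell (True, int i, int j)" for i
  \<comment> \<open>The known cells stay below height \<open>j\<close>, while the third vertex of
    \<open>K i\<close> lies above it.\<close>
  have notF: "K i \<notin> cell ` ?F" if im: "i < m" for i
  proof
    assume "K i \<in> cell ` ?F"
    then obtain l where l: "l \<in> ?F" "K i = cell l" by blast
    obtain r where r: "K i = convex hull {?g i, ?g (Suc i), r}" "0 < D (?g (Suc i) - ?g i) (r - ?g i)"
      using K(2)[OF im] left_edge_def by blast
    have "?g (Suc i) - ?g i = e1" unfolding G_diff by simp
    then have "real j < Y r" using r(2) D12 by (simp add: D_e1 zero_less_mult_iff)
    moreover have "r \<in> cell l" using r(1) l by (metis hull_inc insertCI)
    ultimately show False using below_height l by fastforce
  qed
  have ends: "(U i \<and> dens (K i) (?g i) = \<beta> \<and> dens (K i) (?g (Suc i)) = \<gamma>) \<or>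
      (\<beta> \<noteq> \<gamma> \<and> \<not> U i \<and> dens (K i) (?g i) = \<gamma> \<and> dens (K i) (?g (Suc i)) = \<beta>)" if "i < m" for i
  proof -
    have gd: "?g (Suc i) - ?g i = e1" unfolding G_diff by simp
    have "dist (?g i) (?g (Suc i)) = a" using norms gd by (metis dist_norm norm_minus_commute)
    from left_edge_a[OF K(1,2)[OF that] this] obtain r where r:
      "K i = convex hull {?g i, ?g (Suc i), r}" "0 < D (?g (Suc i) - ?g i) (r - ?g i)"
      "dist (?g (Suc i)) r = b \<and> dist r (?g i) = c \<and> dens (K i) (?g i) = \<beta> \<and> dens (K i) (?g (Suc i)) = \<gamma> \<or>
       dist (?g (Suc i)) r = c \<and> dist r (?g i) = b \<and> dens (K i) (?g i) = \<gamma> \<and> dens (K i) (?g (Suc i)) = \<beta>" .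
    let ?r = "G (real i) (real j + 1)"
    have r': "dist (?g (Suc i)) ?r = b" "dist ?r (?g i) = c" "0 < D (?g (Suc i) - ?g i) (?r - ?g i)"
      using norms D12 unfolding dist_norm G_diff by (simp_all add: D_add norm_minus_commute)
    have up: "U i" if "dist (?g (Suc i)) r = b" "dist r (?g i) = c"
    proof -
      have "r = ?r" by (rule third_vertex[of "?g (Suc i)" _ _ "?g i"]) (use that r r' in auto)
      then show ?thesis using r(1) unfolding U_def by (simp add: grid_tri_def add.commute)
    qed
    have cells: "dens (cell (True, int i, int j)) (?g i) = \<beta>" "dens (cell (True, int i, int j)) (?g (Suc i)) = \<gamma>"
      using grid_tri_dens[of 1 "real i" "real j"] by (simp_all add: add.commute)
    show ?thesis
    proof (cases "\<beta> = \<gamma>")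
      case True
      then have "b = c" using angle_eq_iff by simp
      then show ?thesis using r(3) up True by auto
    next
      case False
      then show ?thesis using r(3) up cells unfolding U_def by auto
    qed
  qed
  have neq: "K i \<noteq> K (Suc i)" if "Suc i < m" for i
  proof
    assume "K i = K (Suc i)"
    then have "left_edge (K i) (?g 0 + real (Suc i) *\<^sub>R e1) (?g 0 + real (Suc (Suc i)) *\<^sub>R e1)"
      using K(2)[OF that] by (simp add: G_row)
    moreover have "left_edge (K i) (?g 0 + real i *\<^sub>R e1) (?g 0 + real (Suc i) *\<^sub>R e1)"
      using K(2)[of i] that by (simp add: G_row)
    ultimately show False
      using left_edge_unique[of e1 "real i" "real (Suc i)" "real (Suc i)" "real (Suc (Suc i))" "K i" "?g 0"] e_nonzero by simp
  qed
  have node: "\<exists>i' j' k' m'. straight = dens (K i) (?g (Suc i)) + dens (K (Suc i)) (?g (Suc i)) +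
      real i' * \<alpha> + real j' * \<beta> + real k' * \<gamma> + real m' * straight" if "Suc i < m" for i
  proof -
    have "{K i, K (Suc i)} \<subseteq> \<P> - cell ` ?F" using K notF that by auto
    from remainder_fill[OF this, of "?g (Suc i)"] show ?thesis
      using neq[OF that] remi[of "Suc i"] that unfolding rem_def by simp
  qed
  have single: "dens (K i) (?g i') \<le> rem i'" if "i < m" for i i'
    using remainder_le[of "{K i}" ?F "?g i'"] K notF that unfolding rem_def by simp
  have "U i" if "i < m" for i
  proof (cases "\<gamma> < \<beta>")
    case True
    have last: "U (m - 1)"
    proof (rule ccontr)
      assume "\<not> U (m - 1)"
      then have d: "dens (K (m - 1)) (?g m) = \<beta>" using ends[of "m - 1"] m by auto
      show False
      proof (cases "m + j = n")
        case True
        then show False using single[of "m - 1" m] d remm \<open>\<gamma> < \<beta>\<close> m by simp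
      next
        case False
        obtain L where L: "L \<in> \<P> - cell ` ?F" "dens L (?g m) = straight" using obst[OF False] by blast
        have "L \<noteq> K (m - 1)" using L d angle_sum angles_pos by auto
        moreover have "{K (m - 1), L} \<subseteq> \<P> - cell ` ?F" using L K notF m by auto
        ultimately have "\<beta> + straight \<le> rem m" using remainder_le[of "{K (m - 1), L}" ?F "?g m"] d L unfolding rem_def by auto
        then show False using remm False \<open>\<gamma> < \<beta>\<close> by simp
      qed
    qed
    have step: "U i" if si: "Suc i < m" "U (Suc i)" for i
    proof (rule ccontr)
      assume "\<not> U i"
      then have "dens (K i) (?g (Suc i)) = \<beta>" "dens (K (Suc i)) (?g (Suc i)) = \<beta>" using ends[of i] ends[of "Suc i"] si by auto
      moreover obtain i' j' k' m' where "straight = dens (K i) (?g (Suc i)) + dens (K (Suc i)) (?g (Suc i)) +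
        real i' * \<alpha> + real j' * \<beta> + real k' * \<gamma> + real m' * straight" using node[OF si(1)] by (elim exE)
      ultimately show False using no_beta[OF True, of i' j' k' m'] by simp
    qed
    have "U (m - 1 - d)" for d
    proof (induction d)
      case 0
      then show ?case using last by simp
    next
      case (Suc d)
      show ?case
      proof (cases "d < m - 1")
        case True
        then have e: "Suc (m - 1 - Suc d) = m - 1 - d" by simp
        show ?thesis by (rule step) (use Suc e True m in auto)
      next
        case False
        then show ?thesis using Suc by simp
      qed
    qed
    from this[of "m - 1 - i"] show ?thesis using that by simp
  next
    case False
    show ?thesis
    proof (cases "\<beta> = \<gamma>")
      case True
      then show ?thesis using ends[OF that] by blast
    next
      case ne: False
      then have lt: "\<beta> < \<gamma>" using False by simp
      have first: "U 0" using ends[OF m] single[OF m, of 0] rem0 lt by auto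
      have step: "U (Suc i)" if si: "Suc i < m" "U i" for i
      proof (rule ccontr)
        assume "\<not> U (Suc i)"
        then have "dens (K i) (?g (Suc i)) = \<gamma>" "dens (K (Suc i)) (?g (Suc i)) = \<gamma>" using ends[of i] ends[of "Suc i"] si by auto
        moreover obtain i' j' k' m' where "straight = dens (K i) (?g (Suc i)) + dens (K (Suc i)) (?g (Suc i)) +
        real i' * \<alpha> + real j' * \<beta> + real k' * \<gamma> + real m' * straight" using node[OF si(1)] by (elim exE)
      ultimately show False using no_gamma[OF lt, of i' j' k' m'] by simp
      qed
      show ?thesis using that first step by (induction i) auto
    qed
  qed
  from this[OF im] show ?thesis using K(1)[OF im] unfolding U_def by simp
qed

lemma below_mono: "k \<le> m \<Longrightarrow> below j k \<subseteq> below j m"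
  by (auto simp: below_def)

text \<open>The wall runs from \<open>G (k - l) (j + l)\<close> down to \<open>G k j\<close>. On its
  left are right edges of upright cells; its upper end is blocked by assumption, its lower end
  because only the gap angle \<open>\<alpha>\<close> is free there. So it splits into
  \<open>b\<close>-edges, and the lowest one belongs to the tile in the tip of the gap.\<close>

lemma gap_step:
  assumes sub: "cell ` below j (Suc k) \<subseteq> \<P>" and mj: "Suc k + j \<le> n"
    and ups: "\<And>i. i < Suc k \<Longrightarrow> cell (True, int i, int j) \<in> \<P>"
    and l: "1 \<le> l" "l \<le> k"
    and fill: "\<And>s i. s < l \<Longrightarrow> i + s < k \<Longrightarrow> cell (True, int i, int (j + s)) \<in> \<P>"
    and np: "\<not> passing (k - l) (j + l)"
  shows "cell (False, int k - 1, int j) \<in> \<P>"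
proof -
  let ?u = "e1 - e2"
  let ?x = "G (real (k - l)) (real (j + l))"
  let ?q = "G (real k) (real j)"
  let ?p = "G (real k - 1) (real j + 1)"
  \<comment> \<open>With \<open>Suc k\<close> the inverted cell to the lower right of
    \<open>?q\<close> is included, so the gap is the only cell missing around
    \<open>?q\<close>.\<close>
  define F where "F = below j (Suc k) \<union> {(True, int k - 1, int j), (True, int k, int j)}"
  have Fl: "F \<subseteq> labels" using below_labels l mj unfolding F_def by (auto simp: labels_mem)
  have "cell (True, int (k - 1), int j) \<in> \<P>" "cell (True, int k, int j) \<in> \<P>" using ups[of "k - 1"] ups[of k] l by auto
  then have Fs: "cell ` F \<subseteq> \<P>" using sub l unfolding F_def by (auto simp: of_nat_diff)
  have rem: "(\<Sum>K\<in>\<P> - cell ` F. dens K ?q) = \<alpha>"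
    using remainder[OF Fl Fs, of "int k" "int j"] l mj
    by (simp add: F_def below_mem labels_mem)
  have seg: "?x + s *\<^sub>R ?u = G (real k - real l + s) (real j + real l - s)" for s
    using l unfolding G_diagonal G_eq_iff by (simp add: of_nat_diff)
  have cov: "covered ?x ?u (real l)"
  proof (rule covered_by_tile[OF e_nonzero(3), of e1])
    show "0 < D ?u e1" using D12 by (simp add: D_add)
    fix s assume s: "0 < s" "s < real l" and gen: "\<And>K. K \<in> \<P> \<Longrightarrow> ?x + s *\<^sub>R ?u \<notin> verts K"
    define y where "y = real k - real l + s"
    have y: "real (k - l) < y" "y < real k" using s l by (auto simp: y_def of_nat_diff)
    have z: "?x + s *\<^sub>R ?u = G y (real k + real j - y)" unfolding seg y_def G_eq_iff by simp
    define i where "i = nat \<lfloor>y\<rfloor>"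
    have y0: "0 \<le> y" using y by simp
    have i: "real i \<le> y" "y < real i + 1" "k - l \<le> i" "i < k" using y y0 unfolding i_def by linarith+
    \<comment> \<open>The filled triangle reindexed along the wall: the cell in column
      \<open>i'\<close> lies in row \<open>k + j - i' - 1\<close>.\<close>
    have inP: "cell (True, int i', int k + int j - int i' - 1) \<in> \<P>" if "i' < k" "k - l \<le> i'" for i'
    proof -
      have "cell (True, int i', int (j + (k - 1 - i'))) \<in> \<P>" by (rule fill) (use that l in auto)
      moreover have "int (j + (k - 1 - i')) = int k + int j - int i' - 1" using that by simp
      ultimately show ?thesis by (simp only:)
    qed
    let ?W = "cell (True, int i, int k + int j - int i - 1)"
    have WP: "?W \<in> \<P>" using inP i by blast
    have W: "?W = grid_tri (real i) (real k + real j - real i - 1) 1" by simp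
    have "G (real i) (real k + real j - real i) \<in> verts ?W" unfolding W by (subst verts_grid_tri) auto
    then have "y \<noteq> real i" using gen[OF WP] unfolding z by auto
    then have iy: "real i < y" using i by simp
    have le: "left_edge ?W (G (real i + 1) (real k + real j - real i - 1)) (G (real i) (real k + real j - real i))"
      using grid_tri_left_edge(2)[of 1 "real i" "real k + real j - real i - 1"] unfolding W by simp
    have "G y (real k + real j - y) \<in> open_segment (G (real i) (real k + real j - real i)) (G (real i + 1) (real k + real j - real i - 1))"
    proof -
      have "real k + real j - real i - 1 = real k + real j - (real i + 1)" by simp
      then show ?thesis
        using line_open_segment[of "real i" y "real i + 1" ?u "G 0 (real k + real j)", unfolded G_diagonal] i iy e_nonzero
        by (simp only: add_0 simp_thms)
    qed
    then have "fcone ?W (G y (real k + real j - y)) = {w. 0 \<le> D (- ?u) w}"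
      using left_edge_fcone[OF le] by (simp add: G_diff open_segment_commute)
    moreover have "G y (real k + real j - y) \<in> interior T" using y y0 mj by (intro T_interior) auto
    ultimately show "?x + s *\<^sub>R ?u \<in> interior T \<and> (\<exists>W\<in>\<P>. fcone W (?x + s *\<^sub>R ?u) = {w. D ?u w \<le> 0})"
      unfolding z using WP by (intro conjI bexI[of _ ?W]) (auto simp: D_add)
  qed
  have b0: "blocked ?x ?u 0" using np unfolding passing_def by simp
  have xl: "?x + real l *\<^sub>R ?u = G (real_of_int (int k)) (real_of_int (int j))" unfolding seg by simp
  have bl: "blocked ?x ?u (real l)"
    by (rule grid_blocked[OF e_nonzero(3) xl, where F = F]) (use rem angle_sum angles_pos in simp)
  have "\<exists>K\<in>\<P>. left_edge K (?x + real (l - 1) *\<^sub>R ?u) (?x + real (Suc (l - 1)) *\<^sub>R ?u)"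
    by (rule pure_chain[OF _ _ cov b0 bl]) (use pure_b norms e_nonzero l in auto)
  moreover have "?x + real (l - 1) *\<^sub>R ?u = ?p" "?x + real (Suc (l - 1)) *\<^sub>R ?u = ?q"
    unfolding seg using l by (simp_all add: of_nat_diff algebra_simps)
  ultimately obtain K where K: "K \<in> \<P>" "left_edge K ?p ?q" by auto
  have pq: "?q - ?p = ?u" unfolding G_diff by simp
  then have "dist ?p ?q = b" using norms by (metis dist_norm norm_minus_commute)
  from left_edge_b[OF K this] obtain r where r: "K = convex hull {?p, ?q, r}" "0 < D (?q - ?p) (r - ?p)"
    "dist ?q r = c \<and> dist r ?p = a \<and> dens K ?p = \<gamma> \<and> dens K ?q = \<alpha> \<or>
     dist ?q r = a \<and> dist r ?p = c \<and> dens K ?p = \<alpha> \<and> dens K ?q = \<gamma>" .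
  let ?r = "G (real k) (real j + 1)"
  have r': "dist ?q ?r = c" "dist ?r ?p = a" "0 < D (?q - ?p) (?r - ?p)"
    using norms D12 unfolding dist_norm G_diff by (simp_all add: D_add)
  have good: ?thesis if "dist ?q r = c" "dist r ?p = a"
  proof -
    have "r = ?r" by (rule third_vertex[of ?q _ _ ?p]) (use that r r' in auto)
    then have "K = cell (False, int k - 1, int j)" using r(1) by (simp add: grid_tri_def insert_commute)
    then show ?thesis using K by simp
  qed
  show ?thesis
  proof (cases "a = c")
    case True
    then show ?thesis using r(3) good by auto
  next
    case False
    \<comment> \<open>The other position of \<open>K\<close> would put \<open>\<gamma>\<close> into
      the free angle \<open>\<alpha>\<close>, which \<open>no_alpha\<close> forbids.\<close>
    have "dens K ?q \<noteq> \<gamma>"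
    proof
      assume d: "dens K ?q = \<gamma>"
      have inK: "?p \<in> K" "r \<in> K" using r(1) by (simp_all add: hull_inc)
      \<comment> \<open>The point \<open>?p\<close> lies above the cells of \<open>below\<close> and
        to the left of upright cell \<open>k\<close>; the vertex \<open>r\<close> lies to the right
        of the wall and so outside upright cell \<open>k - 1\<close>.\<close>
      have "K \<notin> cell ` F"
      proof
        assume "K \<in> cell ` F"
        then obtain lb where lb: "lb \<in> F" "K = cell lb" by blast
        then consider "lb \<in> below j (Suc k)" | "lb = (True, int k - 1, int j)" | "lb = (True, int k, int j)"
          unfolding F_def by auto
        then show False
        proof cases
          case 1
          then show False using below_height[of lb j "Suc k" ?p] inK lb by simp
        next
          case 2
          have "X r + Y r \<le> real k + real j" using inK(2) unfolding lb(2) 2 cell_mem by simp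
          moreover have "0 < (X r + Y r - (real k - 1) - (real j + 1)) * D e1 e2" using r(2) unfolding pq D_diag .
          ultimately show False using D12 by (simp add: zero_less_mult_iff)
        next
          case 3
          then show False using inK(1) unfolding lb(2) 3 cell_mem by simp
        qed
      qed
      then have "{K} \<subseteq> \<P> - cell ` F" using K by simp
      from remainder_fill[OF this, of ?q] obtain i' j' k' m' where
        "\<alpha> = \<gamma> + real i' * \<alpha> + real j' * \<beta> + real k' * \<gamma> + real m' * straight" unfolding rem using d by auto
      then show False using no_alpha[OF False] by blast
    qed
    then show ?thesis using r(3) good by auto
  qed
qed

text \<open>On \<open>AB\<close> at most a straight angle is available and the cell below takes
  \<open>\<alpha>\<close> of it; this stops every wall when it reaches \<open>AB\<close>.\<close>

lemma not_passing_left: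
  assumes "cell (True, 0, int j - 1) \<in> \<P>" "1 \<le> j" "j \<le> n"
  shows "\<not> passing 0 j"
proof -
  let ?F = "{(True, 0, int j - 1)}"
  have F: "?F \<subseteq> labels" "cell ` ?F \<subseteq> \<P>" using assms by (auto simp: labels_mem)
  have "(\<Sum>K\<in>\<P> - cell ` ?F. dens K (G (real_of_int 0) (real_of_int (int j)))) < straight"
    using remainder[OF F, of 0 "int j"] angle_sum angles_pos by (simp add: labels_mem)
  then have "blocked (G (real 0) (real j)) (e1 - e2) 0"
    by (intro grid_blocked[where F = ?F and i = 0 and j = "int j"]) (use e_nonzero in simp_all)
  then show ?thesis unfolding passing_def by simp
qed

text \<open>The gap between two upright cells of a row: follow its left wall upwards until the edges along
  it have a vertex at a grid point; as long as they do not, they bound the rows above, which are then filled.\<close>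
lemma gaps:
  assumes "cell ` below j m \<subseteq> \<P>" "m + j \<le> n" "\<And>i. i < m \<Longrightarrow> cell (True, int i, int j) \<in> \<P>" "Suc i < m"
  shows "cell (False, int i, int j) \<in> \<P>"
  using assms
proof (induction m arbitrary: i j rule: less_induct)
  case (less m)
  show ?case
  proof (cases "Suc (Suc i) < m")
    \<comment> \<open>All gaps but the last one belong to a shorter row.\<close>
    case True
    show ?thesis
      by (rule less.IH[of "m - 1"]) (use less.prems True below_mono[of "m - 1" m j] in auto)
  next
    case False
    define k where "k = Suc i"
    have m: "m = Suc k" using False less.prems by (simp add: k_def)
    note prems = less.prems[unfolded m]
    \<comment> \<open>The part of \<open>l\<close> rows that lies to the left of the wall is
      complete; the row \<open>s\<close> steps up has length \<open>k - s\<close> there.\<close>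
    define filled where "filled l \<longleftrightarrow> (\<forall>s<l. (\<forall>i. i + s < k \<longrightarrow> cell (True, int i, int (j + s)) \<in> \<P>) \<and>
      (\<forall>i. i + s + 1 < k \<longrightarrow> cell (False, int i, int (j + s)) \<in> \<P>))" for l
    have bk: "cell ` below j k \<subseteq> \<P>" using prems(1) below_mono[of k "Suc k" j] by auto
    have "cell (False, int i', int j) \<in> \<P>" if "i' + 1 < k" for i'
      by (rule less.IH[of k j i']) (use m bk prems that in auto)
    then have filled1: "filled 1" unfolding filled_def using prems(3) by simp
    have step: "filled (Suc l)" if l: "1 \<le> l" "l < k" "filled l" "passing (k - l) (j + l)" for l
    proof -
      let ?m = "k - l" and ?j = "j + l"
      have bl: "cell ` below ?j ?m \<subseteq> \<P>"
      proof
        fix K assume "K \<in> cell ` below ?j ?m"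
        then obtain lb where lb: "lb \<in> below ?j ?m" "K = cell lb" by blast
        show "K \<in> \<P>"
        proof (cases lb rule: cell.cases)
          case (1 i' j')
          then have "0 \<le> i'" "i' \<le> int (k - l)" "j' = int (j + l) - 1" using lb by (auto simp: below_mem labels_mem)
          moreover define i'' where "i'' = nat i'"
          ultimately have "i' = int i''" "i'' + (l - 1) < k" "j' = int (j + (l - 1))" "l - 1 < l" using l by auto
          then show ?thesis using l(3) unfolding filled_def lb(2) 1 by blast
        next
          case (2 i' j')
          then have "0 \<le> i'" "i' + 1 \<le> int (k - l)" "j' = int (j + l) - 1" using lb by (auto simp: below_mem labels_mem)
          moreover define i'' where "i'' = nat i'"
          ultimately have "i' = int i''" "i'' + (l - 1) + 1 < k" "j' = int (j + (l - 1))" "l - 1 < l" using l by auto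
          then show ?thesis using l(3) unfolding filled_def lb(2) 2 by blast
        qed
      qed
      have mj: "?m + ?j \<le> n" using prems(2) l by simp
      \<comment> \<open>The edge passing over the upper end of the wall closes this row on the
        right.\<close>
      have ups: "cell (True, int i', int ?j) \<in> \<P>" if "i' < ?m" for i'
        by (rule row[OF bl mj]) (use l that in auto)
      have downs: "cell (False, int i', int ?j) \<in> \<P>" if "Suc i' < ?m" for i'
        by (rule less.IH[of ?m ?j i']) (use m l bl mj ups that in auto)
      show ?thesis using l(3) ups downs unfolding filled_def by (auto simp: less_Suc_eq)
    qed
    show ?thesis
    proof (rule ccontr)
      assume no: "\<not> ?thesis"
      \<comment> \<open>While the gap stays open, every grid point of the wall is passed over, so
        the rows fill up as far as \<open>AB\<close>, where passing is impossible.\<close>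
      have pass: "passing (k - l) (j + l)" if "1 \<le> l" "l \<le> k" "filled l" for l
      proof (rule ccontr)
        assume "\<not> passing (k - l) (j + l)"
        then have "cell (False, int k - 1, int j) \<in> \<P>"
          by (intro gap_step[of j k l]) (use prems that in \<open>auto simp: filled_def\<close>)
        then show False using no by (simp add: k_def)
      qed
      have fl: "filled (Suc l)" if "l < k" for l
        using that
      proof (induction l)
        case 0
        then show ?case using filled1 by simp
      next
        case (Suc l)
        then show ?case using step[of "Suc l"] pass[of "Suc l"] by simp
      qed
      have "filled k" using fl[of "k - 1"] by (simp add: k_def)
      moreover have "cell (True, int 0, int (j + (k - 1))) \<in> \<P>"
        using \<open>filled k\<close> unfolding filled_def by (auto simp: k_def)
      then have "\<not> passing 0 (j + k)" by (intro not_passing_left) (use prems(2) in \<open>auto simp: k_def\<close>)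
      ultimately show False using pass[of k] by (simp add: k_def)
    qed
  qed
qed

text \<open>Row \<open>j\<close> has its full length \<open>n - j\<close>, so its right end lies on
  \<open>CA\<close>.\<close>

lemma rows: "j \<le> n \<Longrightarrow> cell ` below j (n - j) \<subseteq> \<P>"
proof (induction j)
  case 0
  then show ?case by (auto simp: below_def labels_def)
next
  case (Suc j)
  then have ih: "cell ` below j (n - j) \<subseteq> \<P>" and mj: "n - j + j = n" by auto
  have ups: "cell (True, int i, int j) \<in> \<P>" if "i < n - j" for i
    by (rule row[OF ih]) (use mj that in auto)
  have downs: "cell (False, int i, int j) \<in> \<P>" if "Suc i < n - j" for i
    by (rule gaps[OF ih]) (use mj that ups in auto)
  show ?case
  proof
    fix K assume "K \<in> cell ` below (Suc j) (n - Suc j)"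
    then obtain lb where lb: "lb \<in> below (Suc j) (n - Suc j)" "K = cell lb" by blast
    show "K \<in> \<P>"
    proof (cases lb rule: cell.cases)
      case (1 i' j')
      then have *: "0 \<le> i'" "i' + int j + 1 \<le> int n" "j' = int j" using lb by (auto simp: below_mem labels_mem)
      define i'' where "i'' = nat i'"
      have "i' = int i''" "i'' < n - j" using * by (auto simp: i''_def)
      then show ?thesis using ups * lb(2) 1 by simp
    next
      case (2 i' j')
      then have *: "0 \<le> i'" "i' + int j + 2 \<le> int n" "j' = int j" using lb by (auto simp: below_mem labels_mem)
      define i'' where "i'' = nat i'"
      have "i' = int i''" "Suc i'' < n - j" using * by (auto simp: i''_def)
      then show ?thesis using downs * lb(2) 2 by simp
    qed
  qed
qed

lemma cells_subset: "cell ` labels \<subseteq> \<P>"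
proof
  fix K assume "K \<in> cell ` labels"
  then obtain lb where lb: "lb \<in> labels" "K = cell lb" by blast
  obtain b i j where l: "lb = (b, i, j)" by (cases lb)
  have *: "0 \<le> i" "0 \<le> j" "i + j + (if b then 1 else 2) \<le> int n" using lb unfolding l labels_def by auto
  define j' where "j' = Suc (nat j)"
  have "lb \<in> below j' (n - j')" using * lb unfolding l below_def by (cases b) (auto simp: j'_def)
  moreover have "j' \<le> n" using * by (auto simp: j'_def split: if_splits)
  ultimately show "K \<in> \<P>" using rows lb by blast
qed

text \<open>The cells already exhaust the angle at every point, so a further tile would have angle 0
  at one of its own vertices.\<close>

lemma cells_eq: "\<P> = cell ` labels"
proof (rule ccontr)
  assume "\<P> \<noteq> cell ` labels"
  then obtain K where K: "K \<in> \<P>" "K \<notin> cell ` labels" using cells_subset by blast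
  obtain p q r where pqr: "K = convex hull {p, q, r}" "cross (q - p) (r - p) \<noteq> 0" using tile_obtain[OF K(1)] by metis
  have "p \<in> K" "dens K p = sector (q - p) (r - p)" using dens_vertex[OF pqr(2)] pqr(1) by (simp_all add: hull_inc)
  then have "0 < dens K p" using sector_pos[OF pqr(2)] by simp
  also have "dens K p \<le> (\<Sum>L\<in>\<P> - cell ` labels. dens L p)"
    using remainder_le[of "{K}" labels p] K by simp
  also have "\<dots> = dens T p - (\<Sum>L\<in>cell ` labels. dens L p)"
    using sum_diff[OF fin cells_subset, of "\<lambda>K. dens K p"] dens_sum by simp
  also have "(\<Sum>L\<in>cell ` labels. dens L p) = (\<Sum>l\<in>labels. dens (cell l) p)"
    using inj_cell by (simp add: sum.reindex inj_on_subset)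
  finally show False using sum_dens_cell by simp
qed

end

subsection \<open>Comparison with the grid subdivision\<close>

lemma division_points_mem:
  assumes "(P, Q) \<in> sides A B C" "k \<le> n"
  shows "P + (real k / real n) *\<^sub>R (Q - P) \<in> division_points n A B C"
  unfolding division_points_def using assms by (intro CollectI exI[of _ P] exI[of _ Q] exI[of _ k]) simp

context grid begin

lemma corner_shifts:
  "A - s *\<^sub>R e2 = G 0 (real n - s)" "B + s *\<^sub>R e1 = G s 0" "C + s *\<^sub>R (e2 - e1) = G (real n - s) s"
proof -
  have A: "G 0 (real n) = A" and C: "G (real n) 0 = C" using n_pos by (simp_all add: G_def e1_def e2_def)
  have "G 0 (real n - s) = G 0 (real n) - s *\<^sub>R e2" by (simp add: G_def algebra_simps)
  then show "A - s *\<^sub>R e2 = G 0 (real n - s)" unfolding A by simp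
  show "B + s *\<^sub>R e1 = G s 0" by (simp add: G_def)
  have "G (real n - s) s = G (real n) 0 + s *\<^sub>R (e2 - e1)" by (simp add: G_def algebra_simps)
  then show "C + s *\<^sub>R (e2 - e1) = G (real n - s) s" unfolding C by simp
qed

lemma corner_diffs: "B - A = - real n *\<^sub>R e2" "C - B = real n *\<^sub>R e1" "A - C = real n *\<^sub>R (e2 - e1)"
proof -
  have e: "real n *\<^sub>R e1 = C - B" "real n *\<^sub>R e2 = A - B" using n_pos by (simp_all add: e1_def e2_def)
  show "B - A = - real n *\<^sub>R e2" "C - B = real n *\<^sub>R e1" "A - C = real n *\<^sub>R (e2 - e1)"
    unfolding scaleR_minus_left scaleR_diff_right e by simp_all
qed

text \<open>With \<open>integer_grid_line\<close> this identifies the grid lines inside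
  \<open>T\<close> with the integral values of \<open>X\<close>, \<open>Y\<close> and
  \<open>X + Y\<close>.\<close>

lemma grid_line_integer:
  assumes "L \<in> grid_lines n A B C" "z \<in> L"
  shows "\<exists>i::int. X z = real_of_int i \<or> Y z = real_of_int i \<or> X z + Y z = real_of_int i"
proof -
  obtain p U V where p: "p \<in> division_points n A B C" and UV: "(U, V) \<in> sides A B C" and L: "L = line_through p (V - U)"
    using assms unfolding grid_lines_def by blast
  obtain t where z: "z = p + t *\<^sub>R (V - U)" using assms L by (auto simp: line_through_def)
  obtain P Q k where k: "(P, Q) \<in> sides A B C" "k \<le> n" "p = P + (real k / real n) *\<^sub>R (Q - P)"
    using p unfolding division_points_def by blast
  have "\<exists>i j::int. p = G (real_of_int i) (real_of_int j)"
  proof -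
    consider "P = A" "Q = B" | "P = B" "Q = C" | "P = C" "Q = A" using k(1) unfolding sides_def by auto
    then show ?thesis
    proof cases
      case 1
      have "p = A - real k *\<^sub>R e2" unfolding k(3) 1 corner_diffs using n_pos by simp
      then have "p = G (real_of_int 0) (real_of_int (int n - int k))" unfolding corner_shifts by simp
      then show ?thesis by blast
    next
      case 2
      have "p = B + real k *\<^sub>R e1" unfolding k(3) 2 corner_diffs using n_pos by simp
      then have "p = G (real_of_int (int k)) (real_of_int 0)" unfolding corner_shifts by simp
      then show ?thesis by blast
    next
      case 3
      have "p = C + real k *\<^sub>R (e2 - e1)" unfolding k(3) 3 corner_diffs using n_pos by simp
      then have "p = G (real_of_int (int n - int k)) (real_of_int (int k))" unfolding corner_shifts by simp
      then show ?thesis by blast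
    qed
  qed
  then obtain i j where ij: "p = G (real_of_int i) (real_of_int j)" by blast
  consider "V - U = - real n *\<^sub>R e2" | "V - U = real n *\<^sub>R e1" | "V - U = real n *\<^sub>R (e2 - e1)"
    using UV corner_diffs unfolding sides_def by auto
  then show ?thesis
  proof cases
    case 1
    have "z = G (real_of_int i) (real_of_int j - t * real n)" unfolding z ij 1 by (simp add: G_def algebra_simps)
    then show ?thesis by auto
  next
    case 2
    have "z = G (real_of_int i + t * real n) (real_of_int j)" unfolding z ij 2 by (simp add: G_def algebra_simps)
    then show ?thesis by auto
  next
    case 3
    have "z = G (real_of_int i - t * real n) (real_of_int j + t * real n)" unfolding z ij 3 by (simp add: G_def algebra_simps)
    then have "X z + Y z = real_of_int (i + j)" by simp
    then show ?thesis by blast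
  qed
qed

lemma integer_grid_line:
  assumes "z \<in> T" and i: "X z = real_of_int i \<or> Y z = real_of_int i \<or> X z + Y z = real_of_int i"
  shows "z \<in> \<Union>(grid_lines n A B C)"
proof -
  have T: "0 \<le> X z" "0 \<le> Y z" "X z + Y z \<le> real n" using assms(1) T_mem by auto
  have "0 \<le> real_of_int i" "real_of_int i \<le> real n" using i T by linarith+
  then have "0 \<le> i" "i \<le> int n" by linarith+
  then obtain k where k: "i = int k" "k \<le> n" by (metis nonneg_int_cases of_nat_le_iff)
  have pB: "G (real k) 0 \<in> division_points n A B C"
    using division_points_mem[of B C A B C k n] k n_pos unfolding corner_diffs
    by (simp add: sides_def G_def)
  have pA: "G 0 (real k) \<in> division_points n A B C"
  proof -
    have "A + (real (n - k) / real n) *\<^sub>R (B - A) \<in> division_points n A B C"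
      by (rule division_points_mem) (auto simp: sides_def)
    moreover have "A + (real (n - k) / real n) *\<^sub>R (B - A) = A - real (n - k) *\<^sub>R e2"
      unfolding corner_diffs using n_pos by simp
    then have "A + (real (n - k) / real n) *\<^sub>R (B - A) = G 0 (real k)"
      unfolding corner_shifts using k by (simp add: of_nat_diff)
    ultimately show ?thesis by simp
  qed
  have mem: "z \<in> \<Union>(grid_lines n A B C)"
    if "p \<in> division_points n A B C" "(U, V) \<in> sides A B C" "z = p + s *\<^sub>R (V - U)" for p U V s
    using that unfolding grid_lines_def line_through_def by blast
  have z: "z = G (X z) (Y z)" by (simp add: G_XY)
  from i consider "X z = real k" | "Y z = real k" | "X z + Y z = real k" using k by auto
  then show ?thesis
  proof cases
    case 1
    show ?thesis
    proof (rule mem[OF pB, of A B "- (Y z / real n)"])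
      show "z = G (real k) 0 + (- (Y z / real n)) *\<^sub>R (B - A)"
        unfolding corner_diffs using z 1 n_pos by (simp add: G_def)
    qed (simp add: sides_def)
  next
    case 2
    show ?thesis
    proof (rule mem[OF pA, of B C "X z / real n"])
      show "z = G 0 (real k) + (X z / real n) *\<^sub>R (C - B)"
        unfolding corner_diffs using z 2 n_pos by (simp add: G_def algebra_simps)
    qed (simp add: sides_def)
  next
    case 3
    show ?thesis
    proof (rule mem[OF pB, of C A "Y z / real n"])
      have "X z = real k - Y z" using 3 by simp
      moreover have "G (real k) 0 + (Y z / real n) *\<^sub>R (A - C) = G (real k - Y z) (Y z)"
        unfolding corner_diffs using n_pos by (simp add: G_def algebra_simps)
      ultimately show "z = G (real k) 0 + (Y z / real n) *\<^sub>R (A - C)" using G_XY by metis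
    qed (simp add: sides_def)
  qed
qed

lemma between:
  fixes i v :: int
  assumes "real_of_int i < x" "x < real_of_int (i + 1)"
  shows "x \<noteq> real_of_int v"
proof
  assume "x = real_of_int v"
  then have "i < v" "v < i + 1" using assms by (simp_all only: of_int_less_iff)
  then show False by simp
qed

lemma open_cells: "T - \<Union>(grid_lines n A B C) = \<Union>((\<lambda>l. interior (cell l)) ` labels)"
proof (intro equalityI subsetI)
  fix z assume z: "z \<in> T - \<Union>(grid_lines n A B C)"
  then obtain l where l: "l \<in> labels" "z \<in> cell l" using cell_cover by blast
  have ni: "X z \<noteq> real_of_int i" "Y z \<noteq> real_of_int i" "X z + Y z \<noteq> real_of_int i" for i
    using integer_grid_line z by blast+
  have "z \<in> interior (cell l)"
  proof (cases l rule: cell.cases)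
    case (1 i j)
    have "real_of_int i \<le> X z" "real_of_int j \<le> Y z" "X z + Y z \<le> real_of_int (i + j + 1)"
      using l(2) unfolding 1 cell_mem by auto
    then show ?thesis using ni(1)[of i] ni(2)[of j] ni(3)[of "i + j + 1"] unfolding 1 cell_interior_iff by linarith
  next
    case (2 i j)
    have "X z \<le> real_of_int (i + 1)" "Y z \<le> real_of_int (j + 1)" "real_of_int (i + j + 1) \<le> X z + Y z"
      using l(2) unfolding 2 cell_mem by auto
    then show ?thesis using ni(1)[of "i + 1"] ni(2)[of "j + 1"] ni(3)[of "i + j + 1"] unfolding 2 cell_interior_iff by simp
  qed
  then show "z \<in> \<Union>((\<lambda>l. interior (cell l)) ` labels)" using l by blast
next
  fix z assume "z \<in> \<Union>((\<lambda>l. interior (cell l)) ` labels)"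
  then obtain l where l: "l \<in> labels" "z \<in> interior (cell l)" by blast
  have "z \<in> T" using cell_subset_T[OF l(1)] interior_subset l(2) by blast
  moreover have "X z \<noteq> real_of_int v \<and> Y z \<noteq> real_of_int v \<and> X z + Y z \<noteq> real_of_int v" for v
  proof (cases l rule: cell.cases)
    case (1 i j)
    have *: "real_of_int i < X z" "real_of_int j < Y z" "X z + Y z < real_of_int (i + j + 1)"
      using l(2) unfolding 1 cell_interior_iff by auto
    have "X z < real_of_int (i + 1)" "Y z < real_of_int (j + 1)" "real_of_int (i + j) < X z + Y z" using * by simp_all
    with * show ?thesis using between by metis
  next
    case (2 i j)
    have *: "X z < real_of_int (i + 1)" "Y z < real_of_int (j + 1)" "real_of_int (i + j + 1) < X z + Y z"
      using l(2) unfolding 2 cell_interior_iff by auto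
    have "real_of_int i < X z" "real_of_int j < Y z" "X z + Y z < real_of_int (i + j + 1 + 1)" using * by simp_all
    with * show ?thesis using between by metis
  qed
  ultimately show "z \<in> T - \<Union>(grid_lines n A B C)" using grid_line_integer by blast
qed

text \<open>The interiors of the cells are open, connected and disjoint, hence they are the
  components; closing them returns the cells because these are closed and convex with nonempty
  interior.\<close>

lemma trivial: "\<P> = grid_subdivision n A B C"
proof -
  have "components (T - \<Union>(grid_lines n A B C)) = (\<lambda>l. interior (cell l)) ` labels"
  proof (rule components_open_unique)
    show "pairwise disjnt ((\<lambda>l. interior (cell l)) ` labels)"
    proof (rule pairwiseI)
      fix S S' assume "S \<in> (\<lambda>l. interior (cell l)) ` labels" "S' \<in> (\<lambda>l. interior (cell l)) ` labels" "S \<noteq> S'"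
      then obtain l l' where "S = interior (cell l)" "S' = interior (cell l')" "l \<noteq> l'" by blast
      then show "disjnt S S'" using cell_disjoint by (simp add: disjnt_def)
    qed
    show "\<Union>((\<lambda>l. interior (cell l)) ` labels) = T - \<Union>(grid_lines n A B C)" using open_cells by simp
    fix S assume "S \<in> (\<lambda>l. interior (cell l)) ` labels"
    then obtain l where "S = interior (cell l)" by blast
    then show "open S \<and> connected S \<and> S \<noteq> {}"
      using cell_interior_nonempty by (simp add: convex_connected convex_interior cell_convex)
  qed
  moreover have "closure (interior (cell l)) = cell l" for l
    using convex_closure_interior[OF cell_convex cell_interior_nonempty] cell_closed by (simp add: closure_closed)
  ultimately show ?thesis unfolding grid_subdivision_def cells_eq by (simp add: image_image)
qed

end

lemma grid_subdivision_rotate: "grid_subdivision n B C A = grid_subdivision n A B C"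
proof -
  have s: "sides B C A = sides A B C" unfolding sides_def by auto
  have "{B, C, A} = {A, B, C}" by auto
  then show ?thesis unfolding grid_subdivision_def grid_lines_def division_points_def s by simp
qed

text \<open>Sides reverse their direction: the division point with index \<open>k\<close> becomes
  the one with index \<open>n - k\<close>, and a line does not depend on the sign of its
  direction.\<close>

lemma grid_subdivision_swap:
  assumes "0 < n"
  shows "grid_subdivision n A C B = grid_subdivision n A B C"
proof -
  have d: "division_points n A C B \<subseteq> division_points n A B C" for A B C
  proof
    fix p assume "p \<in> division_points n A C B"
    then obtain P Q k where k: "(P, Q) \<in> sides A C B" "k \<le> n" "p = P + (real k / real n) *\<^sub>R (Q - P)"
      unfolding division_points_def by blast
    have "(Q, P) \<in> sides A B C" using k(1) unfolding sides_def by auto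
    then have "Q + (real (n - k) / real n) *\<^sub>R (P - Q) \<in> division_points n A B C"
      by (rule division_points_mem) simp
    moreover have "Q + (real (n - k) / real n) *\<^sub>R (P - Q) = p"
    proof -
      define x where "x = real k / real n"
      have "real (n - k) / real n = 1 - x" using k assms by (simp add: x_def of_nat_diff diff_divide_distrib)
      then have "Q + (real (n - k) / real n) *\<^sub>R (P - Q) = Q + (1 - x) *\<^sub>R (P - Q)" by (simp only:)
      also have "\<dots> = P + x *\<^sub>R (Q - P)" by (simp add: algebra_simps)
      finally show ?thesis unfolding k(3) x_def .
    qed
    ultimately show "p \<in> division_points n A B C" by simp
  qed
  have dp: "division_points n A C B = division_points n A B C" using d[of A C B] d[of A B C] by blast
  have lt: "line_through p (U - V) = line_through p (V - U)" for p U V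
  proof -
    have "line_through p (U - V) \<subseteq> line_through p (V - U)" for U V
    proof
      fix z assume "z \<in> line_through p (U - V)"
      then obtain t where "z = p + t *\<^sub>R (U - V)" by (auto simp: line_through_def)
      then have "z = p + (- t) *\<^sub>R (V - U)" by (simp add: algebra_simps)
      then show "z \<in> line_through p (V - U)" unfolding line_through_def by blast
    qed
    then show ?thesis by blast
  qed
  have gl: "grid_lines n A C B \<subseteq> grid_lines n A B C" if "division_points n A C B = division_points n A B C" for A B C
  proof
    fix L assume "L \<in> grid_lines n A C B"
    then obtain p U V where "p \<in> division_points n A C B" "(U, V) \<in> sides A C B" "L = line_through p (V - U)"
      unfolding grid_lines_def by blast
    moreover have "(V, U) \<in> sides A B C" using \<open>(U, V) \<in> sides A C B\<close> unfolding sides_def by auto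
    ultimately show "L \<in> grid_lines n A B C" unfolding grid_lines_def that using lt by blast
  qed
  have "grid_lines n A C B = grid_lines n A B C" using gl[OF dp] gl[OF dp[symmetric]] by blast
  moreover have "{A, C, B} = {A, B, C}" by auto
  ultimately show ?thesis unfolding grid_subdivision_def by simp
qed

section \<open>From reptilings to tilings with a scale factor\<close>

lemma similarity:
  fixes f :: "plane \<Rightarrow> plane"
  assumes k: "0 < k" and f: "\<And>x y. dist (f x) (f y) = k * dist x y"
  shows "f ` (convex hull S) = convex hull (f ` S)"
    "S \<in> lmeasurable \<Longrightarrow> measure lebesgue (f ` S) = k\<^sup>2 * measure lebesgue S"
proof -
  \<comment> \<open>After removal of scaling and translation, an isometry fixing 0 remains, which is
    orthogonal.\<close>
  define h where "h x = (1 / k) *\<^sub>R (f x - f 0)" for x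
  have "dist (h x) (h y) = dist x y" for x y
  proof -
    have "h x - h y = (1 / k) *\<^sub>R (f x - f y)" by (simp add: h_def algebra_simps)
    then show ?thesis using f[of x y] k by (simp add: dist_norm)
  qed
  then have o: "orthogonal_transformation h" unfolding orthogonal_transformation_isometry by (simp add: h_def)
  have fh: "f = (\<lambda>x. f 0 + x) \<circ> (\<lambda>x. k *\<^sub>R x) \<circ> h" using k by (auto simp: h_def)
  have "f ` (convex hull S) = (\<lambda>x. f 0 + x) ` (\<lambda>x. k *\<^sub>R x) ` h ` (convex hull S)"
    by (subst fh) (simp only: image_comp comp_assoc)
  also have "h ` (convex hull S) = convex hull (h ` S)"
    by (rule convex_hull_linear_image[OF orthogonal_transformation_linear[OF o]])
  also have "(\<lambda>x. f 0 + x) ` (\<lambda>x. k *\<^sub>R x) ` (convex hull (h ` S)) = convex hull ((\<lambda>x. f 0 + x) ` (\<lambda>x. k *\<^sub>R x) ` h ` S)"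
    by (simp only: convex_hull_scaling convex_hull_translation)
  also have "(\<lambda>x. f 0 + x) ` (\<lambda>x. k *\<^sub>R x) ` h ` S = f ` S"
    by (subst (2) fh) (simp only: image_comp comp_assoc)
  finally show "f ` (convex hull S) = convex hull (f ` S)" .
  assume S: "S \<in> lmeasurable"
  have "f ` S = (\<lambda>x. k *\<^sub>R x + f 0) ` h ` S" unfolding image_image using k by (simp add: h_def)
  then have "measure lebesgue (f ` S) = \<bar>k\<bar> ^ DIM(plane) * measure lebesgue (h ` S)"
    using measure_lebesgue_affine[of k "f 0" "h ` S"] by (simp add: add.commute)
  then show "measure lebesgue (f ` S) = k\<^sup>2 * measure lebesgue S"
    using measure_orthogonal_image[OF o S] by simp
qed

text \<open>Congruent tiles have equal areas, so the square of the similarity factor is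
  \<open>1 / r\<close>.\<close>

lemma reptiling_tiling:
  assumes nc: "\<not> collinear {A, B, C}" and rt: "reptiling r (convex hull {A, B, C}) \<P>"
  shows "tiling A B C \<P> (sqrt (real r))"
proof
  let ?T = "convex hull {A, B, C}"
  have r: "2 \<le> r" "finite \<P>" "card \<P> = r" "\<Union>\<P> = ?T" "\<And>K. K \<in> \<P> \<Longrightarrow> is_triangle K \<and> similar_sets ?T K"
    "\<And>K L. K \<in> \<P> \<Longrightarrow> L \<in> \<P> \<Longrightarrow> congruent_sets K L"
    "\<And>K L. K \<in> \<P> \<Longrightarrow> L \<in> \<P> \<Longrightarrow> K \<noteq> L \<Longrightarrow> interior K \<inter> interior L = {}"
    using rt unfolding reptiling_def by auto
  show ne: "cross (B - A) (C - A) \<noteq> 0" using nc collinear_cross by blast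
  show "0 < sqrt (real r)" "finite \<P>" "\<Union>\<P> = ?T" using r by auto
  show "\<And>K L. K \<in> \<P> \<Longrightarrow> L \<in> \<P> \<Longrightarrow> K \<noteq> L \<Longrightarrow> interior K \<inter> interior L = {}" using r by blast
  have lm: "?T \<in> lmeasurable" by (intro measurable_convex) (simp_all add: bounded_convex_hull)
  have "interior ?T \<noteq> {}" using interior_triI[OF ne, of "1/3" "1/3"] by auto
  then have "\<not> negligible ?T" by (simp add: negligible_convex_interior)
  then have posT: "0 < measure lebesgue ?T" using lm by (simp add: negligible_iff_measure zero_less_measure_iff)
  have sim: "\<exists>f k. 0 < k \<and> (\<forall>x y. dist (f x) (f y) = k * dist x y) \<and> f ` ?T = K" if "K \<in> \<P>" for K
    using r(5)[OF that] unfolding similar_sets_def by blast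
  have cl: "K \<in> lmeasurable \<and> convex K" if KP: "K \<in> \<P>" for K
  proof -
    obtain A' B' C' where "K = convex hull {A', B', C'}" using r(5)[OF KP] unfolding is_triangle_def by blast
    then show ?thesis by (simp add: measurable_convex bounded_convex_hull)
  qed
  have eqm: "measure lebesgue K = measure lebesgue L" if KL: "K \<in> \<P>" "L \<in> \<P>" for K L
  proof -
    obtain g where g: "\<forall>x y. dist (g x) (g y) = dist x y" "g ` K = L" using r(6)[OF KL] unfolding congruent_sets_def by blast
    show ?thesis using similarity(2)[of 1 g K] g cl[OF KL(1)] by simp
  qed
  have "(\<Sum>K\<in>\<P>. measure lebesgue K) = measure lebesgue (\<Union>\<P>)"
  proof (rule measure_negligible_finite_Union[symmetric])
    show "pairwise (\<lambda>S T. negligible (S \<inter> T)) \<P>"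
    proof (rule pairwiseI)
      fix K L assume KL: "K \<in> \<P>" "L \<in> \<P>" "K \<noteq> L"
      then have "interior (K \<inter> L) = {}" using r(7) by simp
      moreover have "convex (K \<inter> L)" using cl KL by (simp add: convex_Int)
      ultimately show "negligible (K \<inter> L)" by (simp add: negligible_convex_interior)
    qed
  qed (use r cl in auto)
  then have sum: "(\<Sum>K\<in>\<P>. measure lebesgue K) = measure lebesgue ?T" using r by simp
  fix K assume K: "K \<in> \<P>"
  obtain f k where f: "0 < k" "\<forall>x y. dist (f x) (f y) = k * dist x y" "f ` ?T = K" using sim[OF K] by blast
  have "(\<Sum>L\<in>\<P>. measure lebesgue L) = (\<Sum>L\<in>\<P>. measure lebesgue K)" by (rule sum.cong[OF refl]) (rule eqm[OF _ K])
  then have "real r * measure lebesgue K = measure lebesgue ?T" using sum r by simp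
  moreover have "measure lebesgue K = k\<^sup>2 * measure lebesgue ?T" using similarity(2)[OF f(1), of f ?T] f lm by auto
  ultimately have "real r * k\<^sup>2 = 1" using posT by (simp add: field_simps)
  then have "(sqrt (real r) * k)\<^sup>2 = 1" by (simp add: power_mult_distrib)
  moreover have "0 \<le> sqrt (real r) * k" using f by simp
  ultimately have "sqrt (real r) * k = 1" by (simp add: power2_eq_1_iff)
  then have kk: "k * x = x / sqrt (real r)" for x using r by (simp add: field_simps)
  have "K = convex hull {f A, f B, f C}" using similarity(1)[OF f(1), of f "{A, B, C}"] f by simp
  then show "\<exists>p q r'. K = convex hull {p, q, r'} \<and> dist q r' = dist B C / sqrt (real r) \<and>
      dist r' p = dist C A / sqrt (real r) \<and> dist p q = dist A B / sqrt (real r)"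
    using f kk by (intro exI[of _ "f A"] exI[of _ "f B"] exI[of _ "f C"]) simp
qed

section \<open>Pure sides from irrational ratios\<close>

context tiling begin

text \<open>Scaling by \<open>t\<close> does not change ratios, so this is the hypothesis on
  \<open>T\<close> read on a tile.\<close>

definition ratios :: bool where
  "ratios \<longleftrightarrow> (\<forall>x\<in>{a, b, c}. \<forall>y\<in>{a, b, c}. y / x \<in> \<rat> \<longrightarrow> y = x)"

lemma rational_ratio:
  assumes "ratios" "x \<in> {a, b, c}" "y \<in> {a, b, c}" "x \<noteq> y" "real k * x = real l * x + real m * y"
  shows "m = 0"
proof (rule ccontr)
  assume m: "m \<noteq> 0"
  have x: "x > 0" using assms sides_pos by auto
  have "real m * y = (real k - real l) * x" using assms by (simp add: algebra_simps)
  then have "y / x = (real k - real l) / real m" using m x by (simp add: field_simps)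
  then have "y / x \<in> \<rat>" by simp
  then show False using assms(1)[unfolded ratios_def, rule_format, OF assms(2,3)] assms(4) by simp
qed

text \<open>At most two different lengths occur, so a relation that really involved the other one
  would make their ratio rational.\<close>

lemma pure_isosceles:
  assumes R: ratios and "a = b \<or> b = c \<or> c = a" and e: "e \<in> {a, b, c}"
  shows "pure e"
proof -
  have two: "m = 0" if "real k * e = real l * e + real m * y" "y \<in> {a, b, c}" "y \<noteq> e" for k l m y
    using rational_ratio[OF R e that(2) _ that(1)] that(3) by blast
  show ?thesis unfolding pure_def
  proof (intro allI impI)
    fix k p q s assume eq: "real k * e = real p * a + real q * b + real s * c"
    have aux: "real (x + y) * z = real x * z + real y * z" for x y z by (simp add: algebra_simps)
    consider "a = e" "b = e" | "a = e" "c = e" | "b = e" "c = e" | "a = e" "b = c" | "b = e" "a = c" | "c = e" "a = b"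
      using assms(2) e by (simp only: insert_iff empty_iff) metis
    then show "(a \<noteq> e \<longrightarrow> p = 0) \<and> (b \<noteq> e \<longrightarrow> q = 0) \<and> (c \<noteq> e \<longrightarrow> s = 0)"
    proof cases
      case 1 then show ?thesis using two[of k "p + q" s c] eq aux by simp
    next
      case 2 then show ?thesis using two[of k "p + s" q b] eq aux by simp
    next
      case 3 then show ?thesis using two[of k "q + s" p a] eq aux by simp
    next
      case 4 then show ?thesis using two[of k p "q + s" b] eq aux by simp
    next
      case 5 then show ?thesis using two[of k q "p + s" a] eq aux by simp
    next
      case 6 then show ?thesis using two[of k s "p + q" a] eq aux by simp
    qed
  qed
qed

text \<open>Two relations witnessing that \<open>a\<close> and \<open>b\<close> are not pure would, after elimination of \<open>c\<close>,
  make \<open>b / a\<close> rational.\<close>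
lemma pure_scalene:
  assumes R: ratios and ne: "a \<noteq> b" "b \<noteq> c" "c \<noteq> a"
  shows "pure a \<or> pure b"
proof (rule ccontr)
  assume "\<not> (pure a \<or> pure b)"
  then have np: "\<not> pure a" "\<not> pure b" by auto
  obtain k p q s where e: "real k * a = real p * a + real q * b + real s * c"
    "\<not> ((a \<noteq> a \<longrightarrow> p = 0) \<and> (b \<noteq> a \<longrightarrow> q = 0) \<and> (c \<noteq> a \<longrightarrow> s = 0))"
    using np(1) unfolding pure_def not_all not_imp by (elim exE conjE)
  obtain l p' q' s' where e': "real l * b = real p' * a + real q' * b + real s' * c"
    "\<not> ((a \<noteq> b \<longrightarrow> p' = 0) \<and> (b \<noteq> b \<longrightarrow> q' = 0) \<and> (c \<noteq> b \<longrightarrow> s' = 0))"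
    using np(2) unfolding pure_def not_all not_imp by (elim exE conjE)
  \<comment> \<open>If one of the mixed coefficients vanishes, a relation between only two sides is
    left and \<open>rational_ratio\<close> applies.\<close>
  have "q \<noteq> 0"
  proof
    assume 0: "q = 0"
    then have "real k * a = real p * a + real s * c" using e by simp
    from rational_ratio[OF R _ _ _ this] have "s = 0" using ne by simp
    then show False using e 0 by simp
  qed
  moreover have "s \<noteq> 0"
  proof
    assume 0: "s = 0"
    then have "real k * a = real p * a + real q * b" using e by simp
    from rational_ratio[OF R _ _ _ this] have "q = 0" using ne by simp
    then show False using e 0 by simp
  qed
  moreover have "p' \<noteq> 0"
  proof
    assume 0: "p' = 0"
    then have "real l * b = real q' * b + real s' * c" using e' by simp
    from rational_ratio[OF R _ _ _ this] have "s' = 0" using ne by simp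
    then show False using e' 0 by simp
  qed
  moreover have "s' \<noteq> 0"
  proof
    assume 0: "s' = 0"
    then have "real l * b = real q' * b + real p' * a" using e' by simp
    from rational_ratio[OF R _ _ _ this] have "p' = 0" using ne by simp
    then show False using e' 0 by simp
  qed
  ultimately have pos: "0 < real q" "0 < real s" "0 < real p'" "0 < real s'" by auto
  have "(real k - real p) * a = real q * b + real s * c" using e by (simp add: algebra_simps)
  also have "\<dots> > 0" using pos sides_pos by (simp add: add_pos_pos)
  finally have kp: "0 < real k - real p" using sides_pos by (simp add: zero_less_mult_iff)
  \<comment> \<open>Elimination of \<open>c\<close>; the positive coefficients found above keep the
    resulting relation between \<open>a\<close> and \<open>b\<close> nontrivial.\<close>
  have "real s' * (real k * a - real p * a - real q * b) = real s * (real l * b - real p' * a - real q' * b)"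
    using e(1) e'(1) by (simp add: algebra_simps)
  then have eq: "(real s' * (real k - real p) + real s * real p') * a = (real s * (real l - real q') + real s' * real q) * b"
    by (simp add: algebra_simps)
  have den: "0 < real s' * (real k - real p) + real s * real p'" using pos kp by (simp add: add_pos_pos)
  then have "0 < (real s * (real l - real q') + real s' * real q) * b" unfolding eq[symmetric] using sides_pos by simp
  then have nz: "real s * (real l - real q') + real s' * real q \<noteq> 0" by auto
  have "b / a = (real s' * (real k - real p) + real s * real p') / (real s * (real l - real q') + real s' * real q)"
    using eq nz sides_pos by (simp add: field_simps)
  then have "b / a \<in> \<rat>" by simp
  then show False using R[unfolded ratios_def, rule_format, of a b] ne by simp
qed

end

subsection \<open>Choice of the base\<close>

context tiling begin

lemma gridI:
  assumes n: "t = real n" and "pure a" "pure b"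
    and "\<And>i j k m. \<gamma> < \<beta> \<Longrightarrow> 2 * \<beta> + real i * \<alpha> + real j * \<beta> + real k * \<gamma> + real m * straight \<noteq> straight"
    and "\<And>i j k m. \<beta> < \<gamma> \<Longrightarrow> 2 * \<gamma> + real i * \<alpha> + real j * \<beta> + real k * \<gamma> + real m * straight \<noteq> straight"
    and "\<And>i j k m. a \<noteq> c \<Longrightarrow> \<alpha> \<noteq> \<gamma> + real i * \<alpha> + real j * \<beta> + real k * \<gamma> + real m * straight"
  shows "grid A B C \<P> n"
  by (intro grid.intro grid_axioms.intro; (unfold n[symmetric])?) (use assms tiling_axioms in blast)+

lemma rotate_eqs:
  "tiling.a C A t = b" "tiling.b B A t = c" "tiling.c B C t = a"
  "tiling.\<alpha> B C A = \<beta>" "tiling.\<beta> B C A = \<gamma>" "tiling.\<gamma> B C A = \<alpha>"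
proof -
  interpret r: tiling B C A \<P> t by (rule tiling_rotate)
  show "r.a = b" "r.b = c" "r.c = a" "r.\<alpha> = \<beta>" "r.\<beta> = \<gamma>" "r.\<gamma> = \<alpha>"
    unfolding r.a_def r.b_def r.c_def r.\<alpha>_def r.\<beta>_def r.\<gamma>_def a_def b_def c_def \<alpha>_def \<beta>_def \<gamma>_def
    by (simp_all add: sector_commute)
qed

lemma rotate_pure: "tiling.pure B C A t e = pure e"
proof -
  interpret r: tiling B C A \<P> t by (rule tiling_rotate)
  show ?thesis
  proof
    assume p: "r.pure e"
    show "pure e" unfolding pure_def
    proof (intro allI impI)
      fix k p q s assume "real k * e = real p * a + real q * b + real s * c"
      then have "real k * e = real q * b + real s * c + real p * a" by simp
      with p show "(a \<noteq> e \<longrightarrow> p = 0) \<and> (b \<noteq> e \<longrightarrow> q = 0) \<and> (c \<noteq> e \<longrightarrow> s = 0)"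
        unfolding r.pure_def rotate_eqs by blast
    qed
  next
    assume p: "pure e"
    show "r.pure e" unfolding r.pure_def rotate_eqs
    proof (intro allI impI)
      fix k p q s assume "real k * e = real p * b + real q * c + real s * a"
      then have "real k * e = real s * a + real p * b + real q * c" by simp
      with p show "(b \<noteq> e \<longrightarrow> p = 0) \<and> (c \<noteq> e \<longrightarrow> q = 0) \<and> (a \<noteq> e \<longrightarrow> s = 0)"
        unfolding pure_def by blast
    qed
  qed
qed

text \<open>An angle larger than what remains after \<open>y\<close> cannot occur in the
  sum.\<close>

lemma combination_less:
  assumes "x = y + real i * \<alpha> + real j * \<beta> + real k * \<gamma> + real m * straight"
  shows "x - y < \<alpha> \<Longrightarrow> i = 0" "x - y < \<beta> \<Longrightarrow> j = 0" "x - y < \<gamma> \<Longrightarrow> k = 0" "x - y < straight \<Longrightarrow> m = 0"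
proof -
  have nn: "0 \<le> real i * \<alpha>" "0 \<le> real j * \<beta>" "0 \<le> real k * \<gamma>" "0 \<le> real m * straight"
    using angles_pos angle_sum by simp_all
  have ge: "real x * y \<ge> y" if "x \<noteq> 0" "y > 0" for x y
    using that by (simp add: mult_le_cancel_right1)
  show "x - y < \<alpha> \<Longrightarrow> i = 0" using ge[of i \<alpha>] angles_pos(1) nn assms by linarith
  show "x - y < \<beta> \<Longrightarrow> j = 0" using ge[of j \<beta>] angles_pos(2) nn assms by linarith
  show "x - y < \<gamma> \<Longrightarrow> k = 0" using ge[of k \<gamma>] angles_pos(3) nn assms by linarith
  show "x - y < straight \<Longrightarrow> m = 0" using ge[of m straight] straight_pos nn assms by linarith
qed

text \<open>With \<open>\<alpha>\<close> smallest, the gap angle has room for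
  \<open>\<gamma>\<close> only if both are equal, that is, if \<open>a = c\<close>.\<close>

lemma trivial_smallest:
  assumes t: "t\<^sup>2 = real r" and pure: "pure a" "pure b" and le: "\<alpha> \<le> \<beta>" "\<alpha> \<le> \<gamma>"
    and nr: "2 * \<beta> \<noteq> straight" "2 * \<gamma> \<noteq> straight"
  shows "\<exists>n\<ge>1. \<P> = grid_subdivision n A B C"
proof -
  obtain n where n: "t = real n" using t_integer_smallest[OF pure(1) t le nr] by blast
  interpret sw: tiling A C B \<P> t by (rule tiling_swap)
  have "grid A B C \<P> n"
  proof (rule gridI[OF n pure])
    fix i j k m
    show "2 * \<beta> + real i * \<alpha> + real j * \<beta> + real k * \<gamma> + real m * straight \<noteq> straight" if "\<gamma> < \<beta>"
      by (rule no_double) (use that le nr in auto)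
    show "2 * \<gamma> + real i * \<alpha> + real j * \<beta> + real k * \<gamma> + real m * straight \<noteq> straight" if "\<beta> < \<gamma>"
      using sw.no_double[unfolded swap_eqs, of i k j m] that le nr by (simp add: algebra_simps)
    show "\<alpha> \<noteq> \<gamma> + real i * \<alpha> + real j * \<beta> + real k * \<gamma> + real m * straight" if "a \<noteq> c"
    proof
      assume eq: "\<alpha> = \<gamma> + real i * \<alpha> + real j * \<beta> + real k * \<gamma> + real m * straight"
      have "i = 0" "j = 0" "k = 0" "m = 0"
        using combination_less[OF eq] angles_pos angle_sum le by linarith+
      then have "\<alpha> = \<gamma>" using eq by simp
      then show False using that angle_eq_iff by simp
    qed
  qed
  then interpret g: grid A B C \<P> n .
  show ?thesis using g.trivial g.n_pos by (intro exI[of _ n]) simp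
qed

text \<open>Here the side \<open>c\<close> opposite to the smallest angle is not known to be pure.
  With base \<open>BC\<close>, the gap angle \<open>\<alpha>\<close> can start with
  \<open>\<gamma>\<close> only if it is a multiple of \<open>\<gamma>\<close>; in that case
  acuteness makes \<open>CA\<close> a suitable base.\<close>

lemma trivial_acute:
  assumes t: "t\<^sup>2 = real r" and pure: "pure a" "pure b" and lt: "\<gamma> < \<alpha>" "\<alpha> < \<beta>" and ac: "2 * \<beta> < straight"
  shows "\<exists>n\<ge>1. \<P> = grid_subdivision n A B C"
proof -
  obtain n where n: "t = real n" using t_integer_acute[OF pure t lt] ac by auto
  have n0: "0 < n" using n t_pos by simp
  show ?thesis
  proof (cases "\<exists>k. \<alpha> = real k * \<gamma>")
    case False
    have "grid A B C \<P> n"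
    proof (rule gridI[OF n pure])
      fix i j k m
      show "2 * \<beta> + real i * \<alpha> + real j * \<beta> + real k * \<gamma> + real m * straight \<noteq> straight" if "\<gamma> < \<beta>"
        by (rule no_double) (use lt ac in auto)
      show "2 * \<gamma> + real i * \<alpha> + real j * \<beta> + real k * \<gamma> + real m * straight \<noteq> straight" if "\<beta> < \<gamma>"
        using that lt by simp
      show "\<alpha> \<noteq> \<gamma> + real i * \<alpha> + real j * \<beta> + real k * \<gamma> + real m * straight" if "a \<noteq> c"
      proof
        assume eq: "\<alpha> = \<gamma> + real i * \<alpha> + real j * \<beta> + real k * \<gamma> + real m * straight"
        have "i = 0" "j = 0" "m = 0"
          using combination_less[OF eq] angles_pos angle_sum lt by linarith+
        then have "\<alpha> = real (Suc k) * \<gamma>" using eq by (simp add: algebra_simps)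
        then show False using False by blast
      qed
    qed
    then interpret g: grid A B C \<P> n .
    show ?thesis using g.trivial n0 by (intro exI[of _ n]) simp
  next
    case True
    then obtain x where x: "\<alpha> = real x * \<gamma>" by blast
    txt \<open>Then \<open>\<beta>\<close> lies strictly between \<open>x \<gamma>\<close> and \<open>(x + 1) \<gamma>\<close>, so \<open>CA\<close> is a suitable base.\<close>
    have nm: "\<beta> \<noteq> real_of_int z * \<gamma>" for z
    proof
      assume z: "\<beta> = real_of_int z * \<gamma>"
      \<comment> \<open>As the three angles add up to \<open>straight\<close>, acuteness at
        \<open>B\<close> means \<open>\<beta> < \<alpha> + \<gamma>\<close>.\<close>
      have "\<beta> < (real x + 1) * \<gamma>" using ac angle_sum x by (simp add: algebra_simps)
      then have "real_of_int z < real x + 1" unfolding z using angles_pos by simp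
      moreover have "real x < real_of_int z" using lt(2) unfolding x z using angles_pos by simp
      ultimately have "real_of_int z < real_of_int (int x + 1)" "real_of_int (int x) < real_of_int z" by simp_all
      then show False by (simp only: of_int_less_iff)
    qed
    interpret r: tiling B C A \<P> t by (rule tiling_rotate)
    \<comment> \<open>The order \<open>B, A, C\<close> exchanges \<open>a\<close> with
      \<open>b\<close> and \<open>\<alpha>\<close> with \<open>\<beta>\<close>, and keeps
      \<open>c\<close> and \<open>\<gamma>\<close>.\<close>
    interpret tw: tiling B A C \<P> t by (rule r.tiling_swap)
    have e: "tw.a = b" "tw.b = a" "tw.c = c" "tw.\<alpha> = \<beta>" "tw.\<beta> = \<alpha>" "tw.\<gamma> = \<gamma>" "\<And>e. tw.pure e = pure e"
      using r.swap_eqs rotate_eqs r.swap_pure rotate_pure by auto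
    have "grid B A C \<P> n"
    proof (rule tw.gridI[unfolded e, OF n pure(2,1)])
      fix i j k m
      show "2 * \<alpha> + real i * \<beta> + real j * \<alpha> + real k * \<gamma> + real m * straight \<noteq> straight" if "\<gamma> < \<alpha>"
      proof
        assume "2 * \<alpha> + real i * \<beta> + real j * \<alpha> + real k * \<gamma> + real m * straight = straight"
        then have eq: "straight = 2 * \<alpha> + real j * \<alpha> + real i * \<beta> + real k * \<gamma> + real m * straight" by simp
        have "i = 0" "m = 0"
          using combination_less[OF eq] angles_pos angle_sum lt by linarith+
        then have "\<beta> = \<alpha> + real j * \<alpha> + real k * \<gamma> - \<gamma>" using eq angle_sum by simp
        also have "\<dots> = real_of_int (int x + int j * int x + int k - 1) * \<gamma>" unfolding x by (simp add: algebra_simps)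
        finally show False using nm by blast
      qed
      show "2 * \<gamma> + real i * \<beta> + real j * \<alpha> + real k * \<gamma> + real m * straight \<noteq> straight" if "\<alpha> < \<gamma>"
        using that lt by simp
      show "\<beta> \<noteq> \<gamma> + real i * \<beta> + real j * \<alpha> + real k * \<gamma> + real m * straight" if "b \<noteq> c"
      proof
        assume "\<beta> = \<gamma> + real i * \<beta> + real j * \<alpha> + real k * \<gamma> + real m * straight"
        then have eq: "\<beta> = \<gamma> + real j * \<alpha> + real i * \<beta> + real k * \<gamma> + real m * straight" by simp
        have "i = 0" "m = 0"
          using combination_less[OF eq] angles_pos angle_sum lt by linarith+
        then have "\<beta> = \<gamma> + real j * \<alpha> + real k * \<gamma>" using eq by simp
        also have "\<dots> = real_of_int (1 + int j * int x + int k) * \<gamma>" unfolding x by (simp add: algebra_simps)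
        finally show False using nm by blast
      qed
    qed
    then interpret g: grid B A C \<P> n .
    have "grid_subdivision n B A C = grid_subdivision n A B C"
      using grid_subdivision_swap[OF n0, of B C A] grid_subdivision_rotate[of n B C A] by simp
    then show ?thesis using g.trivial n0 by (intro exI[of _ n]) simp
  qed
qed

text \<open>The hypotheses of the theorem in a form invariant under renaming the corners, so that
  the sides may be assumed sorted.\<close>

definition admissible :: bool where
  "admissible \<longleftrightarrow> ratios \<and> 2 * \<alpha> \<noteq> straight \<and> 2 * \<beta> \<noteq> straight \<and> 2 * \<gamma> \<noteq> straight \<and>
     ((a = b \<or> b = c \<or> c = a) \<or> (2 * \<alpha> < straight \<and> 2 * \<beta> < straight \<and> 2 * \<gamma> < straight))"

lemma swap_admissible: "tiling.admissible A C B t = admissible"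
proof -
  interpret sw: tiling A C B \<P> t by (rule tiling_swap)
  have s: "{a, c, b} = {a, b, c}" by (simp add: insert_commute)
  have iso: "(a = c \<or> c = b \<or> b = a) = (a = b \<or> b = c \<or> c = a)" by metis
  show ?thesis unfolding sw.admissible_def admissible_def sw.ratios_def ratios_def swap_eqs s iso by blast
qed

lemma rotate_admissible: "tiling.admissible B C A t = admissible"
proof -
  interpret r: tiling B C A \<P> t by (rule tiling_rotate)
  have s: "{b, c, a} = {a, b, c}" by (simp add: insert_commute)
  have iso: "(b = c \<or> c = a \<or> a = b) = (a = b \<or> b = c \<or> c = a)" by metis
  show ?thesis unfolding r.admissible_def admissible_def r.ratios_def ratios_def rotate_eqs s iso by blast
qed

text \<open>In the scalene case two sides are pure. If the shortest side is one of them it becomes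
  the base; otherwise the acute argument applies to the two longer sides.\<close>

lemma trivial_sorted:
  assumes t: "t\<^sup>2 = real r" and adm: admissible and le: "a \<le> b" "b \<le> c"
  shows "\<exists>n\<ge>1. \<P> = grid_subdivision n A B C"
proof -
  have R: ratios and nr: "2 * \<beta> \<noteq> straight" "2 * \<gamma> \<noteq> straight" using adm unfolding admissible_def by auto
  have ale: "\<alpha> \<le> \<beta>" "\<alpha> \<le> \<gamma>" using le angle_less angle_eq by (metis less_eq_real_def order.trans)+
  show ?thesis
  proof (cases "a = b \<or> b = c \<or> c = a")
    case True
    then show ?thesis using trivial_smallest[OF t _ _ ale nr] pure_isosceles[OF R True] by blast
  next
    case False
    then have lt: "\<alpha> < \<beta>" "\<beta> < \<gamma>" using le angle_less by auto
    have ac: "2 * \<gamma> < straight" using adm False unfolding admissible_def by auto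
    interpret r: tiling B C A \<P> t by (rule tiling_rotate)
    interpret rr: tiling C A B \<P> t by (rule r.tiling_rotate)
    interpret sw: tiling A C B \<P> t by (rule tiling_swap)
    have rR: r.ratios using adm unfolding rotate_admissible[symmetric] r.admissible_def by blast
    have rrR: rr.ratios using adm unfolding rotate_admissible[symmetric] r.rotate_admissible[symmetric] rr.admissible_def by blast
    have 1: "pure a \<or> pure b" using pure_scalene[OF R] False by auto
    have 2: "pure b \<or> pure c" using r.pure_scalene[OF rR] False unfolding rotate_eqs rotate_pure by auto
    have 3: "pure c \<or> pure a" using rr.pure_scalene[OF rrR] False unfolding r.rotate_eqs r.rotate_pure rotate_eqs rotate_pure by auto
    consider "pure a" "pure b" | "pure a" "pure c" | "pure b" "pure c" using 1 2 3 by blast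
    then show ?thesis
    proof cases
      case 1
      then show ?thesis using trivial_smallest[OF t _ _ ale nr] by blast
    next
      case 2
      then have "\<exists>n\<ge>1. \<P> = grid_subdivision n A C B"
        using sw.trivial_smallest[OF t] unfolding swap_eqs swap_pure using ale nr by blast
      then show ?thesis using grid_subdivision_swap by (metis less_eq_Suc_le One_nat_def)
    next
      case 3
      then have "\<exists>n\<ge>1. \<P> = grid_subdivision n B C A"
        using r.trivial_acute[OF t] unfolding rotate_eqs rotate_pure using lt ac by blast
      then show ?thesis unfolding grid_subdivision_rotate[of _ B C A] .
    qed
  qed
qed

lemma trivial_smallest_side:
  assumes t: "t\<^sup>2 = real r" and adm: admissible and le: "a \<le> b" "a \<le> c"
  shows "\<exists>n\<ge>1. \<P> = grid_subdivision n A B C"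
proof (cases "b \<le> c")
  case True
  then show ?thesis using trivial_sorted[OF t adm le(1)] by blast
next
  case False
  interpret sw: tiling A C B \<P> t by (rule tiling_swap)
  have "\<exists>n\<ge>1. \<P> = grid_subdivision n A C B"
    using sw.trivial_sorted[OF t] False le adm unfolding swap_eqs swap_admissible by simp
  then show ?thesis using grid_subdivision_swap by (metis less_eq_Suc_le One_nat_def)
qed

lemma trivial_admissible:
  assumes t: "t\<^sup>2 = real r" and adm: admissible
  shows "\<exists>n\<ge>1. \<P> = grid_subdivision n A B C"
proof -
  interpret r: tiling B C A \<P> t by (rule tiling_rotate)
  interpret rr: tiling C A B \<P> t by (rule r.tiling_rotate)
  have ra: r.admissible and rra: rr.admissible using adm rotate_admissible r.rotate_admissible by auto
  consider "a \<le> b" "a \<le> c" | "b \<le> c" "b \<le> a" | "c \<le> a" "c \<le> b" by linarith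
  then show ?thesis
  proof cases
    case 1
    then show ?thesis using trivial_smallest_side[OF t adm] by blast
  next
    case 2
    then have "\<exists>n\<ge>1. \<P> = grid_subdivision n B C A"
      using r.trivial_smallest_side[OF t ra] unfolding rotate_eqs by blast
    then show ?thesis unfolding grid_subdivision_rotate[of _ B C A] .
  next
    case 3
    then have "\<exists>n\<ge>1. \<P> = grid_subdivision n C A B"
      using rr.trivial_smallest_side[OF t rra] unfolding r.rotate_eqs rotate_eqs by blast
    then show ?thesis unfolding grid_subdivision_rotate[of _ C A B] grid_subdivision_rotate[of _ B C A] .
  qed
qed

end

text \<open>The bridge from \<open>arccos\<close> to areas: both notions are compared with a right
  angle through the sign of the inner product.\<close>

lemma angle_at_sector:
  assumes "cross (P - V) (Q - V) \<noteq> 0"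
  shows "angle_at V P Q < pi / 2 \<Longrightarrow> 2 * sector (P - V) (Q - V) < straight"
    "angle_at V P Q \<noteq> pi / 2 \<Longrightarrow> 2 * sector (P - V) (Q - V) \<noteq> straight"
proof -
  define x where "x = ((P - V) \<bullet> (Q - V)) / (norm (P - V) * norm (Q - V))"
  have nz: "0 < norm (P - V) * norm (Q - V)" using cross_nonzero_imp[OF assms] by (intro mult_pos_pos) simp_all
  have "\<bar>x\<bar> \<le> 1" unfolding x_def using Cauchy_Schwarz_ineq2[of "P - V" "Q - V"] nz by simp
  moreover have "angle_at V P Q = arccos x" by (simp add: angle_at_def x_def)
  moreover have "arccos 0 = pi / 2" by (rule arccos_0)
  ultimately have *: "angle_at V P Q < pi / 2 \<longleftrightarrow> 0 < x" "x = 0 \<Longrightarrow> angle_at V P Q = pi / 2"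
    using arccos_less_mono[of x 0] by auto
  have x0: "0 < x \<longleftrightarrow> 0 < (P - V) \<bullet> (Q - V)" "x = 0 \<longleftrightarrow> (P - V) \<bullet> (Q - V) = 0"
    unfolding x_def using nz by (auto simp: zero_less_divide_iff)
  show "angle_at V P Q < pi / 2 \<Longrightarrow> 2 * sector (P - V) (Q - V) < straight"
    using sector_acute(2)[OF assms] * x0 by blast
  show "angle_at V P Q \<noteq> pi / 2 \<Longrightarrow> 2 * sector (P - V) (Q - V) \<noteq> straight"
    using sector_acute(2,3)[OF assms] * x0 by (metis less_irrefl linorder_neqE_linordered_idom)
qed

theorem theorem5:
  fixes A B C :: plane
  assumes "\<not> collinear {A, B, C}"
    and "\<not> (\<exists>a\<in>side_lengths A B C. \<exists>b\<in>side_lengths A B C. b / a \<in> \<rat> \<and> b / a \<noteq> 1)"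
    and "acute_triangle A B C \<or> (isosceles_triangle A B C \<and> oblique_triangle A B C)"
  shows "\<forall>r \<P>. reptiling r (convex hull {A, B, C}) \<P> \<longrightarrow> trivial_reptiling A B C \<P>"
proof (intro allI impI)
  fix r \<P> assume rt: "reptiling r (convex hull {A, B, C}) \<P>"
  interpret tiling A B C \<P> "sqrt (real r)" by (rule reptiling_tiling[OF assms(1) rt])
  note n = cross_rotate_ne[OF tri]
  have obl: "2 * \<alpha> \<noteq> straight \<and> 2 * \<beta> \<noteq> straight \<and> 2 * \<gamma> \<noteq> straight"
  proof -
    have "angle_at A B C \<noteq> pi / 2 \<and> angle_at B C A \<noteq> pi / 2 \<and> angle_at C A B \<noteq> pi / 2"
      using assms(3) unfolding acute_triangle_def oblique_triangle_def right_triangle_def triangle_angles_def by auto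
    then show ?thesis unfolding \<alpha>_def \<beta>_def \<gamma>_def
      using angle_at_sector(2)[OF tri] angle_at_sector(2)[OF n(1)] angle_at_sector(2)[OF n(2)] by blast
  qed
  have ac: "2 * \<alpha> < straight \<and> 2 * \<beta> < straight \<and> 2 * \<gamma> < straight" if "acute_triangle A B C"
  proof -
    have "angle_at A B C < pi / 2 \<and> angle_at B C A < pi / 2 \<and> angle_at C A B < pi / 2"
      using that unfolding acute_triangle_def triangle_angles_def by auto
    then show ?thesis unfolding \<alpha>_def \<beta>_def \<gamma>_def
      using angle_at_sector(1)[OF tri] angle_at_sector(1)[OF n(1)] angle_at_sector(1)[OF n(2)] by blast
  qed
  have iso: "a = b \<or> b = c \<or> c = a" if "isosceles_triangle A B C"
    using that unfolding isosceles_triangle_def a_def b_def c_def by auto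
  have R: ratios unfolding ratios_def
  proof (intro ballI impI)
    fix x y assume xy: "x \<in> {a, b, c}" "y \<in> {a, b, c}" "y / x \<in> \<rat>"
    let ?t = "sqrt (real r)"
    have S: "?t * x \<in> side_lengths A B C" "?t * y \<in> side_lengths A B C"
      using xy t_pos unfolding side_lengths_def a_def b_def c_def by auto
    have e: "(?t * y) / (?t * x) = y / x" using t_pos by simp
    then have "y / x = 1" using assms(2) S xy(3) by metis
    then show "y = x" by (simp add: divide_eq_1_iff)
  qed
  have "admissible" unfolding admissible_def using R obl ac iso assms(3) by blast
  then show "trivial_reptiling A B C \<P>"
    unfolding trivial_reptiling_def by (intro trivial_admissible[of r]) simp_all
qed

end
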